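(* Let $0<\alpha<2$, let $X$ be a stationary $S\alpha S$ process, and let $X=X_s^1+X_s^2+X_s^3$ (equality in distribution, independent summands) be its Samorodnitsky decomposition, where $X_s^1$ is a mixed moving average process, $X_s^2$ is associated to a conservative null flow and $X_s^3$ is associated to a positive flow. Then $X_s^1$ has a dissipative L\'evy measure, $X_s^1+X_s^2$ has a L\'evy measure of type $\mathbf{II}_\infty$, and $X_s^3$ has a L\'evy measure of type $\mathbf{II}_1$.
   Context: **L\'evy measures.** $T$ is the shift on $\mathbb{R}^{\mathbb{Z}}$. The L\'evy measure of a stationary infinitely divisible process $X$ without Gaussian part is the $\sigma$-finite shift-invariant measure $Q$ on $\mathbb{R}^{\mathbb{Z}}$ with $Q\{0\}=0$, $\int(x_0^2\wedge1)\,Q(dx)<\infty$ and, up to a constant drift term $i\langle a,b_\infty\rangle$ in the exponent ($b_\infty$ a constant sequence), $\mathbb{E}[\exp i\langle a,X\rangle]=\exp\int(e^{i\langle a,x\rangle}-1-i\langle c(x),a\rangle)\,Q(dx)$ for all finitely supported $a$, where $c(x)_i=\max(-1,\min(1,x_i))$. A process is $S\alpha S$ if it is $\alpha$-stable (its L\'evy measure satisfies $Q=b^{-\alpha}S_b^\star(Q)$ for all $b>0$, with $S_b^\star(Q)$ the image of $Q$ under $\{x_n\}\mapsto\{bx_n\}$) and its distribution is invariant under $x\mapsto-x$. **Types.** A L\'evy measure $Q$ is dissipative if $\mathbb{R}^{\mathbb{Z}}$ is, mod $Q$, the measurable union of all wandering sets ($A$ is wandering if the sets $T^{-n}A$, $n\in\mathbb{Z}$,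 are disjoint). It is of type $\mathbf{II}_\infty$ if there is no $T$-invariant probability measure absolutely continuous with respect to $Q$; of type $\mathbf{II}_1$ if there is a $T$-invariant probability measure equivalent to $Q$. The zero measure is considered to satisfy each property (a component may be trivial). **Samorodnitsky decomposition.** A stationary $S\alpha S$ process can be represented in distribution as $X_n=\int_S f_n\,dM$, where $M$ is an $S\alpha S$ random measure on a standard Borel space $S$ with $\sigma$-finite control measure $m$, and $$f_n=a_n\Big(\frac{d(m\circ\varphi^n)}{dm}\Big)^{1/\alpha}f\circ\varphi^n,$$ with $\varphi$ an invertible bimeasurable nonsingular map of $(S,m)$ (the "flow"), $f\in L^\alpha(m)$, $a_n:S\to\{-1,1\}$ satisfying $a_{n+k}=a_n\cdot(a_k\circ\varphi^n)$, and $\bigcup_n\{f_n\ne0\}=S$ mod $m$. Let $D$ and $C$ be the dissipative and conservative parts of $\varphi$. Let $P$ be the positive part of $\varphi$, i.e. the largest (mod $m$) $\varphi$-invariant set such that $m_{|P}$ is equivalent to a finite $\varphi$-invariant measure, and let $N=S\setminus P$ be the null part; one has $D\subset N$. Then $X_s^1=\{\int_D f_n\,dM\}_n$, $X_s^2=\{\int_{C\cap N}f_n\,dM\}_n$, $X_s^3=\{\int_P f_n\,dM\}_n$; their distributions do not depend on the representation chosen. $X_s^1$ is a mixed moving average, i.e. has the distribution of $\{\int_{W\times\mathbb{Z}}g(w,n+k)\,dM'(w,k)\}_n$, where $M'$ is $S\alpha S$ with control measure the product of a $\sigma$-finite measure on $W$ and the counting measure. *)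

theory Defs
  imports "HOL-Probability.Probability"
begin

section \<open>Invertible maps of a measurable space\<close>

text \<open>Bi-infinite iterates of a bijection \<open>\<phi>\<close> of the space of \<open>M\<close>.\<close>

definition int_iterate :: "'s measure \<Rightarrow> ('s \<Rightarrow> 's) \<Rightarrow> int \<Rightarrow> 's \<Rightarrow> 's" where
  "int_iterate M \<phi> n =
     (if 0 \<le> n then \<phi> ^^ nat n else (the_inv_into (space M) \<phi>) ^^ nat (- n))"

definition equivalent_measures :: "'s measure \<Rightarrow> 's measure \<Rightarrow> bool" where
  "equivalent_measures M N \<longleftrightarrow>
     sets M = sets N \<and> absolutely_continuous M N \<and> absolutely_continuous N M"

definition invariant_measure :: "('s \<Rightarrow> 's) \<Rightarrow> 's measure \<Rightarrow> bool" where
  "invariant_measure \<phi> \<mu> \<longleftrightarrow> \<phi> \<in> measurable \<mu> \<mu> \<and> distr \<mu> \<mu> \<phi> = \<mu>"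

definition nonsingular_flow :: "'s measure \<Rightarrow> ('s \<Rightarrow> 's) \<Rightarrow> bool" where
  "nonsingular_flow m \<phi> \<longleftrightarrow>
     bij_betw \<phi> (space m) (space m) \<and>
     \<phi> \<in> measurable m m \<and>
     the_inv_into (space m) \<phi> \<in> measurable m m \<and>
     (\<forall>A\<in>sets m. emeasure m (\<phi> -` A \<inter> space m) = 0 \<longleftrightarrow> emeasure m A = 0)"

definition wandering :: "'s measure \<Rightarrow> ('s \<Rightarrow> 's) \<Rightarrow> 's set \<Rightarrow> bool" where
  "wandering M \<phi> A \<longleftrightarrow>
     A \<in> sets M \<and> disjoint_family (\<lambda>n::int. int_iterate M \<phi> n -` A \<inter> space M)"

text \<open>The measurable union of a (possibly uncountable) family of measurable sets is its
  least measurable upper bound modulo null sets; it is determined modulo \<open>M\<close>.\<close>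

definition measurable_union :: "'s measure \<Rightarrow> 's set set \<Rightarrow> 's set \<Rightarrow> bool" where
  "measurable_union M \<A> U \<longleftrightarrow>
     U \<in> sets M \<and>
     (\<forall>A\<in>\<A>. A - U \<in> null_sets M) \<and>
     (\<forall>V\<in>sets M. (\<forall>A\<in>\<A>. A - V \<in> null_sets M) \<longrightarrow> U - V \<in> null_sets M)"

definition dissipative_part :: "'s measure \<Rightarrow> ('s \<Rightarrow> 's) \<Rightarrow> 's set \<Rightarrow> bool" where
  "dissipative_part M \<phi> D \<longleftrightarrow> measurable_union M {A. wandering M \<phi> A} D"

text \<open>Invariance of a set is understood modulo \<open>m\<close>. The restriction of \<open>m\<close> to \<open>P\<close> is
  regarded as a measure on the whole space, living on \<open>P\<close>.\<close>

definition positive_set :: "'s measure \<Rightarrow> ('s \<Rightarrow> 's) \<Rightarrow> 's set \<Rightarrow> bool" where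
  "positive_set m \<phi> P \<longleftrightarrow>
     P \<in> sets m \<and>
     sym_diff (\<phi> -` P \<inter> space m) P \<in> null_sets m \<and>
     (\<exists>\<mu>. finite_measure \<mu> \<and> equivalent_measures (density m (indicator P)) \<mu> \<and>
          invariant_measure \<phi> \<mu>)"

definition positive_part :: "'s measure \<Rightarrow> ('s \<Rightarrow> 's) \<Rightarrow> 's set \<Rightarrow> bool" where
  "positive_part m \<phi> P \<longleftrightarrow>
     positive_set m \<phi> P \<and> (\<forall>P'. positive_set m \<phi> P' \<longrightarrow> P' - P \<in> null_sets m)"

definition standard_borel :: "'s measure \<Rightarrow> bool" where
  "standard_borel M \<longleftrightarrow>
     (\<exists>X. topspace X = space M \<and> completely_metrizable_space X \<and> second_countable X \<and>
          sets M = sigma_sets (topspace X) {U. openin X U})"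


section \<open>Processes indexed by the integers and Levy measures\<close>

abbreviation seq_space :: "(int \<Rightarrow> real) measure" where
  "seq_space \<equiv> Pi\<^sub>M UNIV (\<lambda>_::int. (borel :: real measure))"

definition law :: "'w measure \<Rightarrow> (int \<Rightarrow> 'w \<Rightarrow> real) \<Rightarrow> (int \<Rightarrow> real) measure" where
  "law \<Omega> X = distr \<Omega> seq_space (\<lambda>\<omega> n. X n \<omega>)"

definition shift :: "(int \<Rightarrow> real) \<Rightarrow> (int \<Rightarrow> real)" where
  "shift x = (\<lambda>n. x (n + 1))"

definition pairing :: "(int \<Rightarrow> real) \<Rightarrow> (int \<Rightarrow> real) \<Rightarrow> real" where
  "pairing a x = (\<Sum>n | a n \<noteq> 0. a n * x n)"

definition truncate_seq :: "(int \<Rightarrow> real) \<Rightarrow> (int \<Rightarrow> real)" where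
  "truncate_seq x = (\<lambda>n. max (- 1) (min 1 (x n)))"

text \<open>\<open>Q\<close> is the Levy measure of a stationary infinitely divisible law \<open>\<mu>\<close> without Gaussian
  part. The integrand of the exponent is \<open>Q\<close>-integrable as soon as the preceding
  conditions hold, so the Bochner integral never takes its default value.\<close>

definition levy_measure :: "(int \<Rightarrow> real) measure \<Rightarrow> (int \<Rightarrow> real) measure \<Rightarrow> bool" where
  "levy_measure \<mu> Q \<longleftrightarrow>
     sets Q = sets seq_space \<and> sigma_finite_measure Q \<and> invariant_measure shift Q \<and>
     emeasure Q {\<lambda>_. 0} = 0 \<and>
     (\<integral>\<^sup>+x. ennreal (min ((x 0)\<^sup>2) 1) \<partial>Q) < \<infinity> \<and>
     (\<exists>b::real. \<forall>a. finite {n. a n \<noteq> 0} \<longrightarrow>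
        (\<integral>x. iexp (pairing a x) \<partial>\<mu>) =
          exp (\<i> * complex_of_real (pairing a (\<lambda>_. b)) +
               (\<integral>x. iexp (pairing a x) - 1 - \<i> * complex_of_real (pairing a (truncate_seq x)) \<partial>Q)))"

definition stationary_sas :: "real \<Rightarrow> (int \<Rightarrow> real) measure \<Rightarrow> bool" where
  "stationary_sas \<alpha> \<mu> \<longleftrightarrow>
     prob_space \<mu> \<and> sets \<mu> = sets seq_space \<and> invariant_measure shift \<mu> \<and>
     (\<exists>Q. levy_measure \<mu> Q \<and>
        (\<forall>b>0. Q = scale_measure (ennreal (b powr (- \<alpha>))) (distr Q seq_space (\<lambda>x n. b * x n)))) \<and>
     distr \<mu> seq_space (\<lambda>x n. - x n) = \<mu>"

definition levy_dissipative :: "(int \<Rightarrow> real) measure \<Rightarrow> bool" where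
  "levy_dissipative Q \<longleftrightarrow> dissipative_part Q shift (space Q)"

definition type_II_infinity :: "(int \<Rightarrow> real) measure \<Rightarrow> bool" where
  "type_II_infinity Q \<longleftrightarrow>
     \<not> (\<exists>\<nu>. prob_space \<nu> \<and> sets \<nu> = sets Q \<and> invariant_measure shift \<nu> \<and>
            absolutely_continuous Q \<nu>)"

text \<open>By convention the zero measure has every type; for the two properties above this is
  already a consequence of the definition.\<close>

definition type_II_1 :: "(int \<Rightarrow> real) measure \<Rightarrow> bool" where
  "type_II_1 Q \<longleftrightarrow>
     emeasure Q (space Q) = 0 \<or>
     (\<exists>\<nu>. prob_space \<nu> \<and> invariant_measure shift \<nu> \<and> equivalent_measures Q \<nu>)"


section \<open>Stable random measures and stochastic integrals\<close>

text \<open>An independently scattered, sigma-additive random set function on the measurable sets of finite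
  \<open>m\<close>-measure, normalised so that \<open>M A\<close> has characteristic function
  \<open>\<theta> \<mapsto> exp (- m(A) |\<theta>|\<^sup>\<alpha>)\<close>.\<close>

definition sas_random_measure ::
    "real \<Rightarrow> 's measure \<Rightarrow> 'w measure \<Rightarrow> ('s set \<Rightarrow> 'w \<Rightarrow> real) \<Rightarrow> bool" where
  "sas_random_measure \<alpha> m \<Omega> M \<longleftrightarrow>
     prob_space \<Omega> \<and>
     (\<forall>A\<in>sets m. emeasure m A < \<infinity> \<longrightarrow>
        M A \<in> borel_measurable \<Omega> \<and>
        (\<forall>\<theta>::real. (\<integral>\<omega>. iexp (\<theta> * M A \<omega>) \<partial>\<Omega>) =
           complex_of_real (exp (- (measure m A * \<bar>\<theta>\<bar> powr \<alpha>))))) \<and>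
     (\<forall>A::nat \<Rightarrow> 's set. disjoint_family A \<longrightarrow>
        (\<forall>k. A k \<in> sets m \<and> emeasure m (A k) < \<infinity>) \<longrightarrow>
        prob_space.indep_vars \<Omega> (\<lambda>_. borel) (\<lambda>k. M (A k)) UNIV \<and>
        (emeasure m (\<Union>k. A k) < \<infinity> \<longrightarrow>
           (AE \<omega> in \<Omega>. (\<lambda>k. M (A k) \<omega>) sums M (\<Union>k. A k) \<omega>)))"

definition L_alpha :: "real \<Rightarrow> 's measure \<Rightarrow> ('s \<Rightarrow> real) \<Rightarrow> bool" where
  "L_alpha \<alpha> m f \<longleftrightarrow>
     f \<in> borel_measurable m \<and> (\<integral>\<^sup>+s. ennreal (\<bar>f s\<bar> powr \<alpha>) \<partial>m) < \<infinity>"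

definition integrable_simple :: "'s measure \<Rightarrow> ('s \<Rightarrow> real) \<Rightarrow> bool" where
  "integrable_simple m g \<longleftrightarrow>
     simple_function m g \<and> emeasure m {s\<in>space m. g s \<noteq> 0} < \<infinity>"

definition simple_stoch_integral ::
    "'s measure \<Rightarrow> ('s set \<Rightarrow> 'w \<Rightarrow> real) \<Rightarrow> ('s \<Rightarrow> real) \<Rightarrow> 'w \<Rightarrow> real" where
  "simple_stoch_integral m M g \<omega> =
     (\<Sum>y\<in>g ` space m - {0}. y * M (g -` {y} \<inter> space m) \<omega>)"

definition tends_in_probability ::
    "'w measure \<Rightarrow> (nat \<Rightarrow> 'w \<Rightarrow> real) \<Rightarrow> ('w \<Rightarrow> real) \<Rightarrow> bool" where
  "tends_in_probability \<Omega> Z Y \<longleftrightarrow>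
     (\<forall>\<epsilon>>0. (\<lambda>k. measure \<Omega> {\<omega>\<in>space \<Omega>. \<epsilon> < \<bar>Z k \<omega> - Y \<omega>\<bar>}) \<longlonglongrightarrow> 0)"

text \<open>\<open>Y\<close> is (a version of) the stochastic integral of \<open>f\<close> with respect to \<open>M\<close>: a limit in
  probability of the integrals of simple functions approximating \<open>f\<close> in \<open>L\<^sup>\<alpha>(m)\<close>.\<close>

definition has_stoch_integral ::
    "real \<Rightarrow> 's measure \<Rightarrow> 'w measure \<Rightarrow> ('s set \<Rightarrow> 'w \<Rightarrow> real) \<Rightarrow> ('s \<Rightarrow> real) \<Rightarrow> ('w \<Rightarrow> real) \<Rightarrow> bool"
  where
  "has_stoch_integral \<alpha> m \<Omega> M f Y \<longleftrightarrow>
     L_alpha \<alpha> m f \<and> Y \<in> borel_measurable \<Omega> \<and>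
     (\<exists>g::nat \<Rightarrow> 's \<Rightarrow> real.
        (\<forall>k. integrable_simple m (g k)) \<and>
        ((\<lambda>k. \<integral>\<^sup>+s. ennreal (\<bar>g k s - f s\<bar> powr \<alpha>) \<partial>m) \<longlonglongrightarrow> 0) \<and>
        tends_in_probability \<Omega> (\<lambda>k. simple_stoch_integral m M (g k)) Y)"


section \<open>Representation by a nonsingular flow\<close>

definition sign_cocycle :: "'s measure \<Rightarrow> ('s \<Rightarrow> 's) \<Rightarrow> (int \<Rightarrow> 's \<Rightarrow> real) \<Rightarrow> bool" where
  "sign_cocycle m \<phi> a \<longleftrightarrow>
     (\<forall>n. a n \<in> borel_measurable m) \<and>
     (\<forall>n. \<forall>s\<in>space m. a n s \<in> {- 1, 1}) \<and>
     (\<forall>n k. \<forall>s\<in>space m. a (n + k) s = a n s * a k (int_iterate m \<phi> n s))"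

text \<open>The measure \<open>m \<circ> \<phi>\<^sup>n\<close>, that is \<open>A \<mapsto> m(\<phi>\<^sup>n(A))\<close>, is the image of \<open>m\<close> under
  \<open>\<phi>\<close> iterated \<open>- n\<close> times.\<close>

definition flow_kernel ::
    "real \<Rightarrow> 's measure \<Rightarrow> ('s \<Rightarrow> 's) \<Rightarrow> (int \<Rightarrow> 's \<Rightarrow> real) \<Rightarrow> ('s \<Rightarrow> real) \<Rightarrow> int \<Rightarrow> 's \<Rightarrow> real"
  where
  "flow_kernel \<alpha> m \<phi> a f n s =
     a n s * enn2real (RN_deriv m (distr m m (int_iterate m \<phi> (- n))) s) powr (1 / \<alpha>) *
     f (int_iterate m \<phi> n s)"

definition flow_representation ::
    "real \<Rightarrow> 's measure \<Rightarrow> ('s \<Rightarrow> 's) \<Rightarrow> (int \<Rightarrow> 's \<Rightarrow> real) \<Rightarrow> ('s \<Rightarrow> real) \<Rightarrow> bool" where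
  "flow_representation \<alpha> m \<phi> a f \<longleftrightarrow>
     standard_borel m \<and> sigma_finite_measure m \<and> nonsingular_flow m \<phi> \<and>
     sign_cocycle m \<phi> a \<and> L_alpha \<alpha> m f \<and>
     (AE s in m. \<exists>n. flow_kernel \<alpha> m \<phi> a f n s \<noteq> 0)"

text \<open>\<open>Y\<close> is the process \<open>n \<mapsto> \<integral>\<^sub>B f\<^sub>n dM\<close>.\<close>

definition integral_process_over ::
    "real \<Rightarrow> 's measure \<Rightarrow> 'w measure \<Rightarrow> ('s set \<Rightarrow> 'w \<Rightarrow> real) \<Rightarrow> (int \<Rightarrow> 's \<Rightarrow> real) \<Rightarrow> 's set \<Rightarrow>
     (int \<Rightarrow> 'w \<Rightarrow> real) \<Rightarrow> bool" where
  "integral_process_over \<alpha> m \<Omega> M F B Y \<longleftrightarrow>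
     (\<forall>n. has_stoch_integral \<alpha> m \<Omega> M (\<lambda>s. indicator B s * F n s) (Y n))"

end

theory Submission
  imports Defs
begin

text \<open>The process \<open>\<integral>\<^sub>B f\<^sub>n dM\<close> has as its Levy measure the image of
  \<open>1\<^sub>B m \<otimes> K \<bar>r\<bar>\<^bsup>-1-\<alpha>\<^esup> dr\<close> under \<open>(s, r) \<mapsto> (r f\<^sub>n(s))\<^sub>n\<close>. This map intertwines the shift
  with the measure preserving extension \<open>\<Phi>(s, r) = (\<phi> s, a\<^sub>1(s) w(s)\<^bsup>1/\<alpha>\<^esup> r)\<close> of the flow, where
  \<open>w = d(m \<circ> \<phi>)/dm\<close>. On \<open>D\<close> one has \<open>\<Sum>\<^sub>n \<bar>f\<^sub>n\<bar>\<^sup>\<alpha> < \<infinity>\<close>, so that almost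
  every sequence attains its maximal modulus, and the first place where it does so exhibits
  wandering sets that exhaust the space. If \<open>p dm\<close> is a finite invariant measure on \<open>P\<close>, then
  \<open>min((p(s)\<^bsup>1/\<alpha>\<^esup> r)\<^sup>2, 1)\<close> is an integrable \<open>\<Phi>\<close>-invariant density, whose image is a finite
  shift-invariant measure equivalent to the Levy measure. Conversely, a shift-invariant probability
  absolutely continuous with respect to the Levy measure of \<open>S \<setminus> P\<close> lifts along the
  map and projects to a finite \<open>\<phi>\<close>-invariant measure on \<open>S \<setminus> P\<close>, against the
  maximality of \<open>P\<close>.\<close>

section \<open>Stable stochastic integrals\<close>

text \<open>The processes enter only through their characteristic functions, with exponent minus the
  integral of \<open>\<bar>\<Sum>\<^sub>n b\<^sub>n f\<^sub>n\<bar> powr \<alpha>\<close>. The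
  constant K makes the radial integral of 1 - cos (y r) equal to
  \<open>\<bar>y\<bar> powr \<alpha>\<close>; this rewrites the exponent as a Levy-Khintchine
  integral, whose odd part vanishes by symmetry.

  The map to sequences need not be injective, so wandering sets of the flow cannot simply be carried
  over as images. Dissipativity is therefore read off the sequences themselves, while invariant
  measures travel as densities, which can be pushed forward or composed with the map.

  The radial measure is infinite near 0, hence a finite invariant measure needs a radial weight; the
  truncated square is integrable for 0 < \<alpha> < 2 and vanishes only at 0, so that equivalence is
  kept.

  A finite invariant measure gives no mass to a wandering set. Therefore D misses P up to a null
  set, and D together with the conservative null part fills the complement of P: the sum of the
  first two components is a single integral over that complement.\<close>

locale sas_integration =
  fixes \<alpha> :: real and m :: "'s measure" and \<Omega> :: "'w measure" and M :: "'s set \<Rightarrow> 'w \<Rightarrow> real"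
  assumes alpha_pos: "0 < \<alpha>" and sas: "sas_random_measure \<alpha> m \<Omega> M"
begin

sublocale prob_space \<Omega>
  using sas by (simp add: sas_random_measure_def)

lemma M_measurable:
  "A \<in> sets m \<Longrightarrow> emeasure m A < \<infinity> \<Longrightarrow> M A \<in> borel_measurable \<Omega>"
  using sas by (simp add: sas_random_measure_def)

lemma M_char:
  "A \<in> sets m \<Longrightarrow> emeasure m A < \<infinity> \<Longrightarrow>
    (\<integral>\<omega>. iexp (\<theta> * M A \<omega>) \<partial>\<Omega>) = complex_of_real (exp (- (measure m A * \<bar>\<theta>\<bar> powr \<alpha>)))"
  using sas by (simp add: sas_random_measure_def)

lemma M_indep:
  fixes A :: "nat \<Rightarrow> 's set"
  assumes "disjoint_family A" "\<And>k. A k \<in> sets m" "\<And>k. emeasure m (A k) < \<infinity>"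
  shows "indep_vars (\<lambda>_. borel) (\<lambda>k. M (A k)) UNIV"
  using sas assms by (simp add: sas_random_measure_def)

lemma M_sums:
  fixes A :: "nat \<Rightarrow> 's set"
  assumes "disjoint_family A" "\<And>k. A k \<in> sets m" "\<And>k. emeasure m (A k) < \<infinity>"
    "emeasure m (\<Union>k. A k) < \<infinity>"
  shows "AE \<omega> in \<Omega>. (\<lambda>k. M (A k) \<omega>) sums M (\<Union>k. A k) \<omega>"
  using sas assms by (simp add: sas_random_measure_def)

text \<open>Sigma-additivity for the constant sequence of empty sets makes a constant series
  converge, so its term is 0.\<close>

lemma M_empty: "AE \<omega> in \<Omega>. M {} \<omega> = 0"
proof -
  have "AE \<omega> in \<Omega>. (\<lambda>k::nat. M {} \<omega>) sums M (\<Union>k::nat. {}) \<omega>"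
    by (rule M_sums) (auto simp: disjoint_family_on_def)
  then show ?thesis
    by eventually_elim (auto dest!: sums_summable simp: summable_const_iff)
qed

section \<open>Finite families of disjoint sets\<close>

text \<open>The axioms of a random measure speak of sequences of sets; a finite family is brought
  into that form by enumerating it and padding with empty sets.\<close>

lemma nat_enumeration:
  fixes A :: "'i \<Rightarrow> 's set"
  assumes J: "finite J" and disj: "disjoint_family_on A J"
    and A: "\<And>j. j \<in> J \<Longrightarrow> A j \<in> sets m" "\<And>j. j \<in> J \<Longrightarrow> emeasure m (A j) < \<infinity>"
  obtains e B where "bij_betw e {..<card J} J" "disjoint_family B"
    "\<And>k::nat. k < card J \<Longrightarrow> B k = A (e k)" "\<And>k. \<not> k < card J \<Longrightarrow> B k = {}"
    "\<And>k. B k \<in> sets m" "\<And>k. emeasure m (B k) < \<infinity>" "(\<Union>k. B k) = (\<Union>j\<in>J. A j)"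
proof -
  obtain e where e: "bij_betw e {..<card J} J"
    using ex_bij_betw_nat_finite[OF J] by (auto simp: atLeast0LessThan)
  have eJ: "e k \<in> J" if "k < card J" for k
    using e that by (auto simp: bij_betw_def)
  define B where "B k = (if k < card J then A (e k) else {})" for k
  have disjB: "disjoint_family B"
    unfolding disjoint_family_on_def
  proof (intro ballI impI)
    fix k l :: nat assume "k \<noteq> l"
    show "B k \<inter> B l = {}"
    proof (cases "k < card J \<and> l < card J")
      case True
      then have "e k \<noteq> e l"
        using e \<open>k \<noteq> l\<close> by (auto simp: bij_betw_def dest: inj_onD)
      then have "A (e k) \<inter> A (e l) = {}"
        using disj eJ True by (auto simp only: disjoint_family_on_def)
      with True show ?thesis by (simp add: B_def)
    qed (auto simp: B_def)
  qed
  have "(\<Union>k. B k) = (\<Union>k<card J. A (e k))"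
    by (auto simp: B_def split: if_splits)
  also have "\<dots> = (\<Union>j\<in>e ` {..<card J}. A j)"
    by simp
  also have "\<dots> = (\<Union>j\<in>J. A j)"
    by (simp only: bij_betw_imp_surj_on[OF e])
  finally have B_Union: "(\<Union>k. B k) = (\<Union>j\<in>J. A j)" .
  show ?thesis
  proof (rule that[OF e disjB])
    show "B k \<in> sets m" "emeasure m (B k) < \<infinity>" for k
      using eJ[of k] A[of "e k"] by (simp_all add: B_def)
  qed (simp_all add: B_Union, simp_all add: B_def)
qed

lemma M_finite_additive:
  fixes A :: "'i \<Rightarrow> 's set"
  assumes J: "finite J" and disj: "disjoint_family_on A J"
    and A: "\<And>j. j \<in> J \<Longrightarrow> A j \<in> sets m" "\<And>j. j \<in> J \<Longrightarrow> emeasure m (A j) < \<infinity>"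
  shows "AE \<omega> in \<Omega>. M (\<Union>j\<in>J. A j) \<omega> = (\<Sum>j\<in>J. M (A j) \<omega>)"
proof -
  obtain e and B :: "nat \<Rightarrow> 's set" where e: "bij_betw e {..<card J} J" and B: "disjoint_family B"
    "\<And>k. k < card J \<Longrightarrow> B k = A (e k)" "\<And>k. \<not> k < card J \<Longrightarrow> B k = {}"
    "\<And>k. B k \<in> sets m" "\<And>k. emeasure m (B k) < \<infinity>" "(\<Union>k. B k) = (\<Union>j\<in>J. A j)"
    using nat_enumeration[OF J disj A] by metis
  have "emeasure m (\<Union>j\<in>J. A j) \<le> (\<Sum>j\<in>J. emeasure m (A j))"
    by (intro emeasure_subadditive_finite) (use J A in auto)
  also have "\<dots> < \<infinity>"
    using J A(2) by (simp add: ennreal_sum_less_top flip: top.not_eq_extremum)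
  finally have "AE \<omega> in \<Omega>. (\<lambda>k. M (B k) \<omega>) sums M (\<Union>k. B k) \<omega>"
    by (intro M_sums B) (simp add: B)
  with M_empty show ?thesis
  proof eventually_elim
    case (elim \<omega>)
    have "(\<lambda>k. M (B k) \<omega>) sums (\<Sum>k<card J. M (B k) \<omega>)"
      by (rule sums_finite) (use elim B in auto)
    then have "M (\<Union>k. B k) \<omega> = (\<Sum>k<card J. M (A (e k)) \<omega>)"
      using elim(2) B(2) by (simp add: sums_unique2)
    also have "\<dots> = (\<Sum>j\<in>J. M (A j) \<omega>)"
      by (rule sum.reindex_bij_betw[OF e])
    finally show ?case by (simp add: B)
  qed
qed

text \<open>Independence over disjoint sets turns the characteristic function of the sum into a
  product. The coefficients are absorbed into the variables, so that \<open>char\<close> is needed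
  only at 1.\<close>

lemma char_linear_combination:
  fixes A :: "'i \<Rightarrow> 's set" and c :: "'i \<Rightarrow> real"
  assumes J: "finite J" and disj: "disjoint_family_on A J"
    and A: "\<And>j. j \<in> J \<Longrightarrow> A j \<in> sets m" "\<And>j. j \<in> J \<Longrightarrow> emeasure m (A j) < \<infinity>"
  shows "(\<integral>\<omega>. iexp (\<Sum>j\<in>J. c j * M (A j) \<omega>) \<partial>\<Omega>) =
    complex_of_real (exp (- (\<Sum>j\<in>J. measure m (A j) * \<bar>c j\<bar> powr \<alpha>)))"
proof -
  obtain e and B :: "nat \<Rightarrow> 's set" where e: "bij_betw e {..<card J} J" and B: "disjoint_family B"
    "\<And>k. k < card J \<Longrightarrow> B k = A (e k)" "\<And>k. \<not> k < card J \<Longrightarrow> B k = {}"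
    "\<And>k. B k \<in> sets m" "\<And>k. emeasure m (B k) < \<infinity>" "(\<Union>k. B k) = (\<Union>j\<in>J. A j)"
    using nat_enumeration[OF J disj A] by metis
  let ?X = "\<lambda>k \<omega>. c (e k) * M (B k) \<omega>"
  have meas[measurable]: "M (B k) \<in> borel_measurable \<Omega>" for k
    by (rule M_measurable) (use B in auto)
  have "indep_vars (\<lambda>_. borel) (\<lambda>k. M (B k)) UNIV"
    by (intro M_indep B)
  then have "indep_vars (\<lambda>_. borel) (\<lambda>k. M (B k)) {..<card J}"
    by (rule indep_vars_subset) auto
  then have ind: "indep_vars (\<lambda>_. borel) ?X {..<card J}"
    by (rule indep_vars_compose2[where Y="\<lambda>k x. c (e k) * x"]) auto
  have "(\<integral>\<omega>. iexp (\<Sum>j\<in>J. c j * M (A j) \<omega>) \<partial>\<Omega>) = (\<integral>\<omega>. iexp (\<Sum>k<card J. ?X k \<omega>) \<partial>\<Omega>)"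
  proof -
    have "(\<Sum>j\<in>J. c j * M (A j) \<omega>) = (\<Sum>k<card J. ?X k \<omega>)" for \<omega>
      by (subst sum.reindex_bij_betw[OF e, symmetric]) (simp add: B(2))
    then show ?thesis by simp
  qed
  also have "\<dots> = char (distr \<Omega> borel (\<lambda>\<omega>. \<Sum>k<card J. ?X k \<omega>)) 1"
    by (simp add: char_def integral_distr)
  also have "\<dots> = (\<Prod>k<card J. char (distr \<Omega> borel (?X k)) 1)"
    by (rule char_distr_sum[OF ind])
  also have "\<dots> = (\<Prod>k<card J. complex_of_real (exp (- (measure m (A (e k)) * \<bar>c (e k)\<bar> powr \<alpha>))))"
  proof (rule prod.cong[OF refl])
    fix k assume k: "k \<in> {..<card J}"
    have "char (distr \<Omega> borel (?X k)) 1 = (\<integral>\<omega>. iexp (c (e k) * M (B k) \<omega>) \<partial>\<Omega>)"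
      by (simp add: char_def integral_distr)
    also have "\<dots> = complex_of_real (exp (- (measure m (B k) * \<bar>c (e k)\<bar> powr \<alpha>)))"
      by (rule M_char) (use B in auto)
    finally show "char (distr \<Omega> borel (?X k)) 1 =
        complex_of_real (exp (- (measure m (A (e k)) * \<bar>c (e k)\<bar> powr \<alpha>)))"
      using k B(2) by simp
  qed
  also have "\<dots> = complex_of_real (\<Prod>k<card J. exp (- (measure m (A (e k)) * \<bar>c (e k)\<bar> powr \<alpha>)))"
    by (rule of_real_prod[symmetric])
  also have "\<dots> = complex_of_real (exp (- (\<Sum>k<card J. measure m (A (e k)) * \<bar>c (e k)\<bar> powr \<alpha>)))"
    by (simp add: exp_sum flip: sum_negf)
  also have "(\<Sum>k<card J. measure m (A (e k)) * \<bar>c (e k)\<bar> powr \<alpha>) =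
      (\<Sum>j\<in>J. measure m (A j) * \<bar>c j\<bar> powr \<alpha>)"
    by (rule sum.reindex_bij_betw[OF e])
  finally show ?thesis .
qed

section \<open>Integrals of simple functions\<close>

lemma integrable_simple_vimage:
  assumes g: "integrable_simple m g" and y: "y \<noteq> 0"
  shows "g -` {y} \<inter> space m \<in> sets m" "emeasure m (g -` {y} \<inter> space m) < \<infinity>"
proof -
  have s: "simple_function m g" and f: "emeasure m {s \<in> space m. g s \<noteq> 0} < \<infinity>"
    using g by (auto simp: integrable_simple_def)
  show "g -` {y} \<inter> space m \<in> sets m"
    by (rule simple_functionD[OF s])
  have [measurable]: "g \<in> borel_measurable m"
    using s by (rule borel_measurable_simple_function)
  have "emeasure m (g -` {y} \<inter> space m) \<le> emeasure m {s \<in> space m. g s \<noteq> 0}"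
    by (rule emeasure_mono) (use y in auto)
  with f show "emeasure m (g -` {y} \<inter> space m) < \<infinity>" by simp
qed

text \<open>Finite additivity of \<open>M\<close> holds only almost surely, so integrals of
  different simple functions become comparable only over a common partition, here the level sets of
  \<open>G\<close>. Taking for \<open>G\<close> a pair of simple functions gives additivity, taking
  a single one gives homogeneity.\<close>

lemma simple_stoch_integral_refine:
  fixes G :: "'s \<Rightarrow> 'b" and u :: "'b \<Rightarrow> real"
  assumes g: "integrable_simple m (\<lambda>s. u (G s))" and G: "simple_function m G"
  shows "AE \<omega> in \<Omega>. simple_stoch_integral m M (\<lambda>s. u (G s)) \<omega> =
    (\<Sum>v\<in>{v\<in>G ` space m. u v \<noteq> 0}. u v * M (G -` {v} \<inter> space m) \<omega>)"
proof -
  let ?g = "\<lambda>s. u (G s)" and ?V = "{v\<in>G ` space m. u v \<noteq> 0}"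
  let ?Y = "?g ` space m - {0}"
  have finV: "finite ?V" and finY: "finite ?Y"
    using simple_functionD(1)[OF G] g simple_functionD(1) by (auto simp: integrable_simple_def)
  have "AE \<omega> in \<Omega>. \<forall>y\<in>?Y. M (?g -` {y} \<inter> space m) \<omega> =
      (\<Sum>v\<in>{v\<in>?V. u v = y}. M (G -` {v} \<inter> space m) \<omega>)"
  proof (rule AE_finite_allI[OF finY])
    fix y assume y: "y \<in> ?Y"
    have *: "emeasure m (G -` {v} \<inter> space m) < \<infinity>" if "u v \<noteq> 0" for v
    proof -
      have "emeasure m (G -` {v} \<inter> space m) \<le> emeasure m (?g -` {u v} \<inter> space m)"
        by (rule emeasure_mono) (use integrable_simple_vimage(1)[OF g that] in auto)
      with integrable_simple_vimage(2)[OF g that] show ?thesis by simp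
    qed
    have "?g -` {y} \<inter> space m = (\<Union>v\<in>{v\<in>?V. u v = y}. G -` {v} \<inter> space m)"
      using y by auto
    moreover have "AE \<omega> in \<Omega>. M (\<Union>v\<in>{v\<in>?V. u v = y}. G -` {v} \<inter> space m) \<omega> =
      (\<Sum>v\<in>{v\<in>?V. u v = y}. M (G -` {v} \<inter> space m) \<omega>)"
      by (rule M_finite_additive)
        (use finV y * simple_functionD(2)[OF G] in
          \<open>auto simp: disjoint_family_on_def intro: finite_subset[OF _ finV]\<close>)
    ultimately show "AE \<omega> in \<Omega>. M (?g -` {y} \<inter> space m) \<omega> =
      (\<Sum>v\<in>{v\<in>?V. u v = y}. M (G -` {v} \<inter> space m) \<omega>)"
      by simp
  qed
  then show ?thesis
  proof eventually_elim
    case (elim \<omega>)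
    have "simple_stoch_integral m M ?g \<omega> =
        (\<Sum>y\<in>?Y. y * (\<Sum>v\<in>{v\<in>?V. u v = y}. M (G -` {v} \<inter> space m) \<omega>))"
      unfolding simple_stoch_integral_def by (rule sum.cong) (use elim in auto)
    also have "\<dots> = (\<Sum>y\<in>?Y. \<Sum>v\<in>{v\<in>?V. u v = y}. u v * M (G -` {v} \<inter> space m) \<omega>)"
      by (auto simp: sum_distrib_left intro!: sum.cong)
    also have "\<dots> = (\<Sum>v\<in>?V. u v * M (G -` {v} \<inter> space m) \<omega>)"
      by (rule sum.group[OF finV finY]) auto
    finally show ?case .
  qed
qed

lemma integrable_simple_add:
  assumes g: "integrable_simple m g" and g': "integrable_simple m g'"
  shows "integrable_simple m (\<lambda>s. g s + g' s)"
proof -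
  have s: "simple_function m g" "simple_function m g'"
    using g g' by (auto simp: integrable_simple_def)
  then have [measurable]: "g \<in> borel_measurable m" "g' \<in> borel_measurable m"
    by (auto intro: borel_measurable_simple_function)
  have "emeasure m {s \<in> space m. g s + g' s \<noteq> 0} \<le>
      emeasure m ({s \<in> space m. g s \<noteq> 0} \<union> {s \<in> space m. g' s \<noteq> 0})"
    by (rule emeasure_mono) auto
  also have "\<dots> \<le> emeasure m {s \<in> space m. g s \<noteq> 0} + emeasure m {s \<in> space m. g' s \<noteq> 0}"
    by (rule emeasure_subadditive) auto
  also have "\<dots> < \<infinity>"
    using g g' by (auto simp: integrable_simple_def)
  finally show ?thesis
    using s by (auto simp: integrable_simple_def intro: simple_function_add)
qed

lemma integrable_simple_cmult:
  assumes g: "integrable_simple m g"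
  shows "integrable_simple m (\<lambda>s. c * g s)"
proof -
  have s: "simple_function m g"
    using g by (auto simp: integrable_simple_def)
  then have [measurable]: "g \<in> borel_measurable m"
    by (auto intro: borel_measurable_simple_function)
  have "emeasure m {s \<in> space m. c * g s \<noteq> 0} \<le> emeasure m {s \<in> space m. g s \<noteq> 0}"
    by (rule emeasure_mono) auto
  also have "\<dots> < \<infinity>"
    using g by (auto simp: integrable_simple_def)
  finally show ?thesis
    using s simple_function_compose1[OF s, of "\<lambda>x. c * x"] by (simp add: integrable_simple_def)
qed

lemma simple_stoch_integral_add:
  assumes g: "integrable_simple m g" and g': "integrable_simple m g'"
  shows "AE \<omega> in \<Omega>. simple_stoch_integral m M (\<lambda>s. g s + g' s) \<omega> =
    simple_stoch_integral m M g \<omega> + simple_stoch_integral m M g' \<omega>"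
proof -
  let ?G = "\<lambda>s. (g s, g' s)"
  have G: "simple_function m ?G"
    using g g' by (auto simp: integrable_simple_def intro: simple_function_Pair)
  have fin: "finite (?G ` space m)"
    using simple_functionD(1)[OF G] .
  \<comment> \<open>The three sums below run over different sets of values; adding terms with
    coefficient 0 puts them over one index set. The added level sets may have infinite measure,
    where \<open>M\<close> is unconstrained, but the coefficient removes them.\<close>
  have ext: "(\<Sum>v\<in>{v\<in>?G ` space m. u v \<noteq> 0}. u v * M (?G -` {v} \<inter> space m) \<omega>) =
      (\<Sum>v\<in>?G ` space m. u v * M (?G -` {v} \<inter> space m) \<omega>)" for u :: "real \<times> real \<Rightarrow> real" and \<omega>
    by (rule sum.mono_neutral_left) (use fin in auto)
  have "AE \<omega> in \<Omega>. simple_stoch_integral m M (\<lambda>s. fst (?G s) + snd (?G s)) \<omega> =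
      (\<Sum>v\<in>{v\<in>?G ` space m. fst v + snd v \<noteq> 0}. (fst v + snd v) * M (?G -` {v} \<inter> space m) \<omega>)"
    by (rule simple_stoch_integral_refine[where u="\<lambda>v. fst v + snd v"])
      (use G integrable_simple_add[OF g g'] in auto)
  moreover have "AE \<omega> in \<Omega>. simple_stoch_integral m M (\<lambda>s. fst (?G s)) \<omega> =
      (\<Sum>v\<in>{v\<in>?G ` space m. fst v \<noteq> 0}. fst v * M (?G -` {v} \<inter> space m) \<omega>)"
    by (rule simple_stoch_integral_refine) (use G g in auto)
  moreover have "AE \<omega> in \<Omega>. simple_stoch_integral m M (\<lambda>s. snd (?G s)) \<omega> =
      (\<Sum>v\<in>{v\<in>?G ` space m. snd v \<noteq> 0}. snd v * M (?G -` {v} \<inter> space m) \<omega>)"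
    by (rule simple_stoch_integral_refine) (use G g' in auto)
  ultimately show ?thesis
  proof eventually_elim
    case (elim \<omega>)
    let ?T = "\<lambda>u. \<Sum>v\<in>?G ` space m. u v * M (?G -` {v} \<inter> space m) \<omega>"
    have "?T (\<lambda>v. fst v + snd v) = ?T fst + ?T snd"
      by (simp only: distrib_right sum.distrib)
    with elim show ?case
      by (simp only: ext fst_conv snd_conv)
  qed
qed

lemma simple_stoch_integral_cmult:
  assumes g: "integrable_simple m g"
  shows "AE \<omega> in \<Omega>. simple_stoch_integral m M (\<lambda>s. c * g s) \<omega> = c * simple_stoch_integral m M g \<omega>"
proof -
  have s: "simple_function m g"
    using g by (auto simp: integrable_simple_def)
  have "AE \<omega> in \<Omega>. simple_stoch_integral m M (\<lambda>s. c * g s) \<omega> =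
    (\<Sum>v\<in>{v\<in>g ` space m. c * v \<noteq> 0}. c * v * M (g -` {v} \<inter> space m) \<omega>)"
    by (rule simple_stoch_integral_refine[where u="\<lambda>v. c * v"])
      (use s integrable_simple_cmult[OF g] in auto)
  then show ?thesis
  proof eventually_elim
    case (elim \<omega>)
    have "(\<Sum>v\<in>{v\<in>g ` space m. c * v \<noteq> 0}. c * v * M (g -` {v} \<inter> space m) \<omega>) =
       (\<Sum>v\<in>g ` space m - {0}. c * v * M (g -` {v} \<inter> space m) \<omega>)"
      by (rule sum.mono_neutral_left) (use simple_functionD(1)[OF s] in auto)
    with elim show ?case
      by (simp add: simple_stoch_integral_def sum_distrib_left mult.assoc)
  qed
qed

lemma simple_stoch_integral_measurable:
  assumes g: "integrable_simple m g"
  shows "simple_stoch_integral m M g \<in> borel_measurable \<Omega>"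
proof -
  have "M (g -` {y} \<inter> space m) \<in> borel_measurable \<Omega>" if "y \<noteq> 0" for y
    using integrable_simple_vimage[OF g that] by (rule M_measurable)
  then show ?thesis
    unfolding simple_stoch_integral_def by (auto intro!: borel_measurable_sum borel_measurable_times)
qed

text \<open>The exponent found for linear combinations is the integral of
  \<open>\<bar>g\<bar> powr \<alpha>\<close> computed over level sets. It is finite, so
  \<open>enn2real\<close> loses nothing.\<close>

lemma char_simple_stoch_integral:
  assumes g: "integrable_simple m g"
  shows "(\<integral>\<omega>. iexp (simple_stoch_integral m M g \<omega>) \<partial>\<Omega>) =
    complex_of_real (exp (- enn2real (\<integral>\<^sup>+s. ennreal (\<bar>g s\<bar> powr \<alpha>) \<partial>m)))"
    "(\<integral>\<^sup>+s. ennreal (\<bar>g s\<bar> powr \<alpha>) \<partial>m) < \<infinity>"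
proof -
  let ?Y = "g ` space m - {0}" and ?A = "\<lambda>y. g -` {y} \<inter> space m"
  have s: "simple_function m g"
    using g by (auto simp: integrable_simple_def)
  have fin: "finite ?Y"
    using simple_functionD(1)[OF s] by auto
  have A: "?A y \<in> sets m" "emeasure m (?A y) < \<infinity>" if "y \<in> ?Y" for y
    using integrable_simple_vimage[OF g] that by auto
  have *: "ennreal (\<bar>g s\<bar> powr \<alpha>) = (\<Sum>y\<in>?Y. ennreal (\<bar>y\<bar> powr \<alpha>) * indicator (?A y) s)"
    if "s \<in> space m" for s
  proof (cases "g s = 0")
    case True
    then show ?thesis by (auto simp: indicator_def intro!: sum.neutral[symmetric])
  next
    case False
    have "(\<Sum>y\<in>?Y. ennreal (\<bar>y\<bar> powr \<alpha>) * indicator (?A y) s) =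
        (\<Sum>y\<in>{g s}. ennreal (\<bar>y\<bar> powr \<alpha>) * indicator (?A y) s)"
      by (rule sum.mono_neutral_right) (use fin that False in auto)
    with that show ?thesis by simp
  qed
  have "(\<integral>\<^sup>+s. ennreal (\<bar>g s\<bar> powr \<alpha>) \<partial>m) =
      (\<integral>\<^sup>+s. (\<Sum>y\<in>?Y. ennreal (\<bar>y\<bar> powr \<alpha>) * indicator (?A y) s) \<partial>m)"
    by (rule nn_integral_cong) (rule *)
  also have "\<dots> = (\<Sum>y\<in>?Y. ennreal (\<bar>y\<bar> powr \<alpha>) * emeasure m (?A y))"
    by (subst nn_integral_sum)
      (use A in \<open>auto intro!: sum.cong nn_integral_cmult_indicator borel_measurable_times_ennreal
        borel_measurable_indicator\<close>)
  also have "\<dots> = (\<Sum>y\<in>?Y. ennreal (measure m (?A y) * \<bar>y\<bar> powr \<alpha>))"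
  proof (rule sum.cong[OF refl])
    fix y assume "y \<in> ?Y"
    then have "emeasure m (?A y) = ennreal (measure m (?A y))"
      using A(2)[of y] by (intro emeasure_eq_ennreal_measure) simp
    then show "ennreal (\<bar>y\<bar> powr \<alpha>) * emeasure m (?A y) = ennreal (measure m (?A y) * \<bar>y\<bar> powr \<alpha>)"
      by (simp add: mult.commute flip: ennreal_mult'')
  qed
  also have "\<dots> = ennreal (\<Sum>y\<in>?Y. measure m (?A y) * \<bar>y\<bar> powr \<alpha>)"
    by (rule sum_ennreal) simp
  finally have eq: "(\<integral>\<^sup>+s. ennreal (\<bar>g s\<bar> powr \<alpha>) \<partial>m) =
    ennreal (\<Sum>y\<in>?Y. measure m (?A y) * \<bar>y\<bar> powr \<alpha>)" .
  then show "(\<integral>\<^sup>+s. ennreal (\<bar>g s\<bar> powr \<alpha>) \<partial>m) < \<infinity>"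
    by simp
  have "(\<integral>\<omega>. iexp (simple_stoch_integral m M g \<omega>) \<partial>\<Omega>) =
    complex_of_real (exp (- (\<Sum>y\<in>?Y. measure m (?A y) * \<bar>y\<bar> powr \<alpha>)))"
    unfolding simple_stoch_integral_def
    by (rule char_linear_combination) (use fin A in \<open>auto simp: disjoint_family_on_def\<close>)
  also have "(\<Sum>y\<in>?Y. measure m (?A y) * \<bar>y\<bar> powr \<alpha>) =
      enn2real (\<integral>\<^sup>+s. ennreal (\<bar>g s\<bar> powr \<alpha>) \<partial>m)"
    unfolding eq by (simp add: sum_nonneg)
  finally show "(\<integral>\<omega>. iexp (simple_stoch_integral m M g \<omega>) \<partial>\<Omega>) =
    complex_of_real (exp (- enn2real (\<integral>\<^sup>+s. ennreal (\<bar>g s\<bar> powr \<alpha>) \<partial>m)))" .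
qed

end

section \<open>Estimates for powers with exponent \<alpha>\<close>

text \<open>A substitute for the triangle inequality that covers \<alpha> < 1 as well: whichever
  summand dominates up to the factor \<delta> absorbs the other. The coefficient of the first term
  tends to 1 as \<delta> tends to 0, which is what continuity needs.\<close>

lemma abs_add_powr_le:
  fixes x y :: real
  assumes "0 < \<alpha>" "0 < \<delta>"
  shows "\<bar>x + y\<bar> powr \<alpha> \<le> (1 + \<delta>) powr \<alpha> * \<bar>x\<bar> powr \<alpha> + (1 + 1 / \<delta>) powr \<alpha> * \<bar>y\<bar> powr \<alpha>"
proof (cases "\<bar>y\<bar> \<le> \<delta> * \<bar>x\<bar>")
  case True
  have "\<bar>x + y\<bar> powr \<alpha> \<le> ((1 + \<delta>) * \<bar>x\<bar>) powr \<alpha>"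
    using True assms by (intro powr_mono2) (auto simp: algebra_simps)
  also have "\<dots> = (1 + \<delta>) powr \<alpha> * \<bar>x\<bar> powr \<alpha>"
    using assms by (simp add: powr_mult)
  finally show ?thesis by (simp add: add_increasing2)
next
  case False
  then have "\<bar>x\<bar> \<le> \<bar>y\<bar> / \<delta>"
    using assms by (simp add: field_simps)
  then have "\<bar>x + y\<bar> powr \<alpha> \<le> ((1 + 1 / \<delta>) * \<bar>y\<bar>) powr \<alpha>"
    using assms by (intro powr_mono2) (auto simp: algebra_simps)
  also have "\<dots> = (1 + 1 / \<delta>) powr \<alpha> * \<bar>y\<bar> powr \<alpha>"
    using assms by (simp add: powr_mult)
  finally show ?thesis by (simp add: add_increasing)
qed

lemma nn_integral_abs_add_powr_le:
  fixes g h :: "'s \<Rightarrow> real"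
  assumes "0 < \<alpha>" "0 < \<delta>" and [measurable]: "g \<in> borel_measurable m" "h \<in> borel_measurable m"
  shows "(\<integral>\<^sup>+s. ennreal (\<bar>g s + h s\<bar> powr \<alpha>) \<partial>m) \<le>
    ennreal ((1 + \<delta>) powr \<alpha>) * (\<integral>\<^sup>+s. ennreal (\<bar>g s\<bar> powr \<alpha>) \<partial>m) +
    ennreal ((1 + 1 / \<delta>) powr \<alpha>) * (\<integral>\<^sup>+s. ennreal (\<bar>h s\<bar> powr \<alpha>) \<partial>m)"
proof -
  have "(\<integral>\<^sup>+s. ennreal (\<bar>g s + h s\<bar> powr \<alpha>) \<partial>m) \<le>
    (\<integral>\<^sup>+s. ennreal ((1 + \<delta>) powr \<alpha>) * ennreal (\<bar>g s\<bar> powr \<alpha>) +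
      ennreal ((1 + 1 / \<delta>) powr \<alpha>) * ennreal (\<bar>h s\<bar> powr \<alpha>) \<partial>m)"
    using abs_add_powr_le[OF assms(1,2)]
    by (intro nn_integral_mono) (simp flip: ennreal_mult ennreal_plus)
  also have "\<dots> = ennreal ((1 + \<delta>) powr \<alpha>) * (\<integral>\<^sup>+s. ennreal (\<bar>g s\<bar> powr \<alpha>) \<partial>m) +
    ennreal ((1 + 1 / \<delta>) powr \<alpha>) * (\<integral>\<^sup>+s. ennreal (\<bar>h s\<bar> powr \<alpha>) \<partial>m)"
    by (simp add: nn_integral_add nn_integral_cmult)
  finally show ?thesis .
qed

lemma nn_integral_cmult_powr:
  assumes [measurable]: "g \<in> borel_measurable m"
  shows "(\<integral>\<^sup>+s. ennreal (\<bar>c * g s\<bar> powr \<alpha>) \<partial>m) =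
    ennreal (\<bar>c\<bar> powr \<alpha>) * (\<integral>\<^sup>+s. ennreal (\<bar>g s\<bar> powr \<alpha>) \<partial>m)"
  by (simp add: abs_mult powr_mult ennreal_mult nn_integral_cmult)

lemma L_alpha_add:
  assumes "0 < \<alpha>" "L_alpha \<alpha> m g" "L_alpha \<alpha> m h"
  shows "L_alpha \<alpha> m (\<lambda>s. g s + h s)"
proof -
  have [measurable]: "g \<in> borel_measurable m" "h \<in> borel_measurable m"
    using assms by (auto simp: L_alpha_def)
  have "(\<integral>\<^sup>+s. ennreal (\<bar>g s + h s\<bar> powr \<alpha>) \<partial>m) \<le>
    ennreal ((1 + 1) powr \<alpha>) * (\<integral>\<^sup>+s. ennreal (\<bar>g s\<bar> powr \<alpha>) \<partial>m) +
    ennreal ((1 + 1 / 1) powr \<alpha>) * (\<integral>\<^sup>+s. ennreal (\<bar>h s\<bar> powr \<alpha>) \<partial>m)"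
    by (rule nn_integral_abs_add_powr_le) (use assms in auto)
  also have "\<dots> < \<infinity>"
    using assms by (auto simp: L_alpha_def ennreal_mult_less_top)
  finally show ?thesis by (auto simp: L_alpha_def)
qed

lemma L_alpha_cmult:
  assumes "L_alpha \<alpha> m g"
  shows "L_alpha \<alpha> m (\<lambda>s. c * g s)"
proof -
  have [measurable]: "g \<in> borel_measurable m"
    using assms by (auto simp: L_alpha_def)
  show ?thesis
    using assms by (auto simp: L_alpha_def nn_integral_cmult_powr ennreal_mult_less_top)
qed

text \<open>The previous estimate is used in both directions, for \<open>f\<close> against
  \<open>g k\<close> and for \<open>g k\<close> against \<open>f\<close>. The parameter \<delta> is
  fixed before \<open>k\<close>: its large factor \<open>(1 + 1 / \<delta>) powr \<alpha>\<close>
  then stays constant while the error \<open>e k\<close> tends to 0.\<close>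

lemma tendsto_nn_integral_powr:
  fixes g :: "nat \<Rightarrow> 's \<Rightarrow> real"
  assumes \<alpha>: "0 < \<alpha>" and f: "L_alpha \<alpha> m f" and g: "\<And>k. L_alpha \<alpha> m (g k)"
    and lim: "(\<lambda>k. \<integral>\<^sup>+s. ennreal (\<bar>g k s - f s\<bar> powr \<alpha>) \<partial>m) \<longlonglongrightarrow> 0"
  shows "(\<lambda>k. enn2real (\<integral>\<^sup>+s. ennreal (\<bar>g k s\<bar> powr \<alpha>) \<partial>m)) \<longlonglongrightarrow>
    enn2real (\<integral>\<^sup>+s. ennreal (\<bar>f s\<bar> powr \<alpha>) \<partial>m)"
proof -
  let ?N = "\<lambda>h. \<integral>\<^sup>+s. ennreal (\<bar>h s\<bar> powr \<alpha>) \<partial>m"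
  define a b e where "a k = enn2real (?N (g k))" and "b = enn2real (?N f)"
    and "e k = enn2real (?N (\<lambda>s. g k s - f s))" for k
  have [measurable]: "f \<in> borel_measurable m" "g k \<in> borel_measurable m" for k
    using f g by (auto simp: L_alpha_def)
  have d: "L_alpha \<alpha> m (\<lambda>s. g k s - f s)" for k
    using L_alpha_add[OF \<alpha> g[of k] L_alpha_cmult[OF f, of "-1"]] by simp
  have Na: "?N (g k) = ennreal (a k)" and Nb: "?N f = ennreal b"
    and Ne: "?N (\<lambda>s. g k s - f s) = ennreal (e k)" for k
    using f g[of k] d[of k] by (auto simp: a_def b_def e_def L_alpha_def)
  have nn: "0 \<le> a k" "0 \<le> b" "0 \<le> e k" for k
    by (simp_all add: a_def b_def e_def)
  have e: "e \<longlonglongrightarrow> 0"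
    using lim ennreal_tendsto_0_iff[of e] nn unfolding Ne by simp
  have up: "a k \<le> (1 + \<delta>) powr \<alpha> * b + (1 + 1 / \<delta>) powr \<alpha> * e k" if "0 < \<delta>" for \<delta> k
  proof -
    have "?N (\<lambda>s. f s + (g k s - f s)) \<le>
        ennreal ((1 + \<delta>) powr \<alpha>) * ?N f + ennreal ((1 + 1 / \<delta>) powr \<alpha>) * ?N (\<lambda>s. g k s - f s)"
      by (rule nn_integral_abs_add_powr_le) (use \<alpha> that in auto)
    then show ?thesis
      using nn by (simp add: Na Nb Ne flip: ennreal_mult ennreal_plus)
  qed
  have lo: "b \<le> (1 + \<delta>) powr \<alpha> * a k + (1 + 1 / \<delta>) powr \<alpha> * e k" if "0 < \<delta>" for \<delta> k
  proof -
    have "?N (\<lambda>s. g k s + (f s - g k s)) \<le>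
        ennreal ((1 + \<delta>) powr \<alpha>) * ?N (g k) + ennreal ((1 + 1 / \<delta>) powr \<alpha>) * ?N (\<lambda>s. f s - g k s)"
      by (rule nn_integral_abs_add_powr_le) (use \<alpha> that in auto)
    then show ?thesis
      using nn by (simp add: Na Nb Ne abs_minus_commute[of "f _"] flip: ennreal_mult ennreal_plus)
  qed
  have A1: "((\<lambda>\<delta>::real. (1 + \<delta>) powr \<alpha>) \<longlongrightarrow> 1) (at_right 0)"
    by (rule tendsto_eq_intros refl | simp)+
  have "a \<longlonglongrightarrow> b"
  proof (rule order_tendstoI)
    fix u assume u: "b < u"
    have "((\<lambda>\<delta>::real. (1 + \<delta>) powr \<alpha> * b) \<longlongrightarrow> 1 * b) (at_right 0)"
      by (intro tendsto_intros A1)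
    then have "\<forall>\<^sub>F \<delta> in at_right 0. (1 + \<delta>) powr \<alpha> * b < u"
      using u by (intro order_tendstoD) auto
    moreover have "\<forall>\<^sub>F \<delta>::real in at_right 0. 0 < \<delta>"
      by (rule eventually_at_right_less)
    ultimately have "\<forall>\<^sub>F \<delta> in at_right 0. (1 + \<delta>) powr \<alpha> * b < u \<and> 0 < \<delta>"
      by eventually_elim simp
    then obtain \<delta> where \<delta>: "(1 + \<delta>) powr \<alpha> * b < u" "0 < \<delta>"
      by (auto dest!: eventually_happens)
    have "(\<lambda>k. (1 + \<delta>) powr \<alpha> * b + (1 + 1 / \<delta>) powr \<alpha> * e k) \<longlonglongrightarrow>
        (1 + \<delta>) powr \<alpha> * b + (1 + 1 / \<delta>) powr \<alpha> * 0"
      by (intro tendsto_intros e)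
    then have "\<forall>\<^sub>F k in sequentially. (1 + \<delta>) powr \<alpha> * b + (1 + 1 / \<delta>) powr \<alpha> * e k < u"
      using \<delta> by (intro order_tendstoD) auto
    then show "\<forall>\<^sub>F k in sequentially. a k < u"
      by eventually_elim (use up[OF \<delta>(2)] in \<open>auto intro: le_less_trans\<close>)
  next
    fix l assume l: "l < b"
    have "((\<lambda>\<delta>::real. (1 + \<delta>) powr \<alpha> * l) \<longlongrightarrow> 1 * l) (at_right 0)"
      by (intro tendsto_intros A1)
    then have "\<forall>\<^sub>F \<delta> in at_right 0. (1 + \<delta>) powr \<alpha> * l < b"
      using l by (intro order_tendstoD) auto
    moreover have "\<forall>\<^sub>F \<delta>::real in at_right 0. 0 < \<delta>"
      by (rule eventually_at_right_less)
    ultimately have "\<forall>\<^sub>F \<delta> in at_right 0. (1 + \<delta>) powr \<alpha> * l < b \<and> 0 < \<delta>"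
      by eventually_elim simp
    then obtain \<delta> where \<delta>: "(1 + \<delta>) powr \<alpha> * l < b" "0 < \<delta>"
      by (auto dest!: eventually_happens)
    have "(\<lambda>k. b - (1 + 1 / \<delta>) powr \<alpha> * e k) \<longlonglongrightarrow> b - (1 + 1 / \<delta>) powr \<alpha> * 0"
      by (intro tendsto_intros e)
    then have "\<forall>\<^sub>F k in sequentially. (1 + \<delta>) powr \<alpha> * l < b - (1 + 1 / \<delta>) powr \<alpha> * e k"
      using \<delta> by (intro order_tendstoD) auto
    then show "\<forall>\<^sub>F k in sequentially. l < a k"
    proof eventually_elim
      case (elim k)
      then have "(1 + \<delta>) powr \<alpha> * l < (1 + \<delta>) powr \<alpha> * a k"
        using lo[OF \<delta>(2), of k] by linarith
      then show ?case
        using \<delta>(2) by (simp add: mult_less_cancel_left_pos)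
    qed
  qed
  then show ?thesis unfolding a_def b_def .
qed

section \<open>Characteristic functions under convergence in probability\<close>

lemma norm_iexp_diff_le: "cmod (iexp x - iexp y) \<le> \<bar>x - y\<bar>"
proof -
  have "iexp x - iexp y = iexp y * (iexp (x - y) - 1)"
    by (simp add: algebra_simps flip: exp_add)
  then have "cmod (iexp x - iexp y) = cmod (iexp (x - y) - 1)"
    by (simp add: norm_mult)
  also have "\<dots> \<le> \<bar>x - y\<bar>"
    using iexp_approx1[of "x - y" 0] by simp
  finally show ?thesis .
qed

text \<open>Off the event that \<open>Z k\<close> and \<open>Y\<close> differ by more than r / 2 the
  integrands differ by at most r / 2, since \<open>iexp\<close> is Lipschitz; on that event they
  differ by at most 2, and its probability tends to 0.\<close>

lemma (in prob_space) tendsto_integral_iexp: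
  assumes Z[measurable]: "\<And>k. Z k \<in> borel_measurable M" and Y[measurable]: "Y \<in> borel_measurable M"
    and lim: "tends_in_probability M Z Y"
  shows "(\<lambda>k. \<integral>\<omega>. iexp (Z k \<omega>) \<partial>M) \<longlonglongrightarrow> (\<integral>\<omega>. iexp (Y \<omega>) \<partial>M)"
proof (rule LIMSEQ_I)
  fix r :: real assume r: "0 < r"
  let ?S = "\<lambda>k. {\<omega>\<in>space M. r / 2 < \<bar>Z k \<omega> - Y \<omega>\<bar>}"
  have int: "integrable M (\<lambda>\<omega>. iexp (X \<omega>))" if [measurable]: "X \<in> borel_measurable M" for X :: "'a \<Rightarrow> real"
    by (rule integrable_const_bound[where B=1]) auto
  have bound: "norm ((\<integral>\<omega>. iexp (Z k \<omega>) \<partial>M) - (\<integral>\<omega>. iexp (Y \<omega>) \<partial>M)) \<le> r / 2 + 2 * prob (?S k)" for k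
  proof -
    have "norm ((\<integral>\<omega>. iexp (Z k \<omega>) \<partial>M) - (\<integral>\<omega>. iexp (Y \<omega>) \<partial>M)) =
        norm (\<integral>\<omega>. iexp (Z k \<omega>) - iexp (Y \<omega>) \<partial>M)"
      by (simp add: int)
    also have "\<dots> \<le> (\<integral>\<omega>. r / 2 + 2 * indicator (?S k) \<omega> \<partial>M)"
    proof (rule order.trans[OF integral_norm_bound integral_mono])
      show "integrable M (\<lambda>\<omega>. norm (iexp (Z k \<omega>) - iexp (Y \<omega>)))"
        by (intro integrable_norm Bochner_Integration.integrable_diff int) auto
      show "integrable M (\<lambda>\<omega>. r / 2 + 2 * indicator (?S k) \<omega> :: real)"
        by (rule integrable_const_bound[where B="r / 2 + 2"]) (use r in \<open>auto simp: indicator_def\<close>)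
      fix \<omega> assume "\<omega> \<in> space M"
      moreover have "cmod (iexp (Z k \<omega>) - iexp (Y \<omega>)) \<le> 1 + 1"
        by (rule order.trans[OF norm_triangle_ineq4]) simp
      ultimately show "norm (iexp (Z k \<omega>) - iexp (Y \<omega>)) \<le> r / 2 + 2 * indicator (?S k) \<omega>"
        using norm_iexp_diff_le[of "Z k \<omega>" "Y \<omega>"] r by (auto simp: indicator_def)
    qed
    also have "\<dots> = r / 2 + 2 * prob (?S k)"
    proof -
      obtain S where S: "S = ?S k" by simp
      have [measurable]: "S \<in> sets M" unfolding S by measurable
      have "integrable M (indicator S :: 'a \<Rightarrow> real)"
        by (rule integrable_const_bound[where B=1]) auto
      then show ?thesis
        unfolding S[symmetric] by (simp add: prob_space)
    qed
    finally show ?thesis .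
  qed
  have "(\<lambda>k. prob (?S k)) \<longlonglongrightarrow> 0"
    using lim half_gt_zero[OF r] unfolding tends_in_probability_def by blast
  then have "\<forall>\<^sub>F k in sequentially. prob (?S k) < r / 4"
    using r by (intro order_tendstoD) auto
  then have "\<forall>\<^sub>F k in sequentially. norm ((\<integral>\<omega>. iexp (Z k \<omega>) \<partial>M) - (\<integral>\<omega>. iexp (Y \<omega>) \<partial>M)) < r"
  proof eventually_elim
    case (elim k)
    then show ?case using bound[of k] by linarith
  qed
  then show "\<exists>no. \<forall>n\<ge>no. norm ((\<integral>\<omega>. iexp (Z n \<omega>) \<partial>M) - (\<integral>\<omega>. iexp (Y \<omega>) \<partial>M)) < r"
    by (simp add: eventually_sequentially)
qed

lemma (in prob_space) tends_in_probability_add: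
  assumes [measurable]: "\<And>k. Z k \<in> borel_measurable M" "\<And>k. Z' k \<in> borel_measurable M"
      "\<And>k. W k \<in> borel_measurable M" "Y \<in> borel_measurable M" "Y' \<in> borel_measurable M"
    and lim: "tends_in_probability M Z Y" "tends_in_probability M Z' Y'"
    and eq: "\<And>k. AE \<omega> in M. W k \<omega> = Z k \<omega> + Z' k \<omega>"
  shows "tends_in_probability M W (\<lambda>\<omega>. Y \<omega> + Y' \<omega>)"
  unfolding tends_in_probability_def
proof (intro allI impI)
  fix \<epsilon> :: real assume \<epsilon>: "0 < \<epsilon>"
  let ?S = "\<lambda>k. {\<omega>\<in>space M. \<epsilon> / 2 < \<bar>Z k \<omega> - Y \<omega>\<bar>}" and ?S' = "\<lambda>k. {\<omega>\<in>space M. \<epsilon> / 2 < \<bar>Z' k \<omega> - Y' \<omega>\<bar>}"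
  have L: "(\<lambda>k. prob (?S k) + prob (?S' k)) \<longlonglongrightarrow> 0"
    using lim half_gt_zero[OF \<epsilon>] unfolding tends_in_probability_def by (intro tendsto_add_zero) blast+
  have le: "prob {\<omega>\<in>space M. \<epsilon> < \<bar>W k \<omega> - (Y \<omega> + Y' \<omega>)\<bar>} \<le> prob (?S k) + prob (?S' k)" for k
  proof -
    have "prob {\<omega>\<in>space M. \<epsilon> < \<bar>W k \<omega> - (Y \<omega> + Y' \<omega>)\<bar>} \<le> prob (?S k \<union> ?S' k)"
    proof (rule finite_measure_mono_AE)
      show "AE \<omega> in M. \<omega> \<in> {\<omega>\<in>space M. \<epsilon> < \<bar>W k \<omega> - (Y \<omega> + Y' \<omega>)\<bar>} \<longrightarrow> \<omega> \<in> ?S k \<union> ?S' k"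
        using eq[of k]
      proof eventually_elim
        case (elim \<omega>)
        have "\<bar>W k \<omega> - (Y \<omega> + Y' \<omega>)\<bar> \<le> \<bar>Z k \<omega> - Y \<omega>\<bar> + \<bar>Z' k \<omega> - Y' \<omega>\<bar>"
          using elim by linarith
        then show ?case by auto
      qed
    qed measurable
    also have "\<dots> \<le> prob (?S k) + prob (?S' k)"
      by (rule measure_Un_le) measurable
    finally show ?thesis .
  qed
  show "(\<lambda>k. prob {\<omega>\<in>space M. \<epsilon> < \<bar>W k \<omega> - (Y \<omega> + Y' \<omega>)\<bar>}) \<longlonglongrightarrow> 0"
    using le by (intro Lim_null_comparison[OF always_eventually L]) (simp only: real_norm_def abs_of_nonneg[OF measure_nonneg] simp_thms)
qed

lemma (in prob_space) tends_in_probability_cmult: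
  assumes [measurable]: "\<And>k. Z k \<in> borel_measurable M"
      "\<And>k. W k \<in> borel_measurable M" "Y \<in> borel_measurable M"
    and lim: "tends_in_probability M Z Y"
    and eq: "\<And>k. AE \<omega> in M. W k \<omega> = c * Z k \<omega>"
  shows "tends_in_probability M W (\<lambda>\<omega>. c * Y \<omega>)"
  unfolding tends_in_probability_def
proof (intro allI impI)
  fix \<epsilon> :: real assume \<epsilon>: "0 < \<epsilon>"
  \<comment> \<open>Dividing by \<open>\<bar>c\<bar> + 1\<close> instead of
    \<open>\<bar>c\<bar>\<close> covers c = 0 without a case distinction.\<close>
  let ?S = "\<lambda>k. {\<omega>\<in>space M. \<epsilon> / (\<bar>c\<bar> + 1) < \<bar>Z k \<omega> - Y \<omega>\<bar>}"
  have "0 < \<epsilon> / (\<bar>c\<bar> + 1)"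
    using \<epsilon> by (simp add: add_nonneg_pos)
  then have L: "(\<lambda>k. prob (?S k)) \<longlonglongrightarrow> 0"
    using lim by (auto simp: tends_in_probability_def)
  have le: "prob {\<omega>\<in>space M. \<epsilon> < \<bar>W k \<omega> - c * Y \<omega>\<bar>} \<le> prob (?S k)" for k
  proof (rule finite_measure_mono_AE)
    show "AE \<omega> in M. \<omega> \<in> {\<omega>\<in>space M. \<epsilon> < \<bar>W k \<omega> - c * Y \<omega>\<bar>} \<longrightarrow> \<omega> \<in> ?S k"
      using eq[of k]
    proof eventually_elim
      case (elim \<omega>)
      have "\<bar>W k \<omega> - c * Y \<omega>\<bar> = \<bar>c\<bar> * \<bar>Z k \<omega> - Y \<omega>\<bar>"
        using elim by (simp add: abs_mult flip: right_diff_distrib)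
      also have "\<dots> \<le> (\<bar>c\<bar> + 1) * \<bar>Z k \<omega> - Y \<omega>\<bar>"
        by (intro mult_right_mono) auto
      finally show ?case
        by (auto simp: pos_divide_less_eq add_nonneg_pos mult.commute)
    qed
  qed measurable
  show "(\<lambda>k. prob {\<omega>\<in>space M. \<epsilon> < \<bar>W k \<omega> - c * Y \<omega>\<bar>}) \<longlonglongrightarrow> 0"
    using le by (intro Lim_null_comparison[OF always_eventually L]) (simp only: real_norm_def abs_of_nonneg[OF measure_nonneg] simp_thms)
qed

section \<open>Linearity and characteristic function of the stochastic integral\<close>

context sas_integration
begin

lemma L_alpha_simple: "integrable_simple m g \<Longrightarrow> L_alpha \<alpha> m g"
  using char_simple_stoch_integral(2)[of g]
  by (auto simp: L_alpha_def integrable_simple_def borel_measurable_simple_function)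

lemma has_stoch_integral_add:
  assumes "has_stoch_integral \<alpha> m \<Omega> M f Y" "has_stoch_integral \<alpha> m \<Omega> M f' Y'"
  shows "has_stoch_integral \<alpha> m \<Omega> M (\<lambda>s. f s + f' s) (\<lambda>\<omega>. Y \<omega> + Y' \<omega>)"
proof -
  obtain g where f: "L_alpha \<alpha> m f" and Y[measurable]: "Y \<in> borel_measurable \<Omega>"
    and g: "\<And>k. integrable_simple m (g k)"
      "(\<lambda>k. \<integral>\<^sup>+s. ennreal (\<bar>g k s - f s\<bar> powr \<alpha>) \<partial>m) \<longlonglongrightarrow> 0"
      "tends_in_probability \<Omega> (\<lambda>k. simple_stoch_integral m M (g k)) Y"
    using assms(1) unfolding has_stoch_integral_def by auto
  obtain g' where f': "L_alpha \<alpha> m f'" and Y'[measurable]: "Y' \<in> borel_measurable \<Omega>"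
    and g': "\<And>k. integrable_simple m (g' k)"
      "(\<lambda>k. \<integral>\<^sup>+s. ennreal (\<bar>g' k s - f' s\<bar> powr \<alpha>) \<partial>m) \<longlonglongrightarrow> 0"
      "tends_in_probability \<Omega> (\<lambda>k. simple_stoch_integral m M (g' k)) Y'"
    using assms(2) unfolding has_stoch_integral_def by auto
  let ?g = "\<lambda>k s. g k s + g' k s"
  have [measurable]: "f \<in> borel_measurable m" "f' \<in> borel_measurable m"
      "g k \<in> borel_measurable m" "g' k \<in> borel_measurable m" for k
    using f f' L_alpha_simple[OF g(1)] L_alpha_simple[OF g'(1)] by (auto simp: L_alpha_def)
  have "integrable_simple m (?g k)" for k
    by (rule integrable_simple_add[OF g(1) g'(1)])
  moreover have "(\<lambda>k. \<integral>\<^sup>+s. ennreal (\<bar>?g k s - (f s + f' s)\<bar> powr \<alpha>) \<partial>m) \<longlonglongrightarrow> 0"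
  proof (rule tendsto_sandwich[OF _ _ tendsto_const])
    \<comment> \<open>The split with \<delta> = 1; the constants do not matter, since both errors
      tend to 0.\<close>
    let ?b = "\<lambda>k. ennreal ((1 + 1) powr \<alpha>) * (\<integral>\<^sup>+s. ennreal (\<bar>g k s - f s\<bar> powr \<alpha>) \<partial>m) +
      ennreal ((1 + 1 / 1) powr \<alpha>) * (\<integral>\<^sup>+s. ennreal (\<bar>g' k s - f' s\<bar> powr \<alpha>) \<partial>m)"
    have "?b \<longlonglongrightarrow> ennreal ((1 + 1) powr \<alpha>) * 0 + ennreal ((1 + 1 / 1) powr \<alpha>) * 0"
      using g(2) g'(2) by (intro tendsto_add ennreal_tendsto_cmult) auto
    then show "?b \<longlonglongrightarrow> 0" by simp
    have "(\<integral>\<^sup>+s. ennreal (\<bar>?g k s - (f s + f' s)\<bar> powr \<alpha>) \<partial>m) \<le> ?b k" for k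
    proof -
      have "(\<integral>\<^sup>+s. ennreal (\<bar>(g k s - f s) + (g' k s - f' s)\<bar> powr \<alpha>) \<partial>m) \<le> ?b k"
        by (rule nn_integral_abs_add_powr_le) (use alpha_pos in auto)
      then show ?thesis by (simp add: algebra_simps)
    qed
    then show "\<forall>\<^sub>F k in sequentially. (\<integral>\<^sup>+s. ennreal (\<bar>?g k s - (f s + f' s)\<bar> powr \<alpha>) \<partial>m) \<le> ?b k"
      by simp
  qed simp
  moreover have "tends_in_probability \<Omega> (\<lambda>k. simple_stoch_integral m M (?g k)) (\<lambda>\<omega>. Y \<omega> + Y' \<omega>)"
    by (rule tends_in_probability_add[OF _ _ _ _ _ g(3) g'(3)])
      (use g(1) g'(1) in \<open>auto intro: simple_stoch_integral_measurable integrable_simple_add simple_stoch_integral_add\<close>)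
  ultimately show ?thesis
    using L_alpha_add[OF alpha_pos f f'] unfolding has_stoch_integral_def
    by (intro conjI exI[of _ ?g]) auto
qed

lemma has_stoch_integral_cmult:
  assumes "has_stoch_integral \<alpha> m \<Omega> M f Y"
  shows "has_stoch_integral \<alpha> m \<Omega> M (\<lambda>s. c * f s) (\<lambda>\<omega>. c * Y \<omega>)"
proof -
  obtain g where f: "L_alpha \<alpha> m f" and Y[measurable]: "Y \<in> borel_measurable \<Omega>"
    and g: "\<And>k. integrable_simple m (g k)"
      "(\<lambda>k. \<integral>\<^sup>+s. ennreal (\<bar>g k s - f s\<bar> powr \<alpha>) \<partial>m) \<longlonglongrightarrow> 0"
      "tends_in_probability \<Omega> (\<lambda>k. simple_stoch_integral m M (g k)) Y"
    using assms(1) unfolding has_stoch_integral_def by auto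
  let ?g = "\<lambda>k s. c * g k s"
  have [measurable]: "f \<in> borel_measurable m" "g k \<in> borel_measurable m" for k
    using f L_alpha_simple[OF g(1)] by (auto simp: L_alpha_def)
  have "integrable_simple m (?g k)" for k
    by (rule integrable_simple_cmult[OF g(1)])
  moreover have "(\<lambda>k. \<integral>\<^sup>+s. ennreal (\<bar>?g k s - c * f s\<bar> powr \<alpha>) \<partial>m) \<longlonglongrightarrow> 0"
  proof -
    have "(\<lambda>k. ennreal (\<bar>c\<bar> powr \<alpha>) * (\<integral>\<^sup>+s. ennreal (\<bar>g k s - f s\<bar> powr \<alpha>) \<partial>m)) \<longlonglongrightarrow>
        ennreal (\<bar>c\<bar> powr \<alpha>) * 0"
      using g(2) by (intro ennreal_tendsto_cmult) auto
    then show ?thesis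
      by (simp add: nn_integral_cmult_powr[of "\<lambda>s. g _ s - f s", symmetric] right_diff_distrib)
  qed
  moreover have "tends_in_probability \<Omega> (\<lambda>k. simple_stoch_integral m M (?g k)) (\<lambda>\<omega>. c * Y \<omega>)"
    by (rule tends_in_probability_cmult[OF _ _ _ g(3)])
      (use g(1) in \<open>auto intro: simple_stoch_integral_measurable integrable_simple_cmult simple_stoch_integral_cmult\<close>)
  ultimately show ?thesis
    using L_alpha_cmult[OF f] unfolding has_stoch_integral_def
    by (intro conjI exI[of _ ?g]) auto
qed

lemma has_stoch_integral_zero: "has_stoch_integral \<alpha> m \<Omega> M (\<lambda>_. 0) (\<lambda>_. 0)"
proof -
  have "simple_stoch_integral m M (\<lambda>_. 0) = (\<lambda>_. 0)"
    by (auto simp: simple_stoch_integral_def intro!: sum.neutral)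
  then show ?thesis
    unfolding has_stoch_integral_def
    by (intro conjI exI[of _ "\<lambda>_ _. 0"])
      (auto simp: L_alpha_def integrable_simple_def tends_in_probability_def)
qed

lemma has_stoch_integral_sum:
  assumes "finite I" "\<And>i. i \<in> I \<Longrightarrow> has_stoch_integral \<alpha> m \<Omega> M (f i) (Y i)"
  shows "has_stoch_integral \<alpha> m \<Omega> M (\<lambda>s. \<Sum>i\<in>I. c i * f i s) (\<lambda>\<omega>. \<Sum>i\<in>I. c i * Y i \<omega>)"
  using assms
proof (induction I rule: finite_induct)
  case empty
  show ?case by (simp add: has_stoch_integral_zero)
next
  case (insert i I)
  then show ?case
    by (simp add: has_stoch_integral_add has_stoch_integral_cmult)
qed

text \<open>Both sides pass to the limit along the simple functions, the left one by convergence in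
  probability and the right one by convergence in \<open>L\<^sup>\<alpha>\<close>. The value at 1 is
  enough, because multiples and linear combinations are integrals again.\<close>

lemma char_stoch_integral:
  assumes "has_stoch_integral \<alpha> m \<Omega> M f Y"
  shows "(\<integral>\<omega>. iexp (Y \<omega>) \<partial>\<Omega>) =
    complex_of_real (exp (- enn2real (\<integral>\<^sup>+s. ennreal (\<bar>f s\<bar> powr \<alpha>) \<partial>m)))"
proof -
  let ?N = "\<lambda>h. enn2real (\<integral>\<^sup>+s. ennreal (\<bar>h s\<bar> powr \<alpha>) \<partial>m)"
  obtain g where f: "L_alpha \<alpha> m f" and Y[measurable]: "Y \<in> borel_measurable \<Omega>"
    and g: "\<And>k. integrable_simple m (g k)"
      "(\<lambda>k. \<integral>\<^sup>+s. ennreal (\<bar>g k s - f s\<bar> powr \<alpha>) \<partial>m) \<longlonglongrightarrow> 0"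
      "tends_in_probability \<Omega> (\<lambda>k. simple_stoch_integral m M (g k)) Y"
    using assms unfolding has_stoch_integral_def by auto
  have "(\<lambda>k. \<integral>\<omega>. iexp (simple_stoch_integral m M (g k) \<omega>) \<partial>\<Omega>) \<longlonglongrightarrow> (\<integral>\<omega>. iexp (Y \<omega>) \<partial>\<Omega>)"
    by (rule tendsto_integral_iexp[OF _ _ g(3)]) (auto intro: simple_stoch_integral_measurable g(1))
  moreover have "(\<lambda>k. complex_of_real (exp (- ?N (g k)))) \<longlonglongrightarrow> complex_of_real (exp (- ?N f))"
    by (intro tendsto_of_real tendsto_exp tendsto_minus
        tendsto_nn_integral_powr[OF alpha_pos f L_alpha_simple[OF g(1)] g(2)])
  ultimately show ?thesis
    unfolding char_simple_stoch_integral(1)[OF g(1)] by (rule LIMSEQ_unique)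
qed

end

section \<open>The radial measure\<close>

text \<open>The reciprocal of the K of the overview. It is kept as an integral because only its
  finiteness and positivity for 0 < \<alpha> < 2 are used.\<close>

definition levy_const :: "real \<Rightarrow> real" where
  "levy_const \<alpha> = enn2real (\<integral>\<^sup>+r. ennreal ((1 - cos r) * \<bar>r\<bar> powr (- 1 - \<alpha>)) \<partial>lborel)"

definition radial_measure :: "real \<Rightarrow> real measure" where
  "radial_measure \<alpha> = density lborel (\<lambda>r. ennreal (\<bar>r\<bar> powr (- 1 - \<alpha>) / levy_const \<alpha>))"

lemma sets_radial_measure [simp, measurable_cong]: "sets (radial_measure \<alpha>) = sets borel"
  and space_radial_measure [simp]: "space (radial_measure \<alpha>) = UNIV"
  by (simp_all add: radial_measure_def)

lemma nn_integral_radial_measure: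
  assumes [measurable]: "G \<in> borel_measurable borel"
  shows "(\<integral>\<^sup>+r. G r \<partial>radial_measure \<alpha>) =
    (\<integral>\<^sup>+r. ennreal (\<bar>r\<bar> powr (- 1 - \<alpha>) / levy_const \<alpha>) * G r \<partial>lborel)"
  unfolding radial_measure_def by (rule nn_integral_density) auto

section \<open>Integrability and normalisation of the radial density\<close>

text \<open>Near 0 the integrand is a power with exponent 1 - \<alpha>, integrable since \<alpha> <
  2; at infinity it has exponent - 1 - \<alpha>, integrable since \<alpha> > 0. The negative half
  line follows by reflection.\<close>

lemma nn_integral_min_power2_finite:
  fixes \<alpha> :: real
  assumes \<alpha>: "0 < \<alpha>" "\<alpha> < 2"
  shows "(\<integral>\<^sup>+r. ennreal (min (r\<^sup>2) 1 * \<bar>r\<bar> powr (- 1 - \<alpha>)) \<partial>lborel) < \<infinity>"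
proof -
  let ?f = "\<lambda>r::real. ennreal (min (r\<^sup>2) 1 * \<bar>r\<bar> powr (- 1 - \<alpha>))"
  let ?g = "\<lambda>r. indicator {0..} r * ?f r"
  let ?a = "\<lambda>r::real. ennreal (indicator {0..1} r * r powr (1 - \<alpha>))"
  let ?b = "\<lambda>r::real. ennreal (indicator {1..} r * r powr (- 1 - \<alpha>))"
  have "?g r \<le> ?a r + ?b r" for r
  proof -
    have "r\<^sup>2 * r powr (- 1 - \<alpha>) = r powr (1 - \<alpha>)" if "0 < r"
    proof -
      have "r\<^sup>2 = r powr 2" using that by simp
      then show ?thesis by (simp only: powr_add[symmetric]) simp
    qed
    then show ?thesis
      by (cases "r = 0") (auto simp: indicator_def min_def power_le_one_iff abs_square_le_1 intro!: ennreal_leI)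
  qed
  then have "integral\<^sup>N lborel ?g \<le> (\<integral>\<^sup>+r. ?a r + ?b r \<partial>lborel)"
    by (intro nn_integral_mono)
  also have "\<dots> = (\<integral>\<^sup>+r. ?a r \<partial>lborel) + (\<integral>\<^sup>+r. ?b r \<partial>lborel)"
    by (rule nn_integral_add) auto
  also have "(\<integral>\<^sup>+r. ?a r \<partial>lborel) = ennreal (1 powr (1 - \<alpha> + 1) / (1 - \<alpha> + 1))"
    by (rule nn_integral_has_integral_lebesgue) (use \<alpha> has_integral_powr_from_0[of "1 - \<alpha>" 1] in auto)
  also have "(\<integral>\<^sup>+r. ?b r \<partial>lborel) = ennreal (- (1 powr (- 1 - \<alpha> + 1)) / (- 1 - \<alpha> + 1))"
    by (rule nn_integral_has_integral_lebesgue) (use \<alpha> has_integral_powr_to_inf[of "- 1 - \<alpha>" 1] in auto)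
  finally have g: "integral\<^sup>N lborel ?g < \<infinity>"
    by (auto intro: le_less_trans)
  have "integral\<^sup>N lborel ?g = ennreal \<bar>-1\<bar> * (\<integral>\<^sup>+r. ?g (0 + (-1) * r) \<partial>lborel)"
    by (rule nn_integral_real_affine) auto
  then have g': "(\<integral>\<^sup>+r. ?g (- r) \<partial>lborel) < \<infinity>"
    using g by simp
  have "integral\<^sup>N lborel ?f \<le> (\<integral>\<^sup>+r. ?g r + ?g (- r) \<partial>lborel)"
    by (intro nn_integral_mono) (auto simp: indicator_def)
  also have "\<dots> = integral\<^sup>N lborel ?g + (\<integral>\<^sup>+r. ?g (- r) \<partial>lborel)"
    by (rule nn_integral_add) auto
  finally show ?thesis
    using g g' by (auto intro: le_less_trans)
qed

lemma one_minus_cos_le: "1 - cos (r::real) \<le> 2 * min (r\<^sup>2) 1"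
proof -
  have "1 - cos r = 2 * (sin (r / 2))\<^sup>2"
    using cos_double_sin[of "r / 2"] by simp
  moreover have "(sin (r / 2))\<^sup>2 \<le> r\<^sup>2 / 4"
    using abs_sin_x_le_abs_x[of "r / 2", unfolded abs_le_square_iff] by (simp add: power_divide)
  ultimately have "1 - cos r \<le> 2 * r\<^sup>2"
    using zero_le_power2[of r] by linarith
  moreover have "1 - cos r \<le> 2"
    using cos_ge_minus_one[of r] by linarith
  ultimately show ?thesis
    by (cases "r\<^sup>2 \<le> 1") (simp_all only: min_absorb1 min_absorb2 linorder_not_le less_imp_le mult_1_right)
qed

lemma nn_integral_one_minus_cos:
  assumes \<alpha>: "0 < \<alpha>" "\<alpha> < 2"
  shows "(\<integral>\<^sup>+r. ennreal ((1 - cos r) * \<bar>r\<bar> powr (- 1 - \<alpha>)) \<partial>lborel) = ennreal (levy_const \<alpha>)"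
    and levy_const_pos: "0 < levy_const \<alpha>"
proof -
  let ?f = "\<lambda>r::real. ennreal ((1 - cos r) * \<bar>r\<bar> powr (- 1 - \<alpha>))"
  have "integral\<^sup>N lborel ?f \<le> (\<integral>\<^sup>+r. ennreal 2 * ennreal (min (r\<^sup>2) 1 * \<bar>r\<bar> powr (- 1 - \<alpha>)) \<partial>lborel)"
    using one_minus_cos_le
    by (intro nn_integral_mono, subst ennreal_mult''[symmetric])
      (auto simp flip: mult.assoc intro!: ennreal_leI mult_right_mono)
  also have "\<dots> = ennreal 2 * (\<integral>\<^sup>+r. ennreal (min (r\<^sup>2) 1 * \<bar>r\<bar> powr (- 1 - \<alpha>)) \<partial>lborel)"
    by (rule nn_integral_cmult) auto
  also have "\<dots> < \<infinity>"
    using nn_integral_min_power2_finite[OF \<alpha>] by (auto simp: ennreal_mult_less_top)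
  finally have fin: "integral\<^sup>N lborel ?f < \<infinity>" .
  then show eq: "integral\<^sup>N lborel ?f = ennreal (levy_const \<alpha>)"
    by (simp add: levy_const_def)
  have "integral\<^sup>N lborel ?f \<noteq> 0"
  proof
    assume "integral\<^sup>N lborel ?f = 0"
    then have "AE r in lborel. ?f r = 0"
      by (subst (asm) nn_integral_0_iff_AE) auto
    \<comment> \<open>An arbitrary interval on which 1 - cos has no zero; it has positive length and
      therefore cannot be null.\<close>
    then have "AE r::real in lborel. r \<notin> {1<..<2}"
    proof eventually_elim
      case (elim r)
      show ?case
      proof
        assume r: "r \<in> {1<..<2}"
        then have "0 < sin (r / 2)"
          using pi_gt3 by (intro sin_gt_zero) auto
        then have "0 < 1 - cos r"
          using cos_double_sin[of "r / 2"] by simp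
        then have "0 < (1 - cos r) * \<bar>r\<bar> powr (- 1 - \<alpha>)"
          using r by (intro mult_pos_pos) auto
        with elim show False by (simp add: ennreal_eq_0_iff)
      qed
    qed
    then have "{1<..<2::real} \<in> null_sets lborel"
      by (subst AE_iff_null_sets) auto
    then show False by (simp add: null_sets_def)
  qed
  then show "0 < levy_const \<alpha>"
    using eq by (metis ennreal_0 enn2real_nonneg levy_const_def order_le_imp_less_or_eq)
qed

section \<open>Homogeneity of the radial measure\<close>

context
  fixes \<alpha> :: real
  assumes \<alpha>: "0 < \<alpha>" "\<alpha> < 2"
begin

text \<open>The density is homogeneous of degree - 1 - \<alpha> and the substitution contributes
  \<open>\<bar>y\<bar>\<close>, which leaves a total factor
  \<open>\<bar>y\<bar> powr \<alpha>\<close>. The stable exponent and the compensation of the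
  Radon-Nikodym derivative by a change of radius both come from this.\<close>

lemma radial_measure_scale:
  assumes [measurable]: "G \<in> borel_measurable borel" and y: "y \<noteq> 0"
  shows "(\<integral>\<^sup>+r. G (y * r) \<partial>radial_measure \<alpha>) = ennreal (\<bar>y\<bar> powr \<alpha>) * (\<integral>\<^sup>+r. G r \<partial>radial_measure \<alpha>)"
proof -
  let ?d = "\<lambda>r. \<bar>r\<bar> powr (- 1 - \<alpha>) / levy_const \<alpha>"
  have pos: "0 < levy_const \<alpha>"
    using levy_const_pos[OF \<alpha>] .
  have d: "\<bar>y\<bar> powr \<alpha> * (\<bar>y\<bar> * ?d (y * r)) = ?d r" for r
  proof -
    have "\<bar>y\<bar> powr \<alpha> * (\<bar>y\<bar> * ?d (y * r)) =
        (\<bar>y\<bar> powr \<alpha> * \<bar>y\<bar> powr 1 * \<bar>y\<bar> powr (- 1 - \<alpha>)) * ?d r"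
      using y by (simp add: abs_mult powr_mult)
    also have "\<bar>y\<bar> powr \<alpha> * \<bar>y\<bar> powr 1 * \<bar>y\<bar> powr (- 1 - \<alpha>) = 1"
      using y by (simp only: powr_add[symmetric]) simp
    finally show ?thesis by simp
  qed
  have "ennreal (\<bar>y\<bar> powr \<alpha>) * (\<integral>\<^sup>+r. G r \<partial>radial_measure \<alpha>) =
      ennreal (\<bar>y\<bar> powr \<alpha>) * (\<integral>\<^sup>+r. ennreal (?d r) * G r \<partial>lborel)"
    by (simp add: nn_integral_radial_measure)
  also have "(\<integral>\<^sup>+r. ennreal (?d r) * G r \<partial>lborel) =
      ennreal \<bar>y\<bar> * (\<integral>\<^sup>+r. ennreal (?d (0 + y * r)) * G (0 + y * r) \<partial>lborel)"
    by (rule nn_integral_real_affine) (use y in auto)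
  also have "ennreal (\<bar>y\<bar> powr \<alpha>) * \<dots> =
      (\<integral>\<^sup>+r. ennreal (\<bar>y\<bar> powr \<alpha>) * (ennreal \<bar>y\<bar> * (ennreal (?d (0 + y * r)) * G (0 + y * r))) \<partial>lborel)"
    by (simp add: nn_integral_cmult)
  also have "\<dots> = (\<integral>\<^sup>+r. ennreal (?d r) * G (y * r) \<partial>lborel)"
  proof (rule nn_integral_cong)
    fix r
    have "ennreal (\<bar>y\<bar> powr \<alpha>) * (ennreal \<bar>y\<bar> * (ennreal (?d (0 + y * r)) * G (0 + y * r))) =
        ennreal (\<bar>y\<bar> powr \<alpha> * (\<bar>y\<bar> * ?d (y * r))) * G (y * r)"
      using pos by (simp only: ennreal_mult abs_ge_zero powr_ge_zero mult_nonneg_nonneg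
          divide_nonneg_pos mult.assoc add_0)
    then show "ennreal (\<bar>y\<bar> powr \<alpha>) * (ennreal \<bar>y\<bar> * (ennreal (?d (0 + y * r)) * G (0 + y * r))) =
        ennreal (?d r) * G (y * r)"
      by (simp only: d)
  qed
  also have "\<dots> = (\<integral>\<^sup>+r. G (y * r) \<partial>radial_measure \<alpha>)"
    by (simp add: nn_integral_radial_measure)
  finally show ?thesis by simp
qed

text \<open>The condition at 0 admits y = 0: the left side integrates 0, and on the right the factor
  0 wins even against an infinite integral, by the convention of \<open>ennreal\<close>.\<close>

lemma radial_measure_scale':
  assumes [measurable]: "G \<in> borel_measurable borel" and "G 0 = 0"
  shows "(\<integral>\<^sup>+r. G (y * r) \<partial>radial_measure \<alpha>) = ennreal (\<bar>y\<bar> powr \<alpha>) * (\<integral>\<^sup>+r. G r \<partial>radial_measure \<alpha>)"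
  using assms \<alpha> by (cases "y = 0") (simp_all add: radial_measure_scale)

lemma radial_measure_min_finite:
  "(\<integral>\<^sup>+r. ennreal (min (r\<^sup>2) 1) \<partial>radial_measure \<alpha>) < \<infinity>"
proof -
  have pos: "0 < levy_const \<alpha>"
    using levy_const_pos[OF \<alpha>] .
  have "(\<integral>\<^sup>+r. ennreal (min (r\<^sup>2) 1) \<partial>radial_measure \<alpha>) =
     (\<integral>\<^sup>+r. ennreal (1 / levy_const \<alpha>) * ennreal (min (r\<^sup>2) 1 * \<bar>r\<bar> powr (- 1 - \<alpha>)) \<partial>lborel)"
    using pos by (auto simp: nn_integral_radial_measure mult.commute simp flip: ennreal_mult intro!: nn_integral_cong)
  also have "\<dots> = ennreal (1 / levy_const \<alpha>) * (\<integral>\<^sup>+r. ennreal (min (r\<^sup>2) 1 * \<bar>r\<bar> powr (- 1 - \<alpha>)) \<partial>lborel)"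
    by (rule nn_integral_cmult) auto
  also have "\<dots> < \<infinity>"
    using nn_integral_min_power2_finite[OF \<alpha>] by (auto simp: ennreal_mult_less_top)
  finally show ?thesis .
qed

text \<open>Scaling reduces this to y = 1, where the value 1 is the normalisation by
  \<open>levy_const\<close>. It is the bridge from stable characteristic functions to Levy
  measures.\<close>

lemma radial_measure_one_minus_cos:
  "(\<integral>\<^sup>+r. ennreal (1 - cos (y * r)) \<partial>radial_measure \<alpha>) = ennreal (\<bar>y\<bar> powr \<alpha>)"
proof -
  have pos: "0 < levy_const \<alpha>"
    using levy_const_pos[OF \<alpha>] .
  have "(\<integral>\<^sup>+r. ennreal (1 - cos r) \<partial>radial_measure \<alpha>) =
     (\<integral>\<^sup>+r. ennreal (1 / levy_const \<alpha>) * ennreal ((1 - cos r) * \<bar>r\<bar> powr (- 1 - \<alpha>)) \<partial>lborel)"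
    using pos by (auto simp: nn_integral_radial_measure mult.commute simp flip: ennreal_mult intro!: nn_integral_cong)
  also have "\<dots> = ennreal (1 / levy_const \<alpha>) * ennreal (levy_const \<alpha>)"
    by (subst nn_integral_cmult) (auto simp: nn_integral_one_minus_cos[OF \<alpha>])
  also have "\<dots> = 1"
    using pos by (simp flip: ennreal_mult)
  finally show ?thesis
    using radial_measure_scale'[of "\<lambda>r. ennreal (1 - cos r)" y] by simp
qed

lemma sigma_finite_radial_measure: "sigma_finite_measure (radial_measure \<alpha>)"
  unfolding radial_measure_def
  by (subst sigma_finite_measure.sigma_finite_iff_density_finite[OF sigma_finite_lborel]) auto

lemma AE_radial_measure_nonzero: "AE r in radial_measure \<alpha>. r \<noteq> 0"
  unfolding radial_measure_def by (subst AE_density) auto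

end

section \<open>Nonsingular systems\<close>

locale nonsingular_system = sigma_finite_measure m for m :: "'s measure" +
  fixes \<phi> :: "'s \<Rightarrow> 's"
  assumes nonsingular: "nonsingular_flow m \<phi>"
begin

abbreviation \<psi> :: "'s \<Rightarrow> 's" where "\<psi> \<equiv> the_inv_into (space m) \<phi>"
abbreviation it :: "int \<Rightarrow> 's \<Rightarrow> 's" where "it \<equiv> int_iterate m \<phi>"

text \<open>The density of \<open>m \<circ> \<phi>\<^sup>n\<close> that enters the kernel. It stays
  in \<open>ennreal\<close>, so that identities between measures can be read as identities between
  densities before finiteness is known.\<close>

definition W :: "int \<Rightarrow> 's \<Rightarrow> ennreal" where
  "W n = RN_deriv m (distr m m (it (- n)))"

lemma \<phi>_measurable [measurable]: "\<phi> \<in> m \<rightarrow>\<^sub>M m"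
  and \<psi>_measurable [measurable]: "\<psi> \<in> m \<rightarrow>\<^sub>M m"
  and bij_\<phi>: "bij_betw \<phi> (space m) (space m)"
  using nonsingular by (simp_all add: nonsingular_flow_def)

lemma \<phi>_space [simp]: "s \<in> space m \<Longrightarrow> \<phi> s \<in> space m"
  and \<psi>_space [simp]: "s \<in> space m \<Longrightarrow> \<psi> s \<in> space m"
  using measurable_space[OF \<phi>_measurable] measurable_space[OF \<psi>_measurable] by auto

lemma \<psi>_\<phi> [simp]: "s \<in> space m \<Longrightarrow> \<psi> (\<phi> s) = s"
  and \<phi>_\<psi> [simp]: "s \<in> space m \<Longrightarrow> \<phi> (\<psi> s) = s"
  using bij_\<phi> by (auto simp: bij_betw_def the_inv_into_f_f f_the_inv_into_f)

lemma W_measurable [measurable]: "W n \<in> borel_measurable m"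
  unfolding W_def by simp

lemma it_measurable [measurable]: "it n \<in> m \<rightarrow>\<^sub>M m"
  unfolding int_iterate_def by (auto intro!: measurable_compose_n)

lemma it_space [simp]: "s \<in> space m \<Longrightarrow> it n s \<in> space m"
  using measurable_space[OF it_measurable] .

lemma it_0 [simp]: "it 0 s = s" and it_1 [simp]: "it 1 s = \<phi> s" and it_m1 [simp]: "it (- 1) s = \<psi> s"
  by (simp_all add: int_iterate_def)

lemma it_add1: "s \<in> space m \<Longrightarrow> it (n + 1) s = it n (\<phi> s)"
proof (cases "0 \<le> n")
  case True
  then show ?thesis by (simp add: int_iterate_def nat_add_distrib funpow_swap1)
next
  case False
  assume s: "s \<in> space m"
  obtain k where n: "n = - int (Suc k)"
    using False by (metis int_cases2 of_nat_0_le_iff neg_0_le_iff_le not0_implies_Suc of_nat_0 order_refl add.inverse_neutral)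
  have "it n (\<phi> s) = (\<psi> ^^ k) s"
    using s by (simp add: int_iterate_def n funpow_swap1 nat_add_distrib)
  moreover have "it (n + 1) s = (\<psi> ^^ k) s"
    by (cases k) (simp_all add: int_iterate_def n nat_add_distrib)
  ultimately show ?thesis by simp
qed

lemma it_diff1: "s \<in> space m \<Longrightarrow> it (n - 1) s = it n (\<psi> s)"
  using it_add1[of "\<psi> s" "n - 1"] by simp

lemma it_add: "s \<in> space m \<Longrightarrow> it (j + k) s = it j (it k s)"
proof (induction k arbitrary: s rule: int_induct[where k=0])
  case base
  then show ?case by simp
next
  case (step1 i)
  then show ?case by (simp add: it_add1 flip: add.assoc)
next
  case (step2 i)
  then show ?case using it_diff1[of s "j + i"] by (simp add: it_diff1 add_diff_eq)
qed

lemma it_inverse [simp]: "s \<in> space m \<Longrightarrow> it n (it (- n) s) = s"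
    "s \<in> space m \<Longrightarrow> it (- n) (it n s) = s"
  using it_add[of s n "- n"] it_add[of s "- n" n] by auto

lemma null_\<phi>: "A \<in> sets m \<Longrightarrow> \<phi> -` A \<inter> space m \<in> null_sets m \<longleftrightarrow> A \<in> null_sets m"
  using nonsingular by (auto simp: nonsingular_flow_def null_sets_def)

lemma null_\<psi>: "A \<in> sets m \<Longrightarrow> \<psi> -` A \<inter> space m \<in> null_sets m \<longleftrightarrow> A \<in> null_sets m"
proof -
  assume A: "A \<in> sets m"
  have "\<phi> -` (\<psi> -` A \<inter> space m) \<inter> space m = A"
    using sets.sets_into_space[OF A] by auto
  with null_\<phi>[of "\<psi> -` A \<inter> space m"] A show ?thesis by simp
qed

lemma null_it: "A \<in> sets m \<Longrightarrow> it n -` A \<inter> space m \<in> null_sets m \<longleftrightarrow> A \<in> null_sets m"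
proof (induction n arbitrary: A rule: int_induct[where k=0])
  case base
  then show ?case by (simp add: vimage_def sets.Int_space_eq2)
next
  case (step1 i)
  have "it (i + 1) -` A \<inter> space m = \<phi> -` (it i -` A \<inter> space m) \<inter> space m"
    by (auto simp: it_add1)
  with step1 null_\<phi>[of "it i -` A \<inter> space m"] show ?case by simp
next
  case (step2 i)
  have "it (i - 1) -` A \<inter> space m = \<psi> -` (it i -` A \<inter> space m) \<inter> space m"
    by (auto simp: it_diff1)
  with step2 null_\<psi>[of "it i -` A \<inter> space m"] show ?case by simp
qed

lemma AE_\<phi>: "AE s in m. P s \<Longrightarrow> AE s in m. P (\<phi> s)"
proof -
  assume "AE s in m. P s"
  then obtain N where N: "N \<in> null_sets m" "{s\<in>space m. \<not> P s} \<subseteq> N"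
    by (auto simp: eventually_ae_filter)
  then have "\<phi> -` N \<inter> space m \<in> null_sets m"
    using null_\<phi> by (auto simp: null_sets_def)
  moreover have "{s\<in>space m. \<not> P (\<phi> s)} \<subseteq> \<phi> -` N \<inter> space m"
    using subsetD[OF N(2)] by auto
  ultimately show ?thesis by (rule AE_I')
qed

section \<open>Radon-Nikodym derivatives along the flow\<close>

lemma density_W: "density m (W n) = distr m m (it (- n))"
  unfolding W_def
proof (rule density_RN_deriv)
  show "absolutely_continuous m (distr m m (it (- n)))"
    unfolding absolutely_continuous_def
  proof
    fix A assume A: "A \<in> null_sets m"
    then have "it (- n) -` A \<inter> space m \<in> null_sets m"
      using null_it by (auto simp: null_sets_def)
    with A show "A \<in> null_sets (distr m m (it (- n)))"
      by (auto simp: null_sets_def emeasure_distr)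
  qed
qed simp

lemma nn_integral_W:
  assumes [measurable]: "K \<in> borel_measurable m"
  shows "(\<integral>\<^sup>+s. W n s * K s \<partial>m) = (\<integral>\<^sup>+s. K (it (- n) s) \<partial>m)"
proof -
  have "(\<integral>\<^sup>+s. W n s * K s \<partial>m) = (\<integral>\<^sup>+s. K s \<partial>density m (W n))"
    by (simp add: nn_integral_density)
  then show ?thesis
    by (simp add: density_W nn_integral_distr)
qed

text \<open>The change of variables formula of the flow, with \<open>W n\<close> as the Jacobian of
  the iterate.\<close>

lemma nn_integral_W_it:
  assumes [measurable]: "K \<in> borel_measurable m"
  shows "(\<integral>\<^sup>+s. W n s * K (it n s) \<partial>m) = (\<integral>\<^sup>+s. K s \<partial>m)"
  by (auto simp: nn_integral_W intro!: nn_integral_cong)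

lemma nn_integral_W_\<phi>:
  assumes "K \<in> borel_measurable m"
  shows "(\<integral>\<^sup>+s. W 1 s * K (\<phi> s) \<partial>m) = (\<integral>\<^sup>+s. K s \<partial>m)"
  using nn_integral_W_it[OF assms, of 1] by simp

text \<open>Pushing the image back by the inverse iterate returns \<open>m\<close>, and a measure
  with a sigma-finite image is itself sigma-finite.\<close>

lemma sigma_finite_distr_it: "sigma_finite_measure (distr m m (it n))"
proof (rule sigma_finite_measure_distr)
  have "distr (distr m m (it n)) m (it (- n)) = distr m m (it (- n) \<circ> it n)"
    by (rule distr_distr) auto
  also have "\<dots> = distr m m (\<lambda>s. s)"
    by (rule distr_cong) auto
  also have "\<dots> = m" by (rule distr_id)
  finally show "sigma_finite_measure (distr (distr m m (it n)) m (it (- n)))"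
    using sigma_finite_measure_axioms by simp
qed simp

lemma W_finite: "AE s in m. W n s \<noteq> \<infinity>"
proof -
  have "sigma_finite_measure (density m (W n))"
    unfolding density_W by (rule sigma_finite_distr_it)
  then show ?thesis
    by (simp add: sigma_finite_iff_density_finite)
qed

text \<open>The measure with density \<open>W n\<close> gives its own zero set mass 0, so a preimage
  of that set under an iterate is null; nonsingularity makes the set itself null.\<close>

lemma W_nonzero: "AE s in m. W n s \<noteq> 0"
proof -
  let ?Z = "{s\<in>space m. W n s = 0}"
  have "(\<integral>\<^sup>+s. W n s * indicator ?Z s \<partial>m) = 0"
    by (subst nn_integral_0_iff_AE) (auto simp: indicator_def)
  then have "(\<integral>\<^sup>+s. indicator (it (- n) -` ?Z \<inter> space m) s \<partial>m) = 0"
    by (subst (asm) nn_integral_W) (auto simp: indicator_def cong: nn_integral_cong_simp)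
  then have "it (- n) -` ?Z \<inter> space m \<in> null_sets m"
    by (subst (asm) nn_integral_indicator) (auto simp: null_sets_def)
  then have "?Z \<in> null_sets m"
    by (subst (asm) null_it) auto
  then show ?thesis
    by (subst AE_iff_null) auto
qed

text \<open>Both the cocycle identity of the Radon-Nikodym derivatives and the equation satisfied by
  an invariant density are instances of this computation.\<close>

lemma density_W_\<phi>:
  assumes [measurable]: "p \<in> borel_measurable m"
  shows "density m (\<lambda>s. W 1 s * p (\<phi> s)) = distr (density m p) m \<psi>"
proof (rule measure_eqI)
  fix A assume "A \<in> sets (density m (\<lambda>s. W 1 s * p (\<phi> s)))"
  then have [measurable]: "A \<in> sets m" by simp
  have "emeasure (density m (\<lambda>s. W 1 s * p (\<phi> s))) A = (\<integral>\<^sup>+s. W 1 s * p (\<phi> s) * indicator A s \<partial>m)"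
    by (rule emeasure_density) auto
  also have "\<dots> = (\<integral>\<^sup>+s. W 1 s * (p (\<phi> s) * indicator A (\<psi> (\<phi> s))) \<partial>m)"
    by (intro nn_integral_cong) (simp add: mult.assoc)
  also have "\<dots> = (\<integral>\<^sup>+s. p s * indicator A (\<psi> s) \<partial>m)"
    by (rule nn_integral_W_\<phi>) measurable
  also have "\<dots> = (\<integral>\<^sup>+s. p s * indicator (\<psi> -` A \<inter> space m) s \<partial>m)"
    by (intro nn_integral_cong) (simp add: indicator_def)
  also have "\<dots> = emeasure (distr (density m p) m \<psi>) A"
    by (simp add: emeasure_distr emeasure_density)
  finally show "emeasure (density m (\<lambda>s. W 1 s * p (\<phi> s))) A = emeasure (distr (density m p) m \<psi>) A" .
qed simp

text \<open>The chain rule: both sides are densities of the same sigma-finite measure. The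
  exceptional null set depends on \<open>n\<close>.\<close>

lemma W_cocycle: "AE s in m. W (n + 1) s = W 1 s * W n (\<phi> s)"
proof -
  have "density m (\<lambda>s. W 1 s * W n (\<phi> s)) = distr (distr m m (it (- n))) m \<psi>"
    by (subst density_W_\<phi>) (auto simp: density_W)
  also have "\<dots> = distr m m (it (- (n + 1)))"
  proof (subst distr_distr)
    have "(\<psi> \<circ> it (- n)) s = it (- (n + 1)) s" if "s \<in> space m" for s
      using it_add[OF that, of "- 1" "- n"] that by (simp add: add.commute)
    then show "distr m m (\<psi> \<circ> it (- n)) = distr m m (it (- (n + 1)))"
      by (rule distr_cong[OF refl refl])
  qed auto
  finally have "AE s in m. W 1 s * W n (\<phi> s) = RN_deriv m (distr m m (it (- (n + 1)))) s"
    by (intro RN_deriv_unique_sigma_finite sigma_finite_distr_it) auto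
  then show ?thesis
    unfolding W_def[of "n + 1"] by eventually_elim simp
qed

section \<open>Invariant measures and positive sets\<close>

lemma invariant_\<psi>:
  assumes \<mu>: "sets \<mu> = sets m" and inv: "invariant_measure \<phi> \<mu>"
  shows "distr \<mu> m \<psi> = \<mu>"
proof -
  have sp: "space \<mu> = space m" using \<mu> by (rule sets_eq_imp_space_eq)
  have [measurable_cong]: "sets \<mu> = sets m" by fact
  have "\<mu> = distr \<mu> m (\<lambda>s. \<psi> (\<phi> s))"
    using distr_id2[of m \<mu>] \<mu> by (subst distr_cong[where g="\<lambda>s. s"]) (auto simp: sp)
  also have "\<dots> = distr (distr \<mu> \<mu> \<phi>) m \<psi>"
    by (subst distr_distr) (auto simp: comp_def)
  also have "\<dots> = distr \<mu> m \<psi>"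
    using inv by (simp add: invariant_measure_def)
  finally show ?thesis by simp
qed

text \<open>Composing a density with \<phi> and multiplying by \<open>W 1\<close> gives the density
  of the image under the inverse, and an invariant measure equals that image.\<close>

lemma invariant_RN_deriv:
  assumes \<mu>: "sigma_finite_measure \<mu>" "sets \<mu> = sets m" and ac: "absolutely_continuous m \<mu>"
    and inv: "invariant_measure \<phi> \<mu>"
  shows "AE s in m. RN_deriv m \<mu> s = W 1 s * RN_deriv m \<mu> (\<phi> s)"
proof -
  have "density m (\<lambda>s. W 1 s * RN_deriv m \<mu> (\<phi> s)) = distr \<mu> m \<psi>"
    by (subst density_W_\<phi>) (auto simp: density_RN_deriv[OF ac \<mu>(2)])
  also have "\<dots> = \<mu>"
    by (rule invariant_\<psi>[OF \<mu>(2) inv])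
  finally have "AE s in m. W 1 s * RN_deriv m \<mu> (\<phi> s) = RN_deriv m \<mu> s"
    by (intro RN_deriv_unique_sigma_finite \<mu>) auto
  then show ?thesis by eventually_elim simp
qed

text \<open>Replaces the abstract invariant measure by a real density \<open>p\<close> whose
  transformation rule is inverse to that of the kernel; this is the datum from which an invariant
  weight on the polar space is built.\<close>

lemma positive_set_density:
  assumes "positive_set m \<phi> P"
  obtains p :: "'s \<Rightarrow> real" where "p \<in> borel_measurable m" "\<And>s. 0 \<le> p s"
    "(\<integral>\<^sup>+s. ennreal (p s) \<partial>m) < \<infinity>" "AE s in m. p s \<noteq> 0 \<longleftrightarrow> s \<in> P"
    "AE s in m. p s = enn2real (W 1 s) * p (\<phi> s)"
proof -
  obtain \<mu> where "finite_measure \<mu>" and eq: "equivalent_measures (density m (indicator P)) \<mu>"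
    and inv: "invariant_measure \<phi> \<mu>" and [measurable]: "P \<in> sets m"
    using assms unfolding positive_set_def by auto
  interpret \<mu>: finite_measure \<mu> by fact
  have sets\<mu>: "sets \<mu> = sets m"
    using eq by (simp add: equivalent_measures_def)
  have null: "A \<in> null_sets \<mu> \<longleftrightarrow> A \<in> null_sets (density m (indicator P))" for A
    using eq by (auto simp: equivalent_measures_def absolutely_continuous_def)
  have ac: "absolutely_continuous m \<mu>"
    unfolding absolutely_continuous_def
    by (auto simp: null null_sets_density_iff intro: eventually_mono[OF AE_not_in])
  let ?q = "RN_deriv m \<mu>"
  have dq: "density m ?q = \<mu>"
    by (rule density_RN_deriv[OF ac sets\<mu>])
  have fin: "AE s in m. ?q s \<noteq> \<infinity>"
    by (rule RN_deriv_finite[OF \<mu>.sigma_finite_measure_axioms ac sets\<mu>])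
  define p where "p s = enn2real (?q s)" for s
  have [measurable]: "p \<in> borel_measurable m" unfolding p_def by simp
  have pq: "AE s in m. ennreal (p s) = ?q s"
    using fin by eventually_elim (simp add: p_def top.not_eq_extremum)
  have "(\<integral>\<^sup>+s. ennreal (p s) \<partial>m) = (\<integral>\<^sup>+s. ?q s * indicator (space m) s \<partial>m)"
    using pq by (intro nn_integral_cong_AE) auto
  also have "\<dots> = emeasure (density m ?q) (space m)"
    by (rule emeasure_density[symmetric]) auto
  also have "\<dots> < \<infinity>"
    unfolding dq using \<mu>.emeasure_finite[of "space m"] unfolding infinity_ennreal_def less_top .
  finally have 1: "(\<integral>\<^sup>+s. ennreal (p s) \<partial>m) < \<infinity>" .
  \<comment> \<open>Equivalence is used both ways: the zero set of \<open>?q\<close> is null for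
    \<mu>, hence almost disjoint from \<open>P\<close>; the complement of \<open>P\<close> is null
    for the restriction of \<open>m\<close>, hence for \<mu>, so \<open>?q\<close> vanishes
    there.\<close>
  have "{s\<in>space m. ?q s = 0} \<in> null_sets (density m ?q)"
    by (subst null_sets_density_iff) auto
  then have "{s\<in>space m. ?q s = 0} \<in> null_sets (density m (indicator P))"
    unfolding dq null .
  then have q0: "AE s in m. ?q s = 0 \<longrightarrow> s \<notin> P"
    by (subst (asm) null_sets_density_iff) (auto simp: indicator_eq_0_iff)
  have "space m - P \<in> null_sets (density m (indicator P))"
    by (subst null_sets_density_iff) auto
  then have "space m - P \<in> null_sets (density m ?q)"
    unfolding dq null .
  then have "AE s in m. s \<notin> P \<longrightarrow> ?q s = 0"
    by (subst (asm) null_sets_density_iff) auto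
  with q0 fin have 2: "AE s in m. p s \<noteq> 0 \<longleftrightarrow> s \<in> P"
    by eventually_elim (auto simp: p_def enn2real_eq_0_iff)
  have 3: "AE s in m. p s = enn2real (W 1 s) * p (\<phi> s)"
    using invariant_RN_deriv[OF \<mu>.sigma_finite_measure_axioms sets\<mu> ac inv]
    by eventually_elim (simp add: p_def enn2real_mult)
  show ?thesis
    by (rule that[OF _ _ 1 2 3]) (auto simp: p_def)
qed

text \<open>The converse direction, to be confronted with the maximality of the positive part. The
  support of the density is invariant because \<open>W 1\<close> is almost everywhere nonzero in the
  transformation rule.\<close>

lemma positive_set_RN_deriv:
  assumes \<mu>: "finite_measure \<mu>" "sets \<mu> = sets m" and ac: "absolutely_continuous m \<mu>"
    and inv: "invariant_measure \<phi> \<mu>"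
  shows "positive_set m \<phi> {s\<in>space m. RN_deriv m \<mu> s \<noteq> 0}"
proof -
  interpret \<mu>: finite_measure \<mu> by fact
  let ?q = "RN_deriv m \<mu>" and ?P = "{s\<in>space m. RN_deriv m \<mu> s \<noteq> 0}"
  have dq: "density m ?q = \<mu>"
    by (rule density_RN_deriv[OF ac \<mu>(2)])
  have "AE s in m. s \<notin> sym_diff (\<phi> -` ?P \<inter> space m) ?P"
    using invariant_RN_deriv[OF \<mu>.sigma_finite_measure_axioms \<mu>(2) ac inv] W_nonzero[of 1] AE_space
    by eventually_elim auto
  then have 1: "sym_diff (\<phi> -` ?P \<inter> space m) ?P \<in> null_sets m"
    by (subst AE_iff_null_sets) auto
  have "A \<in> null_sets (density m (indicator ?P)) \<longleftrightarrow> A \<in> null_sets (density m ?q)" for A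
  proof -
    have "(AE s in m. s \<in> A \<longrightarrow> indicator ?P s = (0::ennreal)) \<longleftrightarrow> (AE s in m. s \<in> A \<longrightarrow> ?q s = 0)"
      by (rule AE_cong) (auto simp: indicator_def)
    then show ?thesis
      by (simp add: null_sets_density_iff)
  qed
  then have "equivalent_measures (density m (indicator ?P)) \<mu>"
    unfolding equivalent_measures_def absolutely_continuous_def dq by (auto simp: \<mu>)
  with 1 \<mu>(1) inv show ?thesis
    unfolding positive_set_def by auto
qed

lemma positive_set_invariant:
  assumes "positive_set m \<phi> P"
  shows "AE s in m. \<phi> s \<in> P \<longleftrightarrow> s \<in> P"
proof -
  have "sym_diff (\<phi> -` P \<inter> space m) P \<in> null_sets m"
    using assms by (simp add: positive_set_def)
  then have "AE s in m. s \<notin> sym_diff (\<phi> -` P \<inter> space m) P"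
    by (rule AE_not_in)
  with AE_space show ?thesis by eventually_elim auto
qed

section \<open>Wandering sets and the dissipative part\<close>

lemma wandering_vimage:
  assumes A: "wandering m \<phi> A"
  shows "wandering m \<phi> (it k -` A \<inter> space m)"
proof -
  have [measurable]: "A \<in> sets m" and d: "disjoint_family (\<lambda>n. it n -` A \<inter> space m)"
    using A by (auto simp: wandering_def)
  have "it n -` (it k -` A \<inter> space m) \<inter> space m = it (k + n) -` A \<inter> space m" for n
    by (auto simp: it_add)
  moreover have "disjoint_family (\<lambda>n. it (k + n) -` A \<inter> space m)"
    using d by (auto simp: disjoint_family_on_def)
  ultimately show ?thesis
    by (simp add: wandering_def)
qed

text \<open>The wandering sets are stable under the flow, so every preimage of \<open>D\<close>
  under an iterate is again an upper bound for them; minimality puts \<open>D\<close> inside each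
  preimage up to a null set.\<close>

lemma dissipative_part_invariant:
  assumes D: "dissipative_part m \<phi> D"
  shows "AE s in m. \<phi> s \<in> D \<longleftrightarrow> s \<in> D"
proof -
  have [measurable]: "D \<in> sets m" and up: "\<And>A. wandering m \<phi> A \<Longrightarrow> A - D \<in> null_sets m"
    and least: "\<And>V. V \<in> sets m \<Longrightarrow> (\<And>A. wandering m \<phi> A \<Longrightarrow> A - V \<in> null_sets m) \<Longrightarrow> D - V \<in> null_sets m"
    using D by (auto simp: dissipative_part_def measurable_union_def)
  have wD: "D - (it k -` D \<inter> space m) \<in> null_sets m" for k
  proof (rule least)
    fix A assume A: "wandering m \<phi> A"
    then have As: "A \<in> sets m" by (simp add: wandering_def)
    have "it k -` ((it (- k) -` A \<inter> space m) - D) \<inter> space m \<in> null_sets m"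
      using up[OF wandering_vimage[OF A, of "- k"]] null_it by (auto simp: null_sets_def)
    also have "it k -` ((it (- k) -` A \<inter> space m) - D) \<inter> space m = A - (it k -` D \<inter> space m)"
      using sets.sets_into_space[OF As] by auto
    finally show "A - (it k -` D \<inter> space m) \<in> null_sets m" .
  qed simp
  have "AE s in m. s \<notin> D - (\<phi> -` D \<inter> space m)"
    using wD[of 1] by (intro AE_not_in) (simp add: vimage_def)
  \<comment> \<open>The inclusion of \<open>D\<close> in its preimage under the inverse, read at the
    point \<phi> s, gives the reverse implication.\<close>
  moreover have "AE s in m. \<phi> s \<notin> D - (\<psi> -` D \<inter> space m)"
    using wD[of "- 1"] by (intro AE_\<phi> AE_not_in) (simp add: vimage_def)
  ultimately show ?thesis
    using AE_space by eventually_elim auto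
qed

text \<open>The forward preimages of \<open>A\<close> are disjoint and have equal mass for the
  finite invariant measure. A convergent constant series forces that mass to be 0.\<close>

lemma wandering_Int_positive_set:
  assumes A: "wandering m \<phi> A" and P: "positive_set m \<phi> P"
  shows "A \<inter> P \<in> null_sets m"
proof -
  obtain \<mu> where "finite_measure \<mu>" and eq: "equivalent_measures (density m (indicator P)) \<mu>"
    and inv: "invariant_measure \<phi> \<mu>" and [measurable]: "P \<in> sets m"
    using P unfolding positive_set_def by auto
  interpret \<mu>: finite_measure \<mu> by fact
  have sets\<mu>[measurable_cong]: "sets \<mu> = sets m"
    using eq by (simp add: equivalent_measures_def)
  have sp: "space \<mu> = space m"
    using sets\<mu> by (rule sets_eq_imp_space_eq)
  have As[measurable]: "A \<in> sets m" and d: "disjoint_family (\<lambda>n. it n -` A \<inter> space m)"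
    using A by (auto simp: wandering_def)
  have \<mu>\<phi>: "measure \<mu> (\<phi> -` B \<inter> space m) = measure \<mu> B" if "B \<in> sets m" for B
  proof -
    have "measure (distr \<mu> \<mu> \<phi>) B = measure \<mu> (\<phi> -` B \<inter> space \<mu>)"
      using that by (intro measure_distr) (auto simp: sets\<mu>)
    then show ?thesis
      using inv by (simp add: invariant_measure_def sp)
  qed
  have const: "measure \<mu> (it (int k) -` A \<inter> space m) = measure \<mu> A" for k
  proof (induction k)
    case 0
    then show ?case using sets.sets_into_space[OF As] by (simp add: vimage_def Int_absorb2)
  next
    case (Suc k)
    have "it (int (Suc k)) -` A \<inter> space m = \<phi> -` (it (int k) -` A \<inter> space m) \<inter> space m"
      using it_add1[of _ "int k"] by (auto simp: add.commute)
    moreover have "it (int k) -` A \<inter> space m \<in> sets m"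
      by measurable
    ultimately show ?case using Suc \<mu>\<phi> by metis
  qed
  have "disjoint_family (\<lambda>k. it (int k) -` A \<inter> space m)"
    using d by (auto simp: disjoint_family_on_def)
  then have "(\<lambda>k. measure \<mu> (it (int k) -` A \<inter> space m)) sums measure \<mu> (\<Union>k. it (int k) -` A \<inter> space m)"
    by (intro \<mu>.finite_measure_UNION) (auto simp: sets\<mu> intro: measurable_sets[OF it_measurable])
  then have "measure \<mu> A = 0"
    unfolding const by (auto dest!: sums_summable simp: summable_const_iff)
  then have "A \<in> null_sets \<mu>"
    by (simp add: null_sets_def \<mu>.emeasure_eq_measure sets\<mu>)
  then have "A \<in> null_sets (density m (indicator P))"
    using eq by (auto simp: equivalent_measures_def absolutely_continuous_def)
  then have "AE s in m. s \<notin> A \<inter> P"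
    by (subst (asm) null_sets_density_iff) (auto simp: indicator_eq_0_iff)
  then show ?thesis
    by (subst AE_iff_null_sets) auto
qed

text \<open>By the previous lemma the complement of \<open>P\<close> is an upper bound for the
  wandering sets, and \<open>D\<close> is the least one.\<close>

lemma dissipative_part_Int_positive_set:
  assumes D: "dissipative_part m \<phi> D" and P: "positive_set m \<phi> P"
  shows "AE s in m. s \<in> D \<longrightarrow> s \<notin> P"
proof -
  have Ps: "P \<in> sets m" using P by (simp add: positive_set_def)
  have "D - (space m - P) \<in> null_sets m"
  proof -
    have "A - (space m - P) \<in> null_sets m" if A: "wandering m \<phi> A" for A
    proof -
      have "A \<in> sets m" using A by (simp add: wandering_def)
      then have "A - (space m - P) = A \<inter> P"
        using sets.sets_into_space by fastforce
      then show ?thesis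
        using wandering_Int_positive_set[OF A P] by simp
    qed
    then show ?thesis
      using D Ps unfolding dissipative_part_def measurable_union_def by auto
  qed
  then have "AE s in m. s \<notin> D - (space m - P)"
    by (rule AE_not_in)
  then show ?thesis by eventually_elim auto
qed

end

section \<open>Levy measures of stable kernels\<close>

lemma seq_component_measurable [measurable]: "(\<lambda>x. x n) \<in> borel_measurable seq_space"
  by (rule measurable_component_singleton) simp

lemma seq_space_measurableI:
  "(\<And>n. (\<lambda>z. f z n) \<in> borel_measurable M) \<Longrightarrow> f \<in> M \<rightarrow>\<^sub>M seq_space"
  by (rule measurable_PiM_single') (auto simp: space_PiM)

lemma space_seq_space [simp]: "space seq_space = UNIV"
  by (simp add: space_PiM)

lemma shift_measurable [measurable]: "shift \<in> seq_space \<rightarrow>\<^sub>M seq_space"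
  unfolding shift_def by (rule seq_space_measurableI) measurable

lemma pairing_measurable [measurable]: "pairing a \<in> borel_measurable seq_space"
  unfolding pairing_def by measurable

lemma pairing_truncate_measurable [measurable]:
  "(\<lambda>x. pairing a (truncate_seq x)) \<in> borel_measurable seq_space"
  unfolding pairing_def truncate_seq_def by measurable

lemma pairing_scale: "pairing a (\<lambda>n. r * x n) = r * pairing a x"
  by (simp add: pairing_def sum_distrib_left mult.left_commute)

lemma pairing_uminus: "pairing a (\<lambda>n. - x n) = - pairing a x"
  using pairing_scale[of a "- 1" x] by simp

lemma truncate_seq_uminus: "truncate_seq (\<lambda>n. - x n) = (\<lambda>n. - truncate_seq x n)"
  by (auto simp: truncate_seq_def max_def min_def)

lemma abs_sin_minus_le: "\<bar>sin p - p\<bar> \<le> (p::real)\<^sup>2"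
proof -
  have "\<bar>sin p - p\<bar> = \<bar>Im (iexp p - (\<Sum>k\<le>1. (\<i> * p)^k / fact k))\<bar>"
    by (simp add: Im_exp)
  also have "\<dots> \<le> cmod (iexp p - (\<Sum>k\<le>1. (\<i> * p)^k / fact k))"
    by (rule abs_Im_le_cmod)
  also have "\<dots> \<le> \<bar>p\<bar> ^ Suc 1 / fact (Suc 1)"
    by (rule iexp_approx1)
  also have "\<dots> \<le> p\<^sup>2"
    by (simp add: power2_eq_square)
  finally show ?thesis .
qed

text \<open>Gives integrability of the compensated imaginary part. If all relevant coordinates are
  at most 1 in modulus, the truncation is inactive and the error is quadratic; the squared
  coefficients come from Cauchy-Schwarz. Otherwise the last sum is at least 1, while the sine is
  bounded by 1 and the truncated pairing by the sum of the \<open>\<bar>a n\<bar>\<close>.\<close>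

lemma abs_sin_pairing_le:
  assumes fin: "finite {n. a n \<noteq> 0}"
  shows "\<bar>sin (pairing a x) - pairing a (truncate_seq x)\<bar> \<le>
    ((\<Sum>n | a n \<noteq> 0. (a n)\<^sup>2) + 1 + (\<Sum>n | a n \<noteq> 0. \<bar>a n\<bar>)) * (\<Sum>n | a n \<noteq> 0. min ((x n)\<^sup>2) 1)"
    (is "_ \<le> (?A2 + 1 + ?A) * ?T")
proof -
  let ?I = "{n. a n \<noteq> 0}"
  have nn: "0 \<le> ?A2" "0 \<le> ?A" "0 \<le> ?T"
    by (auto intro!: sum_nonneg)
  show ?thesis
  proof (cases "\<forall>n\<in>?I. \<bar>x n\<bar> \<le> 1")
    case True
    then have q: "pairing a (truncate_seq x) = pairing a x"
      unfolding pairing_def truncate_seq_def by (intro sum.cong) (auto simp: abs_le_iff max_def min_def)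
    have T: "?T = (\<Sum>n\<in>?I. (x n)\<^sup>2)"
      using True by (intro sum.cong) (auto simp: min_def abs_square_le_1)
    have "\<bar>sin (pairing a x) - pairing a (truncate_seq x)\<bar> \<le> (pairing a x)\<^sup>2"
      unfolding q by (rule abs_sin_minus_le)
    also have "\<dots> \<le> ?A2 * ?T"
      unfolding T pairing_def by (rule Cauchy_Schwarz_ineq_sum)
    also have "\<dots> \<le> (?A2 + 1 + ?A) * ?T"
      using nn by (intro mult_right_mono) auto
    finally show ?thesis .
  next
    case False
    then obtain n where n: "n \<in> ?I" "1 < \<bar>x n\<bar>" by auto
    have "1 \<le> (x n)\<^sup>2"
      using n(2) abs_square_le_1[of "x n"] by linarith
    then have "1 = min ((x n)\<^sup>2) 1" by simp
    also have "\<dots> \<le> ?T"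
      by (rule member_le_sum[OF n(1)]) (use fin in auto)
    finally have T: "1 \<le> ?T" .
    have "\<bar>pairing a (truncate_seq x)\<bar> \<le> (\<Sum>n\<in>?I. \<bar>a n * truncate_seq x n\<bar>)"
      unfolding pairing_def by (rule sum_abs)
    also have "\<dots> \<le> ?A"
      by (intro sum_mono) (auto simp: abs_mult truncate_seq_def intro!: mult_left_le)
    finally have "\<bar>sin (pairing a x) - pairing a (truncate_seq x)\<bar> \<le> 1 + ?A"
      using abs_sin_le_one[of "pairing a x"] by linarith
    also have "\<dots> \<le> (?A2 + 1 + ?A) * 1"
      using nn by simp
    also have "\<dots> \<le> (?A2 + 1 + ?A) * ?T"
      using nn T by (intro mult_left_mono) auto
    finally show ?thesis .
  qed
qed

section \<open>Images of polar measures along rays\<close>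

locale stable_kernel = sigma_finite_measure m for m :: "'s measure" +
  fixes \<alpha> :: real and F :: "int \<Rightarrow> 's \<Rightarrow> real"
  assumes \<alpha>: "0 < \<alpha>" "\<alpha> < 2" and F: "\<And>n. L_alpha \<alpha> m (F n)"
begin

sublocale radial: sigma_finite_measure "radial_measure \<alpha>"
  by (rule sigma_finite_radial_measure) (rule \<alpha>)+

sublocale polar: pair_sigma_finite m "radial_measure \<alpha>" ..

abbreviation polar_measure :: "('s \<times> real) measure" where
  "polar_measure \<equiv> m \<Otimes>\<^sub>M radial_measure \<alpha>"

definition ray :: "'s \<times> real \<Rightarrow> int \<Rightarrow> real" where
  "ray z = (\<lambda>n. snd z * F n (fst z))"

text \<open>The weight is arbitrary because the same rays carry both the Levy measure, weighted by
  an indicator, and the invariant probability equivalent to it, weighted by an integrable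
  function.\<close>

definition ray_measure :: "('s \<times> real \<Rightarrow> ennreal) \<Rightarrow> (int \<Rightarrow> real) measure" where
  "ray_measure k = distr (density polar_measure k) seq_space ray"

abbreviation ray_measure_on :: "'s set \<Rightarrow> (int \<Rightarrow> real) measure" where
  "ray_measure_on B \<equiv> ray_measure (\<lambda>z. indicator B (fst z))"

lemma F_measurable [measurable]: "F n \<in> borel_measurable m"
  using F[of n] by (simp add: L_alpha_def)

lemma ray_measurable [measurable]: "ray \<in> polar_measure \<rightarrow>\<^sub>M seq_space"
  unfolding ray_def by (rule seq_space_measurableI) measurable

lemma sets_ray_measure [simp, measurable_cong]: "sets (ray_measure k) = sets seq_space"
  and space_ray_measure [simp]: "space (ray_measure k) = UNIV"
  by (simp_all add: ray_measure_def)

lemma nn_integral_ray_measure: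
  assumes [measurable]: "k \<in> borel_measurable polar_measure" "G \<in> borel_measurable seq_space"
  shows "(\<integral>\<^sup>+x. G x \<partial>ray_measure k) = (\<integral>\<^sup>+z. k z * G (ray z) \<partial>polar_measure)"
  unfolding ray_measure_def by (simp add: nn_integral_distr nn_integral_density)

lemma nn_integral_ray_measure_on:
  assumes [measurable]: "B \<in> sets m" "G \<in> borel_measurable seq_space"
  shows "(\<integral>\<^sup>+x. G x \<partial>ray_measure_on B) =
    (\<integral>\<^sup>+s. indicator B s * (\<integral>\<^sup>+r. G (\<lambda>n. r * F n s) \<partial>radial_measure \<alpha>) \<partial>m)"
proof -
  have "(\<integral>\<^sup>+x. G x \<partial>ray_measure_on B) = (\<integral>\<^sup>+z. indicator B (fst z) * G (ray z) \<partial>polar_measure)"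
    by (rule nn_integral_ray_measure) measurable
  also have "\<dots> = (\<integral>\<^sup>+s. \<integral>\<^sup>+r. indicator B s * G (ray (s, r)) \<partial>radial_measure \<alpha> \<partial>m)"
    by (subst radial.nn_integral_fst[symmetric]) auto
  also have "\<dots> = (\<integral>\<^sup>+s. indicator B s * (\<integral>\<^sup>+r. G (ray (s, r)) \<partial>radial_measure \<alpha>) \<partial>m)"
    by (intro nn_integral_cong nn_integral_cmult) measurable
  finally show ?thesis by (simp add: ray_def)
qed

lemma AE_ray_measure:
  assumes [measurable]: "k \<in> borel_measurable polar_measure" "Measurable.pred seq_space P"
  shows "(AE x in ray_measure k. P x) \<longleftrightarrow> (AE z in polar_measure. 0 < k z \<longrightarrow> P (ray z))"
proof -
  have "ray \<in> density polar_measure k \<rightarrow>\<^sub>M seq_space" "{x\<in>space seq_space. P x} \<in> sets seq_space"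
    by measurable
  from AE_distr_iff[OF this] show ?thesis
    unfolding ray_measure_def by (simp add: AE_density)
qed

lemma AE_polar_fst: "AE s in m. P s \<Longrightarrow> AE z in polar_measure. P (fst z)"
proof -
  assume "AE s in m. P s"
  then obtain N where N: "{s\<in>space m. \<not> P s} \<subseteq> N" "N \<in> null_sets m"
    by (auto simp: eventually_ae_filter)
  then have "N \<times> UNIV \<in> null_sets polar_measure"
    using radial.emeasure_pair_measure_Times[of N m UNIV] by (auto simp: null_sets_def)
  then show ?thesis
    by (rule AE_I') (use N in \<open>auto simp: space_pair_measure\<close>)
qed

lemma AE_polar_snd: "AE z in polar_measure. snd z \<noteq> 0"
proof -
  have "{0} \<in> null_sets (radial_measure \<alpha>)"
    using AE_radial_measure_nonzero[of \<alpha>] \<alpha> by (subst AE_iff_null_sets) auto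
  then have "space m \<times> {0} \<in> null_sets polar_measure"
    using radial.emeasure_pair_measure_Times[of "space m" m "{0}"] by (auto simp: null_sets_def)
  then show ?thesis
    by (rule AE_I') (auto simp: space_pair_measure)
qed

text \<open>Equivalence of two image measures is decided before taking images, by the zero sets of
  the weights.\<close>

lemma null_sets_ray_measure_cong:
  assumes [measurable]: "k \<in> borel_measurable polar_measure" "k' \<in> borel_measurable polar_measure"
    and eq: "AE z in polar_measure. k z = 0 \<longleftrightarrow> k' z = 0"
  shows "null_sets (ray_measure k) = null_sets (ray_measure k')"
proof (rule set_eqI)
  fix A
  show "A \<in> null_sets (ray_measure k) \<longleftrightarrow> A \<in> null_sets (ray_measure k')"
  proof (cases "A \<in> sets seq_space")
    case True
    note [measurable] = True
    have "(AE z in polar_measure. 0 < k z \<longrightarrow> ray z \<notin> A) \<longleftrightarrow>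
        (AE z in polar_measure. 0 < k' z \<longrightarrow> ray z \<notin> A)"
      by (rule eventually_subst) (use eq in \<open>eventually_elim, auto simp: zero_less_iff_neq_zero\<close>)
    then show ?thesis
      by (simp add: AE_iff_null_sets AE_ray_measure)
  qed (auto simp: null_sets_def)
qed

text \<open>Scaling the radius by \<open>F n s\<close> turns the inner integral into a constant
  times \<open>\<bar>F n s\<bar> powr \<alpha>\<close>, and the kernel lies in
  \<open>L\<^sup>\<alpha>\<close>.\<close>

lemma ray_measure_min_finite:
  assumes [measurable]: "B \<in> sets m"
  shows "(\<integral>\<^sup>+x. ennreal (min ((x n)\<^sup>2) 1) \<partial>ray_measure_on B) < \<infinity>"
proof -
  let ?C = "\<integral>\<^sup>+r. ennreal (min (r\<^sup>2) 1) \<partial>radial_measure \<alpha>"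
  have "(\<integral>\<^sup>+x. ennreal (min ((x n)\<^sup>2) 1) \<partial>ray_measure_on B) =
      (\<integral>\<^sup>+s. indicator B s * (\<integral>\<^sup>+r. ennreal (min ((r * F n s)\<^sup>2) 1) \<partial>radial_measure \<alpha>) \<partial>m)"
    by (rule nn_integral_ray_measure_on) measurable
  also have "\<dots> = (\<integral>\<^sup>+s. indicator B s * (ennreal (\<bar>F n s\<bar> powr \<alpha>) * ?C) \<partial>m)"
    using radial_measure_scale'[OF \<alpha>, of "\<lambda>r. ennreal (min (r\<^sup>2) 1)"]
    by (simp add: mult.commute[of _ "F n _"])
  also have "\<dots> \<le> (\<integral>\<^sup>+s. ennreal (\<bar>F n s\<bar> powr \<alpha>) * ?C \<partial>m)"
    by (intro nn_integral_mono) (simp add: indicator_def)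
  also have "\<dots> = (\<integral>\<^sup>+s. ennreal (\<bar>F n s\<bar> powr \<alpha>) \<partial>m) * ?C"
    by (rule nn_integral_multc) measurable
  also have "\<dots> < \<infinity>"
    using F[of n] radial_measure_min_finite[OF \<alpha>] by (auto simp: L_alpha_def ennreal_mult_less_top)
  finally show ?thesis .
qed

lemma ray_measure_zero:
  assumes [measurable]: "B \<in> sets m" and supp: "AE s in m. s \<in> B \<longrightarrow> (\<exists>n. F n s \<noteq> 0)"
  shows "{\<lambda>_. 0} \<in> null_sets (ray_measure_on B)"
proof -
  have "{\<lambda>_. 0} = {x \<in> space seq_space. \<forall>n. x n = (0::real)}"
    by auto
  also have "\<dots> \<in> sets seq_space" by measurable
  finally have [measurable]: "{\<lambda>_. 0} \<in> sets seq_space" .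
  have "AE z in polar_measure. 0 < (indicator B (fst z) :: ennreal) \<longrightarrow> ray z \<notin> {\<lambda>_. 0}"
    using AE_polar_fst[OF supp] AE_polar_snd
    by eventually_elim (auto simp: ray_def indicator_def fun_eq_iff)
  then show ?thesis
    by (simp add: AE_iff_null_sets AE_ray_measure)
qed

text \<open>An image of a sigma-finite measure need not be sigma-finite. Here a nonzero sequence has
  some coordinate away from 0, and a Markov bound with the truncated square makes such sets finite;
  the zero sequence is null by the support condition.\<close>

lemma sigma_finite_ray_measure:
  assumes B[measurable]: "B \<in> sets m" and supp: "AE s in m. s \<in> B \<longrightarrow> (\<exists>n. F n s \<noteq> 0)"
  shows "sigma_finite_measure (ray_measure_on B)"
proof
  let ?A = "\<lambda>(n::int, j::nat). {x\<in>space seq_space. 1 / (real j + 1) \<le> min ((x n)\<^sup>2) (1::real)}"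
  have A: "?A i \<in> sets seq_space" for i
    by (cases i) (simp only: prod.case, measurable)
  show "\<exists>\<A>. countable \<A> \<and> \<A> \<subseteq> sets (ray_measure_on B) \<and> \<Union>\<A> = space (ray_measure_on B) \<and>
      (\<forall>a\<in>\<A>. emeasure (ray_measure_on B) a \<noteq> \<infinity>)"
  proof (intro exI[of _ "insert {\<lambda>_. 0} (range ?A)"] conjI ballI)
    show "countable (insert {\<lambda>_. 0} (range ?A))" by simp
    show "insert {\<lambda>_. 0} (range ?A) \<subseteq> sets (ray_measure_on B)"
      using ray_measure_zero[OF B supp] A by (auto simp only: null_sets_def sets_ray_measure)
    show "\<Union>(insert {\<lambda>_. 0} (range ?A)) = space (ray_measure_on B)"
    proof -
      have "x \<in> \<Union>(insert {\<lambda>_. 0} (range ?A))" for x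
      proof (cases "\<exists>n. x n \<noteq> 0")
        case True
        then obtain n where n: "0 < min ((x n)\<^sup>2) 1" by auto
        then obtain j :: nat where "1 / (real j + 1) \<le> min ((x n)\<^sup>2) 1"
          using reals_Archimedean[OF n] by (auto simp: inverse_eq_divide add.commute intro: less_imp_le)
        then have "x \<in> ?A (n, j)" by simp
        then show ?thesis by blast
      qed auto
      then show ?thesis by auto
    qed
    fix a assume "a \<in> insert {\<lambda>_. 0} (range ?A)"
    then consider "a = {\<lambda>_. 0}" | n j where "a = ?A (n, j)" by auto
    then show "emeasure (ray_measure_on B) a \<noteq> \<infinity>"
    proof cases
      case 1
      then show ?thesis using ray_measure_zero[OF B supp] by (simp add: null_sets_def)
    next
      case (2 n j)
      have [measurable]: "a \<in> sets seq_space" unfolding 2 by (rule A)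
      have "emeasure (ray_measure_on B) a = (\<integral>\<^sup>+x. indicator a x \<partial>ray_measure_on B)"
        by simp
      also have "\<dots> \<le> (\<integral>\<^sup>+x. ennreal (real j + 1) * ennreal (min ((x n)\<^sup>2) 1) \<partial>ray_measure_on B)"
      proof (intro nn_integral_mono)
        fix x
        have "1 \<le> ennreal (real j + 1) * ennreal (min ((x n)\<^sup>2) 1)" if "x \<in> a"
        proof -
          have "1 \<le> (real j + 1) * min ((x n)\<^sup>2) 1"
            using that pos_divide_le_eq[of "real j + 1" 1 "min ((x n)\<^sup>2) 1"] unfolding 2
            by (simp del: min_less_iff_conj min.bounded_iff add: mult.commute)
          then have "ennreal 1 \<le> ennreal ((real j + 1) * min ((x n)\<^sup>2) 1)"
            by (rule ennreal_leI)
          then show ?thesis by (simp add: ennreal_mult'')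
        qed
        then show "indicator a x \<le> ennreal (real j + 1) * ennreal (min ((x n)\<^sup>2) 1)"
          by (auto simp: indicator_def)
      qed
      also have "\<dots> = ennreal (real j + 1) * (\<integral>\<^sup>+x. ennreal (min ((x n)\<^sup>2) 1) \<partial>ray_measure_on B)"
        by (rule nn_integral_cmult) measurable
      also have "\<dots> < \<infinity>"
        using ray_measure_min_finite[OF B, of n] by (simp add: ennreal_mult_less_top)
      finally show ?thesis by simp
    qed
  qed
qed

section \<open>The Levy-Khintchine exponent of a ray measure\<close>

lemma ray_measure_one_minus_cos:
  assumes [measurable]: "B \<in> sets m"
  shows "(\<integral>\<^sup>+x. ennreal (1 - cos (pairing a x)) \<partial>ray_measure_on B) =
    (\<integral>\<^sup>+s. ennreal (\<bar>pairing a (\<lambda>n. indicator B s * F n s)\<bar> powr \<alpha>) \<partial>m)"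
proof -
  have "(\<integral>\<^sup>+x. ennreal (1 - cos (pairing a x)) \<partial>ray_measure_on B) =
      (\<integral>\<^sup>+s. indicator B s * (\<integral>\<^sup>+r. ennreal (1 - cos (pairing a (\<lambda>n. r * F n s))) \<partial>radial_measure \<alpha>) \<partial>m)"
    by (rule nn_integral_ray_measure_on) measurable
  also have "\<dots> = (\<integral>\<^sup>+s. indicator B s * ennreal (\<bar>pairing a (\<lambda>n. F n s)\<bar> powr \<alpha>) \<partial>m)"
    using radial_measure_one_minus_cos[OF \<alpha>] by (simp add: pairing_scale mult.commute[of _ "pairing a _"])
  also have "\<dots> = (\<integral>\<^sup>+s. ennreal (\<bar>pairing a (\<lambda>n. indicator B s * F n s)\<bar> powr \<alpha>) \<partial>m)"
    using \<alpha> by (intro nn_integral_cong) (simp add: pairing_scale indicator_def)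
  finally show ?thesis .
qed

lemma ray_measure_uminus:
  assumes [measurable]: "B \<in> sets m"
  shows "distr (ray_measure_on B) seq_space (\<lambda>x n. - x n) = ray_measure_on B"
proof (rule measure_eqI)
  have [measurable]: "(\<lambda>x n. - x n) \<in> seq_space \<rightarrow>\<^sub>M seq_space"
    by (rule seq_space_measurableI) measurable
  fix A assume "A \<in> sets (distr (ray_measure_on B) seq_space (\<lambda>x n. - x n))"
  then have [measurable]: "A \<in> sets seq_space" by simp
  have "emeasure (distr (ray_measure_on B) seq_space (\<lambda>x n. - x n)) A =
      (\<integral>\<^sup>+x. indicator A x \<partial>distr (ray_measure_on B) seq_space (\<lambda>x n. - x n))"
    by simp
  also have "\<dots> = (\<integral>\<^sup>+x. indicator A (\<lambda>n. - x n) \<partial>ray_measure_on B)"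
    by (rule nn_integral_distr) auto
  also have "\<dots> = (\<integral>\<^sup>+s. indicator B s * (\<integral>\<^sup>+r. indicator A (\<lambda>n. - (r * F n s)) \<partial>radial_measure \<alpha>) \<partial>m)"
    by (rule nn_integral_ray_measure_on) measurable
  also have "\<dots> = (\<integral>\<^sup>+s. indicator B s * (\<integral>\<^sup>+r. indicator A (\<lambda>n. r * F n s) \<partial>radial_measure \<alpha>) \<partial>m)"
  proof (rule nn_integral_cong)
    fix s
    have [measurable]: "(\<lambda>r n. r * F n s) \<in> borel \<rightarrow>\<^sub>M seq_space"
      by (rule seq_space_measurableI) measurable
    show "indicator B s * (\<integral>\<^sup>+r. indicator A (\<lambda>n. - (r * F n s)) \<partial>radial_measure \<alpha>) =
        indicator B s * (\<integral>\<^sup>+r. indicator A (\<lambda>n. r * F n s) \<partial>radial_measure \<alpha>)"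
      using radial_measure_scale[OF \<alpha>, of "\<lambda>r. indicator A (\<lambda>n. r * F n s)" "- 1"] by simp
  qed
  also have "\<dots> = (\<integral>\<^sup>+x. indicator A x \<partial>ray_measure_on B)"
    by (rule nn_integral_ray_measure_on[symmetric]) measurable
  finally show "emeasure (distr (ray_measure_on B) seq_space (\<lambda>x n. - x n)) A =
      emeasure (ray_measure_on B) A"
    by simp
qed simp

text \<open>The real part of the integrand is the cosine term, already evaluated by the
  normalisation. The imaginary part is odd and the measure is symmetric, so it contributes
  nothing.\<close>

lemma levy_exponent_ray_measure:
  assumes B[measurable]: "B \<in> sets m" and fin: "finite {n. a n \<noteq> 0}"
  shows "(\<integral>x. iexp (pairing a x) - 1 - \<i> * complex_of_real (pairing a (truncate_seq x)) \<partial>ray_measure_on B) =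
    - complex_of_real (enn2real (\<integral>\<^sup>+s. ennreal (\<bar>pairing a (\<lambda>n. indicator B s * F n s)\<bar> powr \<alpha>) \<partial>m))"
proof -
  let ?Q = "ray_measure_on B" and ?I = "{n. a n \<noteq> 0}"
  let ?N = "\<integral>\<^sup>+s. ennreal (\<bar>pairing a (\<lambda>n. indicator B s * F n s)\<bar> powr \<alpha>) \<partial>m"
  let ?c = "\<lambda>x. 1 - cos (pairing a x)" and ?g = "\<lambda>x. sin (pairing a x) - pairing a (truncate_seq x)"
  have split: "iexp (pairing a x) - 1 - \<i> * complex_of_real (pairing a (truncate_seq x)) =
      complex_of_real (- ?c x) + \<i> * complex_of_real (?g x)" for x
    by (simp add: complex_eq_iff Re_exp Im_exp)
  have int_min: "integrable ?Q (\<lambda>x. min ((x n)\<^sup>2) 1)" for n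
  proof (rule integrableI_nonneg)
    show "(\<integral>\<^sup>+x. ennreal (min ((x n)\<^sup>2) 1) \<partial>?Q) < \<infinity>"
      by (rule ray_measure_min_finite[OF B])
  qed auto
  have int_g: "integrable ?Q ?g"
  proof (rule Bochner_Integration.integrable_bound)
    show "integrable ?Q (\<lambda>x. ((\<Sum>n\<in>?I. (a n)\<^sup>2) + 1 + (\<Sum>n\<in>?I. \<bar>a n\<bar>)) * (\<Sum>n\<in>?I. min ((x n)\<^sup>2) 1))"
      by (intro integrable_mult_right Bochner_Integration.integrable_sum int_min)
    show "AE x in ?Q. norm (?g x) \<le>
        norm (((\<Sum>n\<in>?I. (a n)\<^sup>2) + 1 + (\<Sum>n\<in>?I. \<bar>a n\<bar>)) * (\<Sum>n\<in>?I. min ((x n)\<^sup>2) 1))"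
      unfolding real_norm_def
      by (intro always_eventually allI order.trans[OF abs_sin_pairing_le[OF fin] abs_ge_self])
  qed measurable
  have N: "(\<integral>\<^sup>+x. ennreal (?c x) \<partial>?Q) = ?N"
    by (rule ray_measure_one_minus_cos[OF B])
  \<comment> \<open>Without finiteness \<open>enn2real\<close> would hide an infinite exponent. The
    bound has the same two cases as the estimate for the sine.\<close>
  have "?N < \<infinity>"
  proof -
    have "?N \<le> (\<integral>\<^sup>+x. ennreal ((2 * (\<Sum>n\<in>?I. (a n)\<^sup>2) + 2) * (\<Sum>n\<in>?I. min ((x n)\<^sup>2) 1)) \<partial>?Q)"
      unfolding N[symmetric]
    proof (intro nn_integral_mono ennreal_leI)
      fix x :: "int \<Rightarrow> real"
      let ?T = "\<Sum>n\<in>?I. min ((x n)\<^sup>2) 1"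
      have nn: "0 \<le> ?T" "0 \<le> (\<Sum>n\<in>?I. (a n)\<^sup>2)"
        by (auto intro!: sum_nonneg)
      show "?c x \<le> (2 * (\<Sum>n\<in>?I. (a n)\<^sup>2) + 2) * ?T"
      proof (cases "\<forall>n\<in>?I. \<bar>x n\<bar> \<le> 1")
        case True
        then have T: "?T = (\<Sum>n\<in>?I. (x n)\<^sup>2)"
          by (intro sum.cong) (auto simp: min_def abs_square_le_1)
        have "?c x \<le> 2 * (pairing a x)\<^sup>2"
          using one_minus_cos_le[of "pairing a x"] by linarith
        also have "(pairing a x)\<^sup>2 \<le> (\<Sum>n\<in>?I. (a n)\<^sup>2) * ?T"
          unfolding T pairing_def by (rule Cauchy_Schwarz_ineq_sum)
        finally show ?thesis
          using nn by (simp add: algebra_simps)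
      next
        case False
        then obtain n where n: "n \<in> ?I" "1 < \<bar>x n\<bar>" by auto
        have "1 \<le> (x n)\<^sup>2"
          using n(2) abs_square_le_1[of "x n"] by linarith
        then have "1 = min ((x n)\<^sup>2) 1" by simp
        also have "\<dots> \<le> ?T"
          by (rule member_le_sum[OF n(1)]) (use fin in auto)
        finally have "1 \<le> ?T" .
        have "?c x \<le> 2 * 1"
          using cos_ge_minus_one[of "pairing a x"] by linarith
        also have "\<dots> \<le> (2 * (\<Sum>n\<in>?I. (a n)\<^sup>2) + 2) * ?T"
          using nn \<open>1 \<le> ?T\<close> by (intro mult_mono) auto
        finally show ?thesis .
      qed
    qed
    also have "\<dots> < \<infinity>"
      using int_min
      by (subst nn_integral_eq_integral) (auto intro!: mult_nonneg_nonneg add_nonneg_nonneg sum_nonneg)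
    finally show ?thesis .
  qed
  then have int_c: "integrable ?Q ?c"
    by (intro integrableI_nonneg) (auto simp: N)
  have "(\<integral>x. ?c x \<partial>?Q) = enn2real ?N"
    by (subst integral_eq_nn_integral) (auto simp: N)
  moreover have "(\<integral>x. ?g x \<partial>?Q) = 0"
  proof -
    have [measurable]: "(\<lambda>x n. - x n) \<in> seq_space \<rightarrow>\<^sub>M seq_space"
      by (rule seq_space_measurableI) measurable
    have "(\<integral>x. ?g x \<partial>?Q) = (\<integral>x. ?g x \<partial>distr ?Q seq_space (\<lambda>x n. - x n))"
      by (simp only: ray_measure_uminus[OF B])
    also have "\<dots> = (\<integral>x. ?g (\<lambda>n. - x n) \<partial>?Q)"
      by (rule integral_distr) measurable
    also have "\<dots> = (\<integral>x. - ?g x \<partial>?Q)"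
      by (simp add: pairing_uminus truncate_seq_uminus)
    also have "\<dots> = - (\<integral>x. ?g x \<partial>?Q)"
      by (rule Bochner_Integration.integral_minus)
    finally show ?thesis by linarith
  qed
  \<comment> \<open>Splitting the Bochner integral is legitimate because both parts have been shown
    integrable.\<close>
  moreover have "(\<integral>x. complex_of_real (- ?c x) + \<i> * complex_of_real (?g x) \<partial>?Q) =
      complex_of_real (- (\<integral>x. ?c x \<partial>?Q)) + \<i> * complex_of_real (\<integral>x. ?g x \<partial>?Q)"
  proof -
    have "(\<integral>x. complex_of_real (- ?c x) + \<i> * complex_of_real (?g x) \<partial>?Q) =
        (\<integral>x. complex_of_real (- ?c x) \<partial>?Q) + (\<integral>x. \<i> * complex_of_real (?g x) \<partial>?Q)"
      by (intro Bochner_Integration.integral_add integrable_of_real integrable_mult_right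
          Bochner_Integration.integrable_minus int_c int_g)
    then show ?thesis
      by (simp only: integral_complex_of_real integral_mult_right_zero Bochner_Integration.integral_minus)
  qed
  ultimately show ?thesis
    unfolding split by simp
qed

text \<open>The drift witness is 0: the stable exponent and the compensated integral are both real
  and already agree.\<close>

lemma levy_measure_ray_measure:
  assumes B: "B \<in> sets m" and supp: "AE s in m. s \<in> B \<longrightarrow> (\<exists>n. F n s \<noteq> 0)"
    and inv: "invariant_measure shift (ray_measure_on B)"
    and char: "\<And>a. finite {n. a n \<noteq> 0} \<Longrightarrow> (\<integral>x. iexp (pairing a x) \<partial>\<mu>) = complex_of_real (exp
      (- enn2real (\<integral>\<^sup>+s. ennreal (\<bar>pairing a (\<lambda>n. indicator B s * F n s)\<bar> powr \<alpha>) \<partial>m)))"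
  shows "levy_measure \<mu> (ray_measure_on B)"
  unfolding levy_measure_def
proof (intro conjI exI[of _ "0::real"] allI impI)
  fix a :: "int \<Rightarrow> real" assume a: "finite {n. a n \<noteq> 0}"
  have "pairing a (\<lambda>_. 0) = 0"
    by (simp add: pairing_def)
  then show "(\<integral>x. iexp (pairing a x) \<partial>\<mu>) = exp (\<i> * complex_of_real (pairing a (\<lambda>_. 0)) +
      (\<integral>x. iexp (pairing a x) - 1 - \<i> * complex_of_real (pairing a (truncate_seq x)) \<partial>ray_measure_on B))"
    unfolding char[OF a] levy_exponent_ray_measure[OF B a] by (simp add: exp_of_real flip: of_real_minus)
qed (use ray_measure_zero[OF B supp] sigma_finite_ray_measure[OF B supp] ray_measure_min_finite[OF B] inv
  in \<open>auto simp: null_sets_def\<close>)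

end

section \<open>The Maharam extension of a flow\<close>

text \<open>Integrability of all kernel functions is a locale assumption; the theorem obtains it
  from the stochastic integrals that define the full process.\<close>

locale sas_flow = nonsingular_system m \<phi> for m :: "'s measure" and \<phi> :: "'s \<Rightarrow> 's" +
  fixes \<alpha> :: real and a :: "int \<Rightarrow> 's \<Rightarrow> real" and f :: "'s \<Rightarrow> real"
  assumes alpha: "0 < \<alpha>" "\<alpha> < 2" and sign: "sign_cocycle m \<phi> a" and f: "L_alpha \<alpha> m f"
    and L_alpha_kernel: "\<And>n. L_alpha \<alpha> m (flow_kernel \<alpha> m \<phi> a f n)"
begin

sublocale stable_kernel m \<alpha> "flow_kernel \<alpha> m \<phi> a f"
  by unfold_locales (use alpha L_alpha_kernel in auto)

abbreviation F :: "int \<Rightarrow> 's \<Rightarrow> real" where "F \<equiv> flow_kernel \<alpha> m \<phi> a f"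

definition w :: "'s \<Rightarrow> real" where "w s = enn2real (W 1 s)"
text \<open>The factor by which the kernel at n + 1 over s differs from the kernel at n over \<phi>
  s.\<close>

definition c :: "'s \<Rightarrow> real" where "c s = a 1 s * w s powr (1 / \<alpha>)"
definition \<Phi> :: "'s \<times> real \<Rightarrow> 's \<times> real" where "\<Phi> z = (\<phi> (fst z), c (fst z) * snd z)"

lemma a_measurable [measurable]: "a n \<in> borel_measurable m"
  and a_cases: "s \<in> space m \<Longrightarrow> a n s = - 1 \<or> a n s = 1"
  and a_add: "s \<in> space m \<Longrightarrow> a (n + k) s = a n s * a k (it n s)"
  using sign by (auto simp: sign_cocycle_def)

lemma f_measurable [measurable]: "f \<in> borel_measurable m"
  using f by (simp add: L_alpha_def)

lemma w_measurable [measurable]: "w \<in> borel_measurable m"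
  unfolding w_def by measurable

lemma w_nonneg [simp]: "0 \<le> w s"
  by (simp add: w_def)

lemma w_pos: "AE s in m. 0 < w s \<and> ennreal (w s) = W 1 s"
  using W_finite[of 1] W_nonzero[of 1]
  by eventually_elim (auto simp: w_def enn2real_positive_iff less_top zero_less_iff_neq_zero)

lemma c_measurable [measurable]: "c \<in> borel_measurable m"
  unfolding c_def by measurable

lemma c_powr: "AE s in m. c s \<noteq> 0 \<and> ennreal (\<bar>c s\<bar> powr \<alpha>) = W 1 s"
  using w_pos AE_space
proof eventually_elim
  case (elim s)
  have "\<bar>c s\<bar> = w s powr (1 / \<alpha>)"
    using a_cases[OF elim(2), of 1] by (auto simp: c_def)
  moreover from this have "\<bar>c s\<bar> powr \<alpha> = w s"
    using alpha elim by (simp add: powr_powr)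
  ultimately show ?case using elim by auto
qed

lemma \<Phi>_measurable [measurable]: "\<Phi> \<in> polar_measure \<rightarrow>\<^sub>M polar_measure"
  unfolding \<Phi>_def by measurable

lemma F_eq: "F n s = a n s * enn2real (W n s) powr (1 / \<alpha>) * f (it n s)"
  by (simp add: flow_kernel_def W_def)

text \<open>The cocycle identities of the signs and of the Radon-Nikodym derivatives combine. Since
  there are countably many \<open>n\<close>, one null set serves them all, and a whole shifted ray
  is again a ray.\<close>

lemma F_shift: "AE s in m. \<forall>n. F (n + 1) s = c s * F n (\<phi> s)"
  unfolding AE_all_countable
proof
  fix n
  show "AE s in m. F (n + 1) s = c s * F n (\<phi> s)"
    using W_cocycle[of n] AE_space
  proof eventually_elim
    case (elim s)
    then show ?case
      using a_add[OF elim(2), of 1 n] it_add1[OF elim(2), of n]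
      by (simp add: F_eq c_def w_def enn2real_mult powr_mult add.commute)
  qed
qed

text \<open>\<open>\<Phi>\<close> is the Maharam extension of the flow, twisted by the sign cocycle: the radial scaling by
  \<open>c\<close> compensates the Radon-Nikodym derivative of \<open>\<phi>\<close>.\<close>

lemma nn_integral_\<Phi>:
  assumes [measurable]: "H \<in> borel_measurable polar_measure"
  shows "(\<integral>\<^sup>+z. H (\<Phi> z) \<partial>polar_measure) = (\<integral>\<^sup>+z. H z \<partial>polar_measure)"
proof -
  let ?J = "\<lambda>s. \<integral>\<^sup>+r. H (s, r) \<partial>radial_measure \<alpha>"
  have J[measurable]: "?J \<in> borel_measurable m" by measurable
  have "(\<integral>\<^sup>+z. H (\<Phi> z) \<partial>polar_measure) = (\<integral>\<^sup>+s. \<integral>\<^sup>+r. H (\<phi> s, c s * r) \<partial>radial_measure \<alpha> \<partial>m)"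
    by (subst radial.nn_integral_fst[symmetric]) (simp_all add: \<Phi>_def)
  also have "\<dots> = (\<integral>\<^sup>+s. W 1 s * ?J (\<phi> s) \<partial>m)"
  proof (rule nn_integral_cong_AE)
    show "AE s in m. (\<integral>\<^sup>+r. H (\<phi> s, c s * r) \<partial>radial_measure \<alpha>) = W 1 s * ?J (\<phi> s)"
      using c_powr AE_space
    proof eventually_elim
      case (elim s)
      have [measurable]: "(\<lambda>r. H (\<phi> s, r)) \<in> borel_measurable borel"
        using elim(2) by measurable
      show ?case
        using radial_measure_scale[OF alpha, of "\<lambda>r. H (\<phi> s, r)" "c s"] elim by simp
    qed
  qed
  also have "\<dots> = (\<integral>\<^sup>+s. ?J s \<partial>m)"
    by (rule nn_integral_W_\<phi>[OF J])
  also have "\<dots> = (\<integral>\<^sup>+z. H z \<partial>polar_measure)"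
    by (rule radial.nn_integral_fst) measurable
  finally show ?thesis .
qed

lemma shift_ray: "AE z in polar_measure. shift (ray z) = ray (\<Phi> z)"
  using AE_polar_fst[OF F_shift]
  by eventually_elim (auto simp: shift_def ray_def \<Phi>_def fun_eq_iff)

text \<open>\<open>\<Phi>\<close> preserves the polar measure although \<open>m\<close> is only
  quasi-invariant under the flow, so a weight that is constant along \<open>\<Phi>\<close> is
  carried to a shift-invariant measure.\<close>

lemma ray_measure_invariant:
  assumes [measurable]: "k \<in> borel_measurable polar_measure"
    and k: "AE z in polar_measure. k (\<Phi> z) = k z"
  shows "invariant_measure shift (ray_measure k)"
proof -
  have "distr (ray_measure k) (ray_measure k) shift = ray_measure k"
  proof (rule measure_eqI)
    fix A assume "A \<in> sets (distr (ray_measure k) (ray_measure k) shift)"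
    then have [measurable]: "A \<in> sets seq_space" by simp
    have "emeasure (distr (ray_measure k) (ray_measure k) shift) A =
        (\<integral>\<^sup>+x. indicator A x \<partial>distr (ray_measure k) (ray_measure k) shift)"
      by simp
    also have "\<dots> = (\<integral>\<^sup>+x. indicator A (shift x) \<partial>ray_measure k)"
      by (rule nn_integral_distr) measurable
    also have "\<dots> = (\<integral>\<^sup>+z. k z * indicator A (shift (ray z)) \<partial>polar_measure)"
      by (rule nn_integral_ray_measure) measurable
    also have "\<dots> = (\<integral>\<^sup>+z. k (\<Phi> z) * indicator A (ray (\<Phi> z)) \<partial>polar_measure)"
      by (rule nn_integral_cong_AE) (use k shift_ray in \<open>eventually_elim, simp\<close>)
    also have "\<dots> = (\<integral>\<^sup>+z. k z * indicator A (ray z) \<partial>polar_measure)"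
      by (rule nn_integral_\<Phi>) measurable
    also have "\<dots> = (\<integral>\<^sup>+x. indicator A x \<partial>ray_measure k)"
      by (rule nn_integral_ray_measure[symmetric]) measurable
    finally show "emeasure (distr (ray_measure k) (ray_measure k) shift) A = emeasure (ray_measure k) A"
      by simp
  qed simp
  moreover have "shift \<in> ray_measure k \<rightarrow>\<^sub>M ray_measure k" by measurable
  ultimately show ?thesis by (simp add: invariant_measure_def)
qed

lemma indicator_\<Phi>:
  assumes "AE s in m. \<phi> s \<in> B \<longleftrightarrow> s \<in> B"
  shows "AE z in polar_measure. (indicator B (fst (\<Phi> z)) :: ennreal) = indicator B (fst z)"
  using AE_polar_fst[OF assms] by eventually_elim (auto simp: \<Phi>_def indicator_def)

lemma ray_measure_on_invariant:
  assumes [measurable]: "B \<in> sets m" and B: "AE s in m. \<phi> s \<in> B \<longleftrightarrow> s \<in> B"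
  shows "invariant_measure shift (ray_measure_on B)"
  by (rule ray_measure_invariant) (use indicator_\<Phi>[OF B] in auto)

section \<open>Summability of the kernel on the dissipative part\<close>

text \<open>The change of variables moves the integral of
  \<open>\<bar>F n\<bar> powr \<alpha>\<close> over \<open>A\<close> to the integral of
  \<open>\<bar>f\<bar> powr \<alpha>\<close> over the n-th forward image of \<open>A\<close>. These
  images are disjoint, so the sum stays below the integral over the whole space.
  \<open>int_decode\<close> only arranges the integers as a series.\<close>

lemma nn_integral_wandering:
  assumes A: "wandering m \<phi> A"
  shows "(\<integral>\<^sup>+s. indicator A s * (\<Sum>k. ennreal (\<bar>F (int_decode k) s\<bar> powr \<alpha>)) \<partial>m) \<le>
    (\<integral>\<^sup>+s. ennreal (\<bar>f s\<bar> powr \<alpha>) \<partial>m)"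
proof -
  let ?g = "\<lambda>s. ennreal (\<bar>f s\<bar> powr \<alpha>)" and ?n = "\<lambda>k. int_decode k"
  let ?A = "\<lambda>k. it (- ?n k) -` A \<inter> space m"
  have [measurable]: "A \<in> sets m" and d: "disjoint_family (\<lambda>n. it n -` A \<inter> space m)"
    using A by (auto simp: wandering_def)
  have d': "disjoint_family ?A"
    unfolding disjoint_family_on_def
  proof (intro ballI impI)
    fix k l :: nat assume "k \<noteq> l"
    then have "- ?n k \<noteq> - ?n l"
      using inj_eq[OF inj_int_decode] by simp
    with d show "?A k \<inter> ?A l = {}"
      unfolding disjoint_family_on_def by blast
  qed
  have F_powr: "AE s in m. ennreal (\<bar>F n s\<bar> powr \<alpha>) = W n s * ?g (it n s)" for n
    using W_finite[of n] AE_space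
  proof eventually_elim
    case (elim s)
    have "\<bar>F n s\<bar> powr \<alpha> = enn2real (W n s) * \<bar>f (it n s)\<bar> powr \<alpha>"
      using a_cases[OF elim(2), of n] alpha by (auto simp: F_eq abs_mult powr_mult powr_powr)
    then show ?case
      using elim by (simp add: ennreal_mult less_top)
  qed
  have "(\<integral>\<^sup>+s. indicator A s * (\<Sum>k. ennreal (\<bar>F (?n k) s\<bar> powr \<alpha>)) \<partial>m) =
      (\<integral>\<^sup>+s. (\<Sum>k. indicator A s * ennreal (\<bar>F (?n k) s\<bar> powr \<alpha>)) \<partial>m)"
    by (simp add: ennreal_suminf_cmult)
  also have "\<dots> = (\<Sum>k. \<integral>\<^sup>+s. indicator A s * ennreal (\<bar>F (?n k) s\<bar> powr \<alpha>) \<partial>m)"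
    by (rule nn_integral_suminf) measurable
  also have "\<dots> = (\<Sum>k. \<integral>\<^sup>+s. ?g s * indicator (?A k) s \<partial>m)"
  proof (rule suminf_cong)
    fix k
    have "(\<integral>\<^sup>+s. indicator A s * ennreal (\<bar>F (?n k) s\<bar> powr \<alpha>) \<partial>m) =
        (\<integral>\<^sup>+s. W (?n k) s * (?g (it (?n k) s) * indicator A (it (- ?n k) (it (?n k) s))) \<partial>m)"
      by (rule nn_integral_cong_AE)
        (use F_powr[of "?n k"] AE_space in \<open>eventually_elim, simp add: mult_ac\<close>)
    also have "\<dots> = (\<integral>\<^sup>+s. ?g s * indicator A (it (- ?n k) s) \<partial>m)"
      by (rule nn_integral_W_it) measurable
    also have "\<dots> = (\<integral>\<^sup>+s. ?g s * indicator (?A k) s \<partial>m)"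
      by (rule nn_integral_cong) (simp add: indicator_def)
    finally show "(\<integral>\<^sup>+s. indicator A s * ennreal (\<bar>F (?n k) s\<bar> powr \<alpha>) \<partial>m) =
      (\<integral>\<^sup>+s. ?g s * indicator (?A k) s \<partial>m)" .
  qed
  also have "\<dots> = (\<integral>\<^sup>+s. (\<Sum>k. ?g s * indicator (?A k) s) \<partial>m)"
    by (rule nn_integral_suminf[symmetric]) measurable
  also have "\<dots> = (\<integral>\<^sup>+s. ?g s * indicator (\<Union>k. ?A k) s \<partial>m)"
    by (simp add: ennreal_suminf_cmult suminf_indicator[OF d'])
  also have "\<dots> \<le> (\<integral>\<^sup>+s. ?g s \<partial>m)"
    by (rule nn_integral_mono) (simp add: indicator_def)
  finally show ?thesis .
qed

text \<open>The set on which the series converges contains every wandering set up to a null set,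
  hence also \<open>D\<close>, the least such bound. This avoids exhausting \<open>D\<close> by
  countably many wandering sets.\<close>

lemma dissipative_summable:
  assumes D: "dissipative_part m \<phi> D"
  shows "AE s in m. s \<in> D \<longrightarrow> (\<Sum>k. ennreal (\<bar>F (int_decode k) s\<bar> powr \<alpha>)) \<noteq> \<infinity>"
proof -
  let ?S = "\<lambda>s. \<Sum>k. ennreal (\<bar>F (int_decode k) s\<bar> powr \<alpha>)"
  let ?V = "{s\<in>space m. ?S s \<noteq> \<infinity>}"
  have "A - ?V \<in> null_sets m" if A: "wandering m \<phi> A" for A
  proof -
    have [measurable]: "A \<in> sets m" using A by (simp add: wandering_def)
    have "(\<integral>\<^sup>+s. indicator A s * ?S s \<partial>m) \<noteq> \<infinity>"
      using le_less_trans[OF nn_integral_wandering[OF A]] f by (auto simp: L_alpha_def)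
    then have "AE s in m. indicator A s * ?S s \<noteq> \<infinity>"
      by (intro nn_integral_noteq_infinite) auto
    then have "AE s in m. s \<notin> A - ?V"
      using AE_space by eventually_elim (auto simp: indicator_def)
    then show ?thesis
      by (subst AE_iff_null_sets) auto
  qed
  then have "D - ?V \<in> null_sets m"
    using D by (auto simp: dissipative_part_def measurable_union_def)
  then have "AE s in m. s \<notin> D - ?V"
    by (rule AE_not_in)
  then show ?thesis by eventually_elim auto
qed

lemma dissipative_finite:
  assumes D: "dissipative_part m \<phi> D"
  shows "AE s in m. s \<in> D \<longrightarrow> (\<forall>t>0. finite {n. t \<le> \<bar>F n s\<bar>})"
  using dissipative_summable[OF D]
proof eventually_elim
  case (elim s)
  show ?case
  proof (intro impI allI)
    fix t :: real assume sD: "s \<in> D" and t: "0 < t"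
    have "(\<Sum>k. ennreal (\<bar>F (int_decode k) s\<bar> powr \<alpha>)) \<noteq> \<infinity>"
      by (rule mp[OF elim sD])
    then have "summable (\<lambda>k. \<bar>F (int_decode k) s\<bar> powr \<alpha>)"
      unfolding infinity_ennreal_def by (rule summable_suminf_not_top[rotated]) (rule powr_ge_zero)
    then have "(\<lambda>k. \<bar>F (int_decode k) s\<bar> powr \<alpha>) \<longlonglongrightarrow> 0"
      by (rule summable_LIMSEQ_zero)
    then have "\<forall>\<^sub>F k in sequentially. \<bar>F (int_decode k) s\<bar> powr \<alpha> < t powr \<alpha>"
      using t by (intro order_tendstoD) auto
    then obtain K where K: "\<And>k. K \<le> k \<Longrightarrow> \<bar>F (int_decode k) s\<bar> powr \<alpha> < t powr \<alpha>"
      by (auto simp: eventually_sequentially)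
    have "{n. t \<le> \<bar>F n s\<bar>} \<subseteq> int_decode ` {..<K}"
    proof
      fix n assume "n \<in> {n. t \<le> \<bar>F n s\<bar>}"
      then have "t powr \<alpha> \<le> \<bar>F (int_decode (int_encode n)) s\<bar> powr \<alpha>"
        using t alpha by (simp add: powr_mono2)
      then have "int_encode n < K"
        using K[of "int_encode n"] by (meson not_le)
      then show "n \<in> int_decode ` {..<K}"
        by (intro image_eqI[of _ _ "int_encode n"]) auto
    qed
    then show "finite {n. t \<le> \<bar>F n s\<bar>}"
      by (rule finite_subset) simp
  qed
qed

end

section \<open>Types of the Levy measures\<close>

lemma bij_shift: "bij shift"
  by (rule bij_betw_byWitness[of _ "\<lambda>x n. x (n - 1)"]) (auto simp: shift_def)

lemma the_inv_into_shift: "the_inv_into UNIV shift x = (\<lambda>n. x (n - 1))"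
  using bij_shift by (intro the_inv_into_f_eq) (auto simp: shift_def bij_def)

lemma funpow_shift: "(shift ^^ j) x = (\<lambda>n. x (n + int j))"
  by (induction j) (auto simp: shift_def add_ac)

lemma funpow_inverse_shift: "(the_inv_into UNIV shift ^^ j) x = (\<lambda>n. x (n - int j))"
  by (induction j) (auto simp: the_inv_into_shift algebra_simps)

lemma int_iterate_shift: "space Q = UNIV \<Longrightarrow> int_iterate Q shift n x = (\<lambda>k. x (k + n))"
  by (auto simp: int_iterate_def funpow_shift funpow_inverse_shift)

text \<open>Strict inequality on the left and weak inequality on the right select the first maximum
  of the modulus, so that a sequence has at most one peak.\<close>

definition peak :: "int \<Rightarrow> (int \<Rightarrow> real) set" where
  "peak n = {x. (\<forall>k<n. \<bar>x k\<bar> < \<bar>x n\<bar>) \<and> (\<forall>k>n. \<bar>x k\<bar> \<le> \<bar>x n\<bar>)}"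

lemma sets_peak [measurable]: "peak n \<in> sets seq_space"
proof -
  have "peak n = {x\<in>space seq_space. \<forall>k. (k < n \<longrightarrow> \<bar>x k\<bar> < \<bar>x n\<bar>) \<and> (k > n \<longrightarrow> \<bar>x k\<bar> \<le> \<bar>x n\<bar>)}"
    by (auto simp: peak_def)
  also have "\<dots> \<in> sets seq_space"
  proof -
    have [measurable]: "Measurable.pred seq_space (\<lambda>x::int \<Rightarrow> real. \<bar>x k\<bar> \<le> \<bar>x n\<bar>)" for k
      unfolding pred_def by (rule borel_measurable_le) measurable
    show ?thesis by measurable
  qed
  finally show ?thesis .
qed

lemma disjoint_peak: "disjoint_family peak"
proof -
  have "False" if "x \<in> peak i" "x \<in> peak j" "i < j" for x i j
  proof -
    have "\<bar>x i\<bar> < \<bar>x j\<bar>" "\<bar>x j\<bar> \<le> \<bar>x i\<bar>"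
      using that by (auto simp: peak_def)
    then show False by simp
  qed
  then show ?thesis
    unfolding disjoint_family_on_def by (metis disjoint_iff linorder_neqE)
qed

lemma vimage_peak: "space Q = UNIV \<Longrightarrow> int_iterate Q shift n -` peak k \<inter> space Q = peak (k + n)"
proof -
  assume Q: "space Q = UNIV"
  have "(\<lambda>i. x (i + n)) \<in> peak k \<longleftrightarrow> x \<in> peak (k + n)" for x
    unfolding peak_def mem_Collect_eq
  proof (intro conj_cong)
    show "(\<forall>i<k. \<bar>x (i + n)\<bar> < \<bar>x (k + n)\<bar>) \<longleftrightarrow> (\<forall>i<k + n. \<bar>x i\<bar> < \<bar>x (k + n)\<bar>)"
      by (metis add_less_cancel_right diff_add_cancel)
    show "(\<forall>i>k. \<bar>x (i + n)\<bar> \<le> \<bar>x (k + n)\<bar>) \<longleftrightarrow> (\<forall>i>k + n. \<bar>x i\<bar> \<le> \<bar>x (k + n)\<bar>)"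
      by (metis add_less_cancel_right diff_add_cancel)
  qed
  then show ?thesis
    using Q by (auto simp: int_iterate_shift)
qed

text \<open>Only finitely many coordinates reach the modulus of \<open>x i\<close>, so the maximum
  over them is a global maximum, and among its finitely many positions there is a first one.\<close>

lemma peak_exists:
  assumes "x i \<noteq> 0" and fin: "finite {n. \<bar>x i\<bar> \<le> \<bar>x n\<bar>}"
  shows "\<exists>n. x \<in> peak n"
proof -
  let ?S = "{n. \<bar>x i\<bar> \<le> \<bar>x n\<bar>}"
  define b where "b = Max ((\<lambda>n. \<bar>x n\<bar>) ` ?S)"
  have S: "i \<in> ?S" by simp
  have b: "\<bar>x n\<bar> \<le> b" for n
  proof (cases "n \<in> ?S")
    case True
    then show ?thesis unfolding b_def using fin by (intro Max_ge) auto
  next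
    case False
    have "\<bar>x i\<bar> \<le> b" unfolding b_def using fin S by (intro Max_ge) auto
    with False show ?thesis by simp
  qed
  have "b \<in> (\<lambda>n. \<bar>x n\<bar>) ` ?S"
    unfolding b_def using fin S by (intro Max_in) auto
  then obtain j where j: "j \<in> ?S" "\<bar>x j\<bar> = b" by auto
  let ?T = "{n\<in>?S. \<bar>x n\<bar> = b}"
  have T: "finite ?T" "?T \<noteq> {}" using fin j by auto
  define l where "l = Min ?T"
  have "l \<in> ?T" unfolding l_def using T by (rule Min_in)
  then have l: "\<bar>x l\<bar> = b" by simp
  have "\<bar>x k\<bar> < b" if k: "k < l" for k
  proof (rule ccontr)
    assume "\<not> \<bar>x k\<bar> < b"
    then have "\<bar>x k\<bar> = b" using b[of k] by simp
    then have "k \<in> ?T" using j b[of i] by auto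
    then show False using Min_le[OF T(1), of k] k by (simp add: l_def)
  qed
  then have "x \<in> peak l"
    using b by (simp add: peak_def l)
  then show ?thesis ..
qed

text \<open>The shift only translates the peak position, so each peak set is wandering; if these
  sets cover almost everything, every upper bound of the wandering sets has full measure.\<close>

lemma levy_dissipativeI:
  assumes sets: "sets Q = sets seq_space" and AE: "AE x in Q. \<exists>n. x \<in> peak n"
  shows "levy_dissipative Q"
proof -
  have sp: "space Q = UNIV"
    using sets_eq_imp_space_eq[OF sets] by simp
  have w: "wandering Q shift (peak n)" for n
  proof -
    have "disjoint_family (\<lambda>k. peak (n + k))"
      using disjoint_peak by (auto simp: disjoint_family_on_def)
    then show ?thesis
      unfolding wandering_def vimage_peak[OF sp] by (simp add: sets)
  qed
  have "space Q - V \<in> null_sets Q"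
    if V: "V \<in> sets Q" and up: "\<And>A. wandering Q shift A \<Longrightarrow> A - V \<in> null_sets Q" for V
  proof -
    have "AE x in Q. \<forall>n. x \<notin> peak n - V"
      unfolding AE_all_countable using up[OF w] by (intro allI AE_not_in)
    with AE have "AE x in Q. x \<notin> space Q - V"
      by eventually_elim auto
    then show ?thesis
      using V by (subst AE_iff_null_sets) auto
  qed
  moreover have "A - space Q \<in> null_sets Q" if "wandering Q shift A" for A
  proof -
    have "A - space Q = {}"
      using that by (auto simp: wandering_def dest: sets.sets_into_space)
    then show ?thesis by (simp only: null_sets.empty_sets)
  qed
  ultimately show ?thesis
    unfolding levy_dissipative_def dissipative_part_def measurable_union_def by simp
qed

section \<open>Invariant densities for the shift\<close>

text \<open>Makes the results on Radon-Nikodym derivatives of a flow available a second time, now on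
  sequence space.\<close>

lemma nonsingular_system_shift:
  assumes sets: "sets Q = sets seq_space" and sf: "sigma_finite_measure Q"
    and inv: "invariant_measure shift Q"
  shows "nonsingular_system Q shift"
proof -
  have sp: "space Q = UNIV"
    using sets_eq_imp_space_eq[OF sets] by simp
  have [measurable_cong]: "sets Q = sets seq_space" by fact
  have m: "shift \<in> Q \<rightarrow>\<^sub>M Q" by measurable
  have "(\<lambda>x n. x (n - 1)) \<in> Q \<rightarrow>\<^sub>M Q"
    by (subst measurable_cong_sets[OF refl sets], rule seq_space_measurableI) measurable
  then have m': "the_inv_into (space Q) shift \<in> Q \<rightarrow>\<^sub>M Q"
    by (simp add: sp the_inv_into_shift[abs_def])
  have "emeasure Q (shift -` A \<inter> space Q) = emeasure Q A" if "A \<in> sets Q" for A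
    using emeasure_distr[OF m that] inv by (simp add: invariant_measure_def)
  then have "nonsingular_flow Q shift"
    using bij_shift m m' by (simp add: nonsingular_flow_def sp)
  with sf show ?thesis
    by (simp add: nonsingular_system_def nonsingular_system_axioms_def)
qed

text \<open>When the reference measure is itself invariant the Jacobian is 1, and the transformation
  rule becomes plain invariance of the density.\<close>

lemma (in nonsingular_system) invariant_RN_deriv':
  assumes inv_m: "invariant_measure \<phi> m"
    and \<mu>: "sigma_finite_measure \<mu>" "sets \<mu> = sets m" and ac: "absolutely_continuous m \<mu>"
    and inv: "invariant_measure \<phi> \<mu>"
  shows "AE s in m. RN_deriv m \<mu> (\<phi> s) = RN_deriv m \<mu> s"
proof -
  have "it (- 1) = \<psi>" by (simp add: fun_eq_iff)
  then have "density m (W 1) = density m (\<lambda>_. 1)"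
    using invariant_\<psi>[OF refl inv_m] by (simp add: density_W density_1)
  then have "AE s in m. W 1 s = 1"
    by (intro density_unique) auto
  with invariant_RN_deriv[OF \<mu> ac inv] show ?thesis
    by eventually_elim simp
qed

section \<open>The three types\<close>

context sas_flow
begin

lemma levy_dissipative_ray_measure:
  assumes D: "dissipative_part m \<phi> D" and supp: "AE s in m. s \<in> D \<longrightarrow> (\<exists>n. F n s \<noteq> 0)"
  shows "levy_dissipative (ray_measure_on D)"
proof (rule levy_dissipativeI)
  have [measurable]: "D \<in> sets m"
    using D by (simp add: dissipative_part_def measurable_union_def)
  have ae: "AE z in polar_measure. 0 < (indicator D (fst z) :: ennreal) \<longrightarrow> (\<exists>n. ray z \<in> peak n)"
    using AE_polar_fst[OF supp] AE_polar_fst[OF dissipative_finite[OF D]] AE_polar_snd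
  proof eventually_elim
    case (elim z)
    show ?case
    proof
      assume "0 < (indicator D (fst z) :: ennreal)"
      then have zD: "fst z \<in> D" by (cases "fst z \<in> D") auto
      with elim obtain i where i: "F i (fst z) \<noteq> 0" by auto
      \<comment> \<open>A nonzero radius scales all coordinates alike, so finiteness of the level
        sets passes from the kernel at a point to the rays above it.\<close>
      have "{n. \<bar>ray z i\<bar> \<le> \<bar>ray z n\<bar>} = {n. \<bar>F i (fst z)\<bar> \<le> \<bar>F n (fst z)\<bar>}"
        using elim by (simp add: ray_def abs_mult mult_le_cancel_left_pos)
      then have "finite {n. \<bar>ray z i\<bar> \<le> \<bar>ray z n\<bar>}"
        using elim zD i by simp
      moreover have "ray z i \<noteq> 0"
        using i elim by (simp add: ray_def)
      ultimately show "\<exists>n. ray z \<in> peak n"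
        by (intro peak_exists)
    qed
  qed
  show "AE x in ray_measure_on D. \<exists>n. x \<in> peak n"
    by (subst AE_ray_measure) (use ae in measurable)
qed simp

lemma type_II_1_ray_measure:
  assumes P: "positive_set m \<phi> P"
  shows "type_II_1 (ray_measure_on P)"
proof -
  have Ps[measurable]: "P \<in> sets m" using P by (simp add: positive_set_def)
  obtain p where p[measurable]: "p \<in> borel_measurable m" and p0: "\<And>s. 0 \<le> p s"
    and pfin: "(\<integral>\<^sup>+s. ennreal (p s) \<partial>m) < \<infinity>" and pP: "AE s in m. p s \<noteq> 0 \<longleftrightarrow> s \<in> P"
    and pinv: "AE s in m. p s = enn2real (W 1 s) * p (\<phi> s)"
    using positive_set_density[OF P] by blast
  define k where "k z = ennreal (min ((p (fst z) powr (1 / \<alpha>) * snd z)\<^sup>2) 1)" for z :: "'s \<times> real"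
  have k[measurable]: "k \<in> borel_measurable polar_measure"
    unfolding k_def by measurable
  define t where "t = (\<integral>\<^sup>+z. k z \<partial>polar_measure)"
  have k\<Phi>: "AE z in polar_measure. k (\<Phi> z) = k z"
    using AE_polar_fst[OF pinv] AE_polar_fst[OF AE_space]
  proof eventually_elim
    case (elim z)
    have "p (fst z) powr (1 / \<alpha>) = w (fst z) powr (1 / \<alpha>) * p (\<phi> (fst z)) powr (1 / \<alpha>)"
      using elim(1) p0 by (simp add: w_def powr_mult)
    then show ?case
      using a_cases[OF elim(2), of 1] by (auto simp: k_def \<Phi>_def c_def power_mult_distrib mult_ac)
  qed
  \<comment> \<open>Off radius 0 the weight vanishes exactly where \<open>p\<close> does, that is
    off \<open>P\<close>; this yields equivalence and not just absolute continuity.\<close>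
  have k0: "AE z in polar_measure. indicator P (fst z) = (0::ennreal) \<longleftrightarrow> k z = 0"
    using AE_polar_fst[OF pP] AE_polar_snd
    by eventually_elim (auto simp: k_def indicator_def ennreal_eq_0_iff min_def split: if_splits)
  have "t = (\<integral>\<^sup>+s. ennreal (p s) * (\<integral>\<^sup>+r. ennreal (min (r\<^sup>2) 1) \<partial>radial_measure \<alpha>) \<partial>m)"
  proof -
    have "t = (\<integral>\<^sup>+s. \<integral>\<^sup>+r. k (s, r) \<partial>radial_measure \<alpha> \<partial>m)"
      unfolding t_def by (subst radial.nn_integral_fst[symmetric]) auto
    moreover have "(\<integral>\<^sup>+r. k (s, r) \<partial>radial_measure \<alpha>) =
        ennreal (p s) * (\<integral>\<^sup>+r. ennreal (min (r\<^sup>2) 1) \<partial>radial_measure \<alpha>)" for s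
      using radial_measure_scale'[OF alpha, of "\<lambda>r. ennreal (min (r\<^sup>2) 1)" "p s powr (1 / \<alpha>)"] p0[of s] alpha
      by (simp add: k_def powr_powr)
    ultimately show ?thesis by simp
  qed
  also have "\<dots> = (\<integral>\<^sup>+s. ennreal (p s) \<partial>m) * (\<integral>\<^sup>+r. ennreal (min (r\<^sup>2) 1) \<partial>radial_measure \<alpha>)"
    by (rule nn_integral_multc) measurable
  also have "\<dots> < \<infinity>"
    using pfin radial_measure_min_finite[OF alpha] by (simp add: ennreal_mult_less_top)
  finally have t: "t < \<infinity>" .
  show ?thesis
  \<comment> \<open>If the total mass is 0 then the Levy measure is 0 and the convention for the
    zero measure applies; otherwise the weight is normalised by \<open>t\<close>.\<close>
  proof (cases "t = 0")
    case True
    then have "AE z in polar_measure. k z = 0"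
      unfolding t_def by (subst (asm) nn_integral_0_iff_AE) auto
    with k0 have "AE z in polar_measure. indicator P (fst z) = (0::ennreal)"
      by eventually_elim simp
    then have "(\<integral>\<^sup>+x. 1 \<partial>ray_measure_on P) = 0"
      by (subst nn_integral_ray_measure) (auto simp: nn_integral_0_iff_AE)
    then show ?thesis
      by (simp add: type_II_1_def)
  next
    case False
    define k' where "k' z = k z / t" for z
    have k'[measurable]: "k' \<in> borel_measurable polar_measure"
      unfolding k'_def by measurable
    have "emeasure (ray_measure k') (space (ray_measure k')) = (\<integral>\<^sup>+x. 1 \<partial>ray_measure k')"
      by simp
    also have "\<dots> = (\<integral>\<^sup>+z. k' z \<partial>polar_measure)"
      by (subst nn_integral_ray_measure) auto
    also have "\<dots> = t / t"
      unfolding k'_def t_def by (rule nn_integral_divide) measurable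
    also have "\<dots> = 1"
      using False t by (intro ennreal_divide_self) auto
    finally have "prob_space (ray_measure k')"
      by (rule prob_spaceI)
    moreover have "invariant_measure shift (ray_measure k')"
      by (rule ray_measure_invariant) (use k\<Phi> in \<open>auto simp: k'_def\<close>)
    moreover have "AE z in polar_measure. indicator P (fst z) = (0::ennreal) \<longleftrightarrow> k' z = 0"
      using k0 by eventually_elim (use False t in \<open>auto simp: k'_def ennreal_divide_eq_0_iff\<close>)
    then have "null_sets (ray_measure_on P) = null_sets (ray_measure k')"
      by (intro null_sets_ray_measure_cong) auto
    then have "equivalent_measures (ray_measure_on P) (ray_measure k')"
      by (simp add: equivalent_measures_def absolutely_continuous_def)
    ultimately show ?thesis
      by (auto simp: type_II_1_def)
  qed
qed

text \<open>An invariant probability with density \<open>q\<close> with respect to the Levy measure lifts to the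
  \<open>\<Phi>\<close>-invariant density \<open>q \<circ> ray\<close>, whose projection to the base is a \<open>\<phi>\<close>-invariant
  probability carried by the null part.\<close>

lemma type_II_infinity_ray_measure:
  assumes P: "positive_part m \<phi> P"
    and supp: "AE s in m. s \<in> space m - P \<longrightarrow> (\<exists>n. F n s \<noteq> 0)"
  shows "type_II_infinity (ray_measure_on (space m - P))"
  unfolding type_II_infinity_def
proof
  let ?N = "space m - P"
  let ?Q = "ray_measure_on ?N"
  assume "\<exists>\<nu>. prob_space \<nu> \<and> sets \<nu> = sets ?Q \<and> invariant_measure shift \<nu> \<and> absolutely_continuous ?Q \<nu>"
  then obtain \<nu> where "prob_space \<nu>" and sets\<nu>: "sets \<nu> = sets ?Q"
    and inv\<nu>: "invariant_measure shift \<nu>" and ac\<nu>: "absolutely_continuous ?Q \<nu>" by auto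
  interpret \<nu>: prob_space \<nu> by fact
  have Pset: "positive_set m \<phi> P" and Pmax: "\<And>P'. positive_set m \<phi> P' \<Longrightarrow> P' - P \<in> null_sets m"
    using P by (auto simp: positive_part_def)
  have [measurable]: "P \<in> sets m" using Pset by (simp add: positive_set_def)
  have Ninv: "AE s in m. \<phi> s \<in> ?N \<longleftrightarrow> s \<in> ?N"
    using positive_set_invariant[OF Pset] AE_space by eventually_elim auto
  have Qinv: "invariant_measure shift ?Q"
    by (rule ray_measure_on_invariant[OF _ Ninv]) simp
  interpret Q: nonsingular_system ?Q shift
    by (rule nonsingular_system_shift[OF _ sigma_finite_ray_measure[OF _ supp] Qinv]) simp_all
  define q where "q = RN_deriv ?Q \<nu>"
  have [measurable]: "q \<in> borel_measurable seq_space"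
    using borel_measurable_RN_deriv[of ?Q \<nu>] unfolding q_def by simp
  have q_shift: "AE x in ?Q. q (shift x) = q x"
    unfolding q_def
    by (rule Q.invariant_RN_deriv'[OF Qinv \<nu>.sigma_finite_measure_axioms sets\<nu> ac\<nu> inv\<nu>])
  have dq: "density ?Q q = \<nu>"
    unfolding q_def by (rule Q.density_RN_deriv[OF ac\<nu> sets\<nu>])
  define K where "K z = indicator ?N (fst z) * q (ray z)" for z
  have [measurable]: "K \<in> borel_measurable polar_measure"
    unfolding K_def by measurable
  have K\<Phi>: "AE z in polar_measure. K (\<Phi> z) = K z"
  proof -
    \<comment> \<open>Invariance of \<open>q\<close> is known only almost everywhere for
      \<open>?Q\<close>, hence only along rays over \<open>?N\<close>; elsewhere the indicator makes
      \<open>K\<close> vanish.\<close>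
    have "AE z in polar_measure. 0 < (indicator ?N (fst z) :: ennreal) \<longrightarrow> q (shift (ray z)) = q (ray z)"
    proof -
      have "Measurable.pred seq_space (\<lambda>x. q (shift x) = q x)"
        unfolding pred_def by (rule borel_measurable_eq) measurable
      with q_shift show ?thesis by (subst (asm) AE_ray_measure) auto
    qed
    with shift_ray indicator_\<Phi>[OF Ninv] show ?thesis
      by eventually_elim (auto simp: K_def indicator_def split: if_splits)
  qed
  have K1: "(\<integral>\<^sup>+z. K z \<partial>polar_measure) = 1"
  proof -
    have "(\<integral>\<^sup>+z. K z \<partial>polar_measure) = (\<integral>\<^sup>+x. q x \<partial>?Q)"
      unfolding K_def by (rule nn_integral_ray_measure[symmetric]) measurable
    also have "\<dots> = emeasure (density ?Q q) (space ?Q)"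
      using sets.top[of seq_space] by (subst emeasure_density) auto
    also have "\<dots> = 1"
      unfolding dq using \<nu>.emeasure_space_1 sets_eq_imp_space_eq[OF sets\<nu>] by simp
    finally show ?thesis .
  qed
  \<comment> \<open>The radius is integrated out. The first projection intertwines
    \<open>\<Phi>\<close> with \<phi>, so invariance passes to the base.\<close>
  define \<mu> where "\<mu> = distr (density polar_measure K) m fst"
  have sets\<mu>[simp, measurable_cong]: "sets \<mu> = sets m" and space\<mu>[simp]: "space \<mu> = space m"
    by (simp_all add: \<mu>_def)
  have emeasure\<mu>: "emeasure \<mu> A = (\<integral>\<^sup>+z. K z * indicator A (fst z) \<partial>polar_measure)" if [measurable]: "A \<in> sets m" for A
  proof -
    have "emeasure \<mu> A = (\<integral>\<^sup>+s. indicator A s \<partial>\<mu>)" by simp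
    also have "\<dots> = (\<integral>\<^sup>+z. indicator A (fst z) \<partial>density polar_measure K)"
      unfolding \<mu>_def by (rule nn_integral_distr) measurable
    also have "\<dots> = (\<integral>\<^sup>+z. K z * indicator A (fst z) \<partial>polar_measure)"
      by (rule nn_integral_density) measurable
    finally show ?thesis .
  qed
  have \<mu>1: "emeasure \<mu> (space m) = 1"
  proof -
    have "emeasure \<mu> (space m) = (\<integral>\<^sup>+z. K z \<partial>polar_measure)"
      by (subst emeasure\<mu>) (auto simp: space_pair_measure intro!: nn_integral_cong)
    then show ?thesis by (simp add: K1)
  qed
  interpret \<mu>: prob_space \<mu>
    by (rule prob_spaceI) (simp add: \<mu>1)
  have ac: "absolutely_continuous m \<mu>"
    unfolding absolutely_continuous_def
  proof
    fix A assume A: "A \<in> null_sets m"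
    then have [measurable]: "A \<in> sets m" by auto
    have "AE z in polar_measure. K z * indicator A (fst z) = 0"
      using AE_polar_fst[OF AE_not_in[OF A]] by eventually_elim simp
    then have "emeasure \<mu> A = 0"
      by (simp add: emeasure\<mu> nn_integral_0_iff_AE)
    then show "A \<in> null_sets \<mu>" by (simp add: null_sets_def)
  qed
  have inv: "invariant_measure \<phi> \<mu>"
  proof -
    have "distr \<mu> \<mu> \<phi> = \<mu>"
    proof (rule measure_eqI)
      fix A assume "A \<in> sets (distr \<mu> \<mu> \<phi>)"
      then have [measurable]: "A \<in> sets m" by simp
      have "emeasure (distr \<mu> \<mu> \<phi>) A = emeasure \<mu> (\<phi> -` A \<inter> space m)"
        by (subst emeasure_distr) auto
      also have "\<dots> = (\<integral>\<^sup>+z. K z * indicator (\<phi> -` A \<inter> space m) (fst z) \<partial>polar_measure)"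
        by (rule emeasure\<mu>) measurable
      also have "\<dots> = (\<integral>\<^sup>+z. K (\<Phi> z) * indicator A (fst (\<Phi> z)) \<partial>polar_measure)"
        by (rule nn_integral_cong_AE)
          (use K\<Phi> AE_polar_fst[OF AE_space] in \<open>eventually_elim, auto simp: \<Phi>_def indicator_def\<close>)
      also have "\<dots> = (\<integral>\<^sup>+z. K z * indicator A (fst z) \<partial>polar_measure)"
        by (rule nn_integral_\<Phi>) measurable
      also have "\<dots> = emeasure \<mu> A"
        by (rule emeasure\<mu>[symmetric]) measurable
      finally show "emeasure (distr \<mu> \<mu> \<phi>) A = emeasure \<mu> A" .
    qed simp
    moreover have "\<phi> \<in> \<mu> \<rightarrow>\<^sub>M \<mu>" by measurable
    ultimately show ?thesis by (simp add: invariant_measure_def)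
  qed
  let ?P' = "{s\<in>space m. RN_deriv m \<mu> s \<noteq> 0}"
  \<comment> \<open>Maximality places the support of \<mu> inside \<open>P\<close>, whereas
    \<open>K\<close> vanishes over \<open>P\<close>; both together leave no room for a measure of
    mass 1.\<close>
  have "?P' - P \<in> null_sets m"
    by (intro Pmax positive_set_RN_deriv \<mu>.finite_measure_axioms sets\<mu> ac inv)
  then have 1: "AE s in \<mu>. s \<notin> ?P' - P"
    using ac by (intro AE_not_in) (auto simp: absolutely_continuous_def)
  have "emeasure \<mu> P = 0"
    by (subst emeasure\<mu>) (auto simp: K_def indicator_def intro!: nn_integral_zero')
  then have 2: "AE s in \<mu>. s \<notin> P"
    by (intro AE_not_in) (auto simp: null_sets_def)
  have "AE s in density m (RN_deriv m \<mu>). RN_deriv m \<mu> s \<noteq> 0"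
    by (subst AE_density) (auto intro: always_eventually)
  then have "AE s in \<mu>. RN_deriv m \<mu> s \<noteq> 0"
    unfolding density_RN_deriv[OF ac sets\<mu>] .
  with 1 2 AE_space[of \<mu>] have "AE s in \<mu>. False"
    by eventually_elim auto
  then show False
    using \<mu>.AE_False by simp
qed

end

section \<open>Characteristic functions of the components and conclusion\<close>

text \<open>A pairing with a finitely supported sequence is a finite linear combination of
  integrals, hence the integral of the combined kernel; one-dimensional characteristic functions
  therefore give the joint ones.\<close>

lemma (in sas_integration) char_law:
  fixes Z :: "int \<Rightarrow> 'w \<Rightarrow> real"
  assumes Z: "\<And>n. has_stoch_integral \<alpha> m \<Omega> M (g n) (Z n)" and fin: "finite {n. b n \<noteq> 0}"
  shows "(\<integral>x. iexp (pairing b x) \<partial>law \<Omega> Z) = complex_of_real (exp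
    (- enn2real (\<integral>\<^sup>+s. ennreal (\<bar>pairing b (\<lambda>n. g n s)\<bar> powr \<alpha>) \<partial>m)))"
proof -
  have "Z n \<in> borel_measurable \<Omega>" for n
    using Z[of n] by (simp add: has_stoch_integral_def)
  then have "(\<lambda>\<omega> n. Z n \<omega>) \<in> \<Omega> \<rightarrow>\<^sub>M seq_space"
    by (intro seq_space_measurableI)
  then have "(\<integral>x. iexp (pairing b x) \<partial>law \<Omega> Z) = (\<integral>\<omega>. iexp (pairing b (\<lambda>n. Z n \<omega>)) \<partial>\<Omega>)"
    unfolding law_def by (rule integral_distr) measurable
  also have "\<dots> = complex_of_real (exp
      (- enn2real (\<integral>\<^sup>+s. ennreal (\<bar>pairing b (\<lambda>n. g n s)\<bar> powr \<alpha>) \<partial>m)))"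
    unfolding pairing_def by (rule char_stoch_integral[OF has_stoch_integral_sum[OF fin Z]])
  finally show ?thesis .
qed

theorem proposition8p6:
  fixes \<alpha> :: real
    and \<Omega>' :: "'v measure" and X :: "int \<Rightarrow> 'v \<Rightarrow> real"
    and m :: "'s measure" and \<phi> :: "'s \<Rightarrow> 's" and a :: "int \<Rightarrow> 's \<Rightarrow> real" and f :: "'s \<Rightarrow> real"
    and \<Omega> :: "'w measure" and M :: "'s set \<Rightarrow> 'w \<Rightarrow> real"
    and D P :: "'s set"
    and Y X1 X2 X3 :: "int \<Rightarrow> 'w \<Rightarrow> real"
  assumes alpha: "0 < \<alpha>" "\<alpha> < 2"
    and X: "prob_space \<Omega>'" "\<And>n. X n \<in> borel_measurable \<Omega>'" "stationary_sas \<alpha> (law \<Omega>' X)"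
    and rep: "flow_representation \<alpha> m \<phi> a f"
    and M: "sas_random_measure \<alpha> m \<Omega> M"
    and Y: "integral_process_over \<alpha> m \<Omega> M (flow_kernel \<alpha> m \<phi> a f) (space m) Y"
    and X_Y: "law \<Omega>' X = law \<Omega> Y"
    and D: "dissipative_part m \<phi> D"
    and P: "positive_part m \<phi> P"
    and X1: "integral_process_over \<alpha> m \<Omega> M (flow_kernel \<alpha> m \<phi> a f) D X1"
    and X2: "integral_process_over \<alpha> m \<Omega> M (flow_kernel \<alpha> m \<phi> a f)
               ((space m - D) \<inter> (space m - P)) X2"
    and X3: "integral_process_over \<alpha> m \<Omega> M (flow_kernel \<alpha> m \<phi> a f) P X3"
  shows "(\<exists>Q. levy_measure (law \<Omega> X1) Q \<and> levy_dissipative Q) \<and>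
         (\<exists>Q. levy_measure (law \<Omega> (\<lambda>n \<omega>. X1 n \<omega> + X2 n \<omega>)) Q \<and> type_II_infinity Q) \<and>
         (\<exists>Q. levy_measure (law \<Omega> X3) Q \<and> type_II_1 Q)"
proof -
  have nonsing: "nonsingular_system m \<phi>" and sign: "sign_cocycle m \<phi> a" and f: "L_alpha \<alpha> m f"
    and supp: "AE s in m. \<exists>n. flow_kernel \<alpha> m \<phi> a f n s \<noteq> 0"
    using rep by (auto simp: flow_representation_def nonsingular_system_def nonsingular_system_axioms_def)
  \<comment> \<open>Possessing a stochastic integral includes membership in
    \<open>L\<^sup>\<alpha>\<close>; the indicator of the whole space is 1 wherever it
    matters.\<close>
  have "L_alpha \<alpha> m (flow_kernel \<alpha> m \<phi> a f n)" for n
  proof -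
    have "L_alpha \<alpha> m (\<lambda>s. indicator (space m) s * flow_kernel \<alpha> m \<phi> a f n s)"
      using Y by (simp add: integral_process_over_def has_stoch_integral_def)
    then show ?thesis
      by (simp add: L_alpha_def cong: measurable_cong nn_integral_cong)
  qed
  then interpret sas_flow m \<phi> \<alpha> a f
    by (intro sas_flow.intro nonsing sas_flow_axioms.intro alpha sign f)
  interpret sas_integration \<alpha> m \<Omega> M
    by unfold_locales (use alpha M in auto)
  have Ds[measurable]: "D \<in> sets m"
    using D by (simp add: dissipative_part_def measurable_union_def)
  have Pset: "positive_set m \<phi> P"
    using P by (simp add: positive_part_def)
  then have Ps[measurable]: "P \<in> sets m"
    by (simp add: positive_set_def)
  have supp': "AE s in m. s \<in> B \<longrightarrow> (\<exists>n. F n s \<noteq> 0)" for B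
    using supp by eventually_elim simp
  have DP: "AE s in m. s \<in> D \<longrightarrow> s \<notin> P"
    by (rule dissipative_part_Int_positive_set[OF D Pset])
  let ?N = "space m - P"
  have levy: "levy_measure \<mu> (ray_measure_on B)"
    if "B \<in> sets m" "AE s in m. \<phi> s \<in> B \<longleftrightarrow> s \<in> B"
      "\<And>b. finite {n. b n \<noteq> 0} \<Longrightarrow> (\<integral>x. iexp (pairing b x) \<partial>\<mu>) = complex_of_real (exp
        (- enn2real (\<integral>\<^sup>+s. ennreal (\<bar>pairing b (\<lambda>n. indicator B s * F n s)\<bar> powr \<alpha>) \<partial>m)))" for \<mu> B
    using that by (intro levy_measure_ray_measure supp' ray_measure_on_invariant)
  have "levy_measure (law \<Omega> X1) (ray_measure_on D)"
    by (intro levy Ds dissipative_part_invariant[OF D] char_law)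
      (use X1 in \<open>simp_all add: integral_process_over_def\<close>)
  moreover have "levy_measure (law \<Omega> X3) (ray_measure_on P)"
    by (intro levy Ps positive_set_invariant[OF Pset] char_law)
      (use X3 in \<open>simp_all add: integral_process_over_def\<close>)
  moreover have "levy_measure (law \<Omega> (\<lambda>n \<omega>. X1 n \<omega> + X2 n \<omega>)) (ray_measure_on ?N)"
  proof (rule levy)
    show "?N \<in> sets m" by measurable
    show "AE s in m. \<phi> s \<in> ?N \<longleftrightarrow> s \<in> ?N"
      using positive_set_invariant[OF Pset] AE_space by eventually_elim auto
    fix b :: "int \<Rightarrow> real" assume fin: "finite {n. b n \<noteq> 0}"
    \<comment> \<open>Both integrals are taken against the same random measure, so their sum has the
      summed kernel; since \<open>D\<close> almost misses \<open>P\<close>, this is the kernel cut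
      off to the complement of \<open>P\<close>.\<close>
    let ?g = "\<lambda>n s. indicator D s * F n s + indicator ((space m - D) \<inter> (space m - P)) s * F n s"
    have "(\<integral>x. iexp (pairing b x) \<partial>law \<Omega> (\<lambda>n \<omega>. X1 n \<omega> + X2 n \<omega>)) = complex_of_real (exp
        (- enn2real (\<integral>\<^sup>+s. ennreal (\<bar>pairing b (\<lambda>n. ?g n s)\<bar> powr \<alpha>) \<partial>m)))"
      using X1 X2 by (intro char_law[OF _ fin] has_stoch_integral_add) (simp_all add: integral_process_over_def)
    also have "(\<integral>\<^sup>+s. ennreal (\<bar>pairing b (\<lambda>n. ?g n s)\<bar> powr \<alpha>) \<partial>m) =
        (\<integral>\<^sup>+s. ennreal (\<bar>pairing b (\<lambda>n. indicator ?N s * F n s)\<bar> powr \<alpha>) \<partial>m)"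
    proof (rule nn_integral_cong_AE)
      show "AE s in m. ennreal (\<bar>pairing b (\<lambda>n. ?g n s)\<bar> powr \<alpha>) =
          ennreal (\<bar>pairing b (\<lambda>n. indicator ?N s * F n s)\<bar> powr \<alpha>)"
        using DP AE_space
      proof eventually_elim
        case (elim s)
        then have "?g n s = indicator ?N s * F n s" for n
          by (auto simp: indicator_def)
        then show ?case by simp
      qed
    qed
    finally show "(\<integral>x. iexp (pairing b x) \<partial>law \<Omega> (\<lambda>n \<omega>. X1 n \<omega> + X2 n \<omega>)) = complex_of_real (exp
        (- enn2real (\<integral>\<^sup>+s. ennreal (\<bar>pairing b (\<lambda>n. indicator ?N s * F n s)\<bar> powr \<alpha>) \<partial>m)))" .
  qed
  ultimately show ?thesis
    using levy_dissipative_ray_measure[OF D supp'] type_II_1_ray_measure[OF Pset]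
      type_II_infinity_ray_measure[OF P supp'] by blast
qed

end
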